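(* Let $N$ and $t$ be positive integers with $t+1\le N$. Then the following hold. (i) Let $\epsilon>0$. If $$t+1\le \frac{2\pi}{\left(\frac12+\epsilon\right)\log\left(N+\frac{t}{24}\right)}\sqrt{\frac{24(t+1)\left(N+\frac{t}{24}\right)}{t}},$$ then $$p(N,t)=\frac{\sqrt{12}\,A_t(N)\exp\left(\frac{2\pi}{\sqrt6}\sqrt{\frac{t}{t+1}\left(N+\frac{t}{24}\right)}\right)}{\exp\left(\rho_1\exp\left(-2\pi\sqrt{\frac{24N+t}{t(t+1)}}+O\left(N^{-1/2}\right)\right)\right)}\left(1+O\left(N^{-1/2}\right)\right)$$ for some real number $\rho_1$ (depending on $N,t$) with $1<\rho_1<1.00873$, where $$A_t(N)=t^{1/4}\bigl((t+1)(24N+t)\bigr)^{-3/4}.$$ (ii) Let $\epsilon>0$. If $$\frac{2\pi}{\left(\frac12+\epsilon\right)\log\left(N+\frac{t}{24}\right)}\sqrt{\frac{24(t+1)\left(N+\frac{t}{24}\right)}{t}}<t+1\le\sqrt{24N},$$ then $$p(N,t)\le\frac{\sqrt{12}\,(2t+1)^{3/4}\exp\left(\frac{2\pi}{\sqrt6}\sqrt{\frac{2t+1}{2t+2}\left(N+\frac{t}{24}\right)}\right)}{\sqrt{t-1}\,\bigl((24N+t)(2t+2)\bigr)^{3/4}\exp\left(\exp\left(-2\pi\sqrt{\frac{24N+t}{t(t+1)}}\right)\right)}\left(1+O\left(N^{-1/2}\right)\right).$$ (iii) If $t+1>\sqrt{24N}$, then $$p(N,t)=p(N)\exp\left(-\nu_1\exp\left(-\frac{\pi(t+1)}{\sqrt{6N}}\left(1+O\left(N^{-1/2}\right)\right)\right)\right)\left(1+O\left(N^{-1/2}\right)\right)$$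 for some real number $\nu_1$ (depending on $N,t$) with $1<\nu_1<1.00873$.
   Context: $p(N)$ denotes the number of partitions of $N$. $p(N,t)$ denotes the number of $(t+1)$-regular partitions of $N$, i.e. partitions of $N$ none of whose parts is divisible by $t+1$. The $O$-terms are understood as $N\to\infty$, uniformly in $t$ in the indicated range; implied constants may depend on $\epsilon$ only. *)

theory Defs
  imports Complex_Main "HOL-Library.Multiset" "HOL-Library.Landau_Symbols"
begin

text \<open>A partition is the multiset of its (positive) parts.\<close>

definition partitions :: "nat \<Rightarrow> nat multiset set" where
  "partitions N = {M. (\<forall>x\<in>#M. x > 0) \<and> sum_mset M = N}"

definition num_partitions :: "nat \<Rightarrow> nat" where
  "num_partitions N = card (partitions N)"

text \<open>\<open>p(N, t)\<close> counts the \<open>(t + 1)\<close>-regular partitions, not the \<open>t\<close>-regular ones.\<close>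

definition num_regular_partitions :: "nat \<Rightarrow> nat \<Rightarrow> nat" where
  "num_regular_partitions N t = card {M \<in> partitions N. \<forall>x\<in>#M. \<not> (t + 1) dvd x}"

lemma finite_partitions: "finite (partitions N)"
proof (rule finite_subset)
  show "partitions N \<subseteq> mset ` {xs. set xs \<subseteq> {..N} \<and> length xs \<le> N}"
  proof
    fix M assume "M \<in> partitions N"
    then have pos: "\<forall>x\<in>#M. x > 0" and sum: "sum_mset M = N"
      by (auto simp: partitions_def)
    obtain xs where M: "M = mset xs" using ex_mset[of M] by auto
    have "length xs \<le> sum_list xs" if "\<forall>x\<in>set xs. x > 0" for xs :: "nat list"
      using that by (induction xs) auto
    from this[of xs] pos sum M have "length xs \<le> N" by (auto simp: sum_mset_sum_list)
    moreover have "set xs \<subseteq> {..N}"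
      using sum M member_le_sum_list[of _ xs] by (auto simp: sum_mset_sum_list)
    ultimately show "M \<in> mset ` {xs. set xs \<subseteq> {..N} \<and> length xs \<le> N}" using M by auto
  qed
  show "finite (mset ` {xs. set xs \<subseteq> {..N} \<and> length xs \<le> N})"
    by (intro finite_imageI finite_lists_length_le) auto
qed

definition A_coeff :: "nat \<Rightarrow> nat \<Rightarrow> real" where
  "A_coeff t N = real t powr (1/4) * ((real t + 1) * (24 * real N + real t)) powr (-3/4)"

text \<open>The value of \<open>t + 1\<close> that separates the ranges of the first two parts.\<close>

definition threshold :: "real \<Rightarrow> nat \<Rightarrow> nat \<Rightarrow> real" where
  "threshold \<epsilon> N t =
     2 * pi / ((1/2 + \<epsilon>) * ln (real N + real t / 24)) *
     sqrt (24 * (real t + 1) * (real N + real t / 24) / real t)"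

text \<open>
  An error term \<open>O(N\<^sup>-\<^sup>1\<^sup>/\<^sup>2)\<close> as \<open>N\<close> tends to infinity, uniformly in \<open>t\<close>: the filter
  \<open>top\<close> in the second component means that nothing is required of \<open>t\<close>. When uniformity is
  only meant on some range of \<open>t\<close>, the error may be taken to be 0 outside of that range.
\<close>

definition error_term :: "(nat \<Rightarrow> nat \<Rightarrow> real) \<Rightarrow> bool" where
  "error_term E \<longleftrightarrow>
     (\<lambda>(N, t). E N t) \<in> O[sequentially \<times>\<^sub>F top](\<lambda>(N, t). real N powr (-1/2))"

lemma error_term_iff:
  "error_term E \<longleftrightarrow> (\<exists>C N0. \<forall>N\<ge>N0. \<forall>t. \<bar>E N t\<bar> \<le> C * real N powr (-1/2))"
proof
  assume "error_term E"
  then obtain C where "eventually (\<lambda>x. norm ((\<lambda>(N, t). E N t) x) \<le>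
      C * norm ((\<lambda>(N, t). real N powr (-1/2)) x)) (sequentially \<times>\<^sub>F (top :: nat filter))"
    unfolding error_term_def by (elim landau_o.bigE)
  then show "\<exists>C N0. \<forall>N\<ge>N0. \<forall>t. \<bar>E N t\<bar> \<le> C * real N powr (-1/2)"
    unfolding eventually_prod_filter eventually_top eventually_sequentially
    by (auto; metis)
next
  assume "\<exists>C N0. \<forall>N\<ge>N0. \<forall>t. \<bar>E N t\<bar> \<le> C * real N powr (-1/2)"
  then obtain C N0 where *: "\<And>N t. N \<ge> N0 \<Longrightarrow> \<bar>E N t\<bar> \<le> C * real N powr (-1/2)" by auto
  show "error_term E"
    unfolding error_term_def
  proof (rule bigoI[of _ C])
    show "\<forall>\<^sub>F x in sequentially \<times>\<^sub>F (top :: nat filter). norm (case x of (N, t) \<Rightarrow> E N t) \<le>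
        C * norm (case x of (N, t :: nat) \<Rightarrow> real N powr (-1/2))"
      unfolding eventually_prod_filter eventually_top eventually_sequentially
      by (rule exI[of _ "\<lambda>N. N \<ge> N0"], rule exI[of _ "\<lambda>_. True"]) (use * in auto)
  qed
qed

end

theory Submission
  imports
    Defs
    "HOL-Complex_Analysis.Complex_Analysis"
    "HOL-Probability.Distributions"
    "HOL-Real_Asymp.Real_Asymp"
begin

text \<open>
  The generating function of the \<open>q\<close>-regular partitions, \<open>q = t + 1\<close>, is \<open>F(z) / F(q z)\<close> with
  \<open>F(z) = \<Prod>\<^sub>n 1 / (1 - exp (- n z))\<close>. The modular transformation \<open>z \<mapsto> 4 \<pi>\<^sup>2 / z\<close> of \<open>F\<close> turns
  \<open>exp (N z) F(z) / F(q z)\<close> into \<open>exp (a / z + M z) / sqrt q\<close> times \<open>F(4 \<pi>\<^sup>2 / z) / F(4 \<pi>\<^sup>2 / (q z))\<close>,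
  where \<open>a = \<pi>\<^sup>2 t / (6 q)\<close> and \<open>M = N + t / 24\<close>. With the saddle point \<open>s = sqrt (a / M)\<close> and
  \<open>z = s (1 + i u)\<close>, the exponent is \<open>X (2 - u\<^sup>2 / (1 + i u))\<close> for \<open>X = s M\<close>, so that the main term
  is a Gaussian integral up to a relative error \<open>O(1 / X)\<close>, which is \<open>O(1 / sqrt N)\<close>; the part
  \<open>\<bar>u\<bar> > 1\<close> of the circle is exponentially small.

  In range (i), \<open>y = exp (- 4 \<pi>\<^sup>2 / (q s))\<close> is \<open>O(1 / sqrt N)\<close>, hence so is
  \<open>F(4 \<pi>\<^sup>2 / z) / F(4 \<pi>\<^sup>2 / (q z)) - 1\<close>, and any admissible \<open>\<rho>\<^sub>1\<close> works. In range (ii), the asserted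
  bound exceeds the main term by a factor of at least \<open>exp (\<pi> / 24 - y)\<close>, which leaves room for crude
  estimates. In range (iii), the factor \<open>1 / F(q z)\<close> is not transformed, but replaced by its value at
  the saddle point \<open>s = \<pi> / sqrt (6 N)\<close> of \<open>F\<close>, where it equals \<open>exp (- \<nu>\<^sub>1 exp (- q s))\<close>.
\<close>

section \<open>The modular transformation of the partition generating function\<close>

text \<open>The difficulty is uniformity in t. The border q = sqrt (24 N) is the fixed point of the
  modular transformation: with s = pi / sqrt (6 N), both q s and 4 pi^2 / (q s) equal 2 pi there.
  Below it F(q z) is transformed, above it F(q z) is used as it stands; for large N the argument of
  this factor then has real part at least 2 pi at the saddle point in all ranges, and all constants
  are absolute. The decay along the circle is obtained without the transformation: in the logarithm
  of each factor of the product only the first term of the series is compared with its value on the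
  real axis. The sum over the parts has a closed form in cos \<theta> and cosh s, from which the
  multiples of q can be subtracted. The error terms are existentially quantified. The ones inside
  exponentials, and the one in (ii), are taken to be 0; the remaining ones are solved from the
  asserted equations, so that the work lies in showing that they are O(N^(-1/2)).\<close>

lemma sinh_product_ln_sums:
  fixes u :: real
  assumes "u > 0"
  shows "(\<lambda>k. ln (1 + u\<^sup>2 / (4 * pi\<^sup>2 * (real (Suc k))\<^sup>2))) sums (ln (sinh (u / 2)) - ln (u / 2))"
proof -
  \<comment> \<open>At this imaginary point the factors of Euler's sine product become 1 + u^2 / (4
    pi^2 k^2) > 0, so that logarithms turn the product into a series that can be differentiated
    termwise.\<close>
  define z where "z = \<i> * of_real (u / (2 * pi))"
  have 1: "(\<lambda>n. of_real pi * z * (\<Prod>k=1..n. 1 - z^2 / of_nat k^2)) \<longlonglongrightarrow> sin (of_real pi * z)"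
    by (rule sin_product_formula_complex)
  have z2: "z^2 = - of_real ((u / (2*pi))\<^sup>2)" by (simp add: z_def power_mult_distrib power_divide)
  have eq: "of_real pi * z * (\<Prod>k=1..n. 1 - z^2 / of_nat k^2) =
     \<i> * of_real (u / 2 * (\<Prod>k=1..n. 1 + u\<^sup>2 / (4 * pi\<^sup>2 * (real k)\<^sup>2)))" for n
    unfolding z2 by (simp add: z_def power_divide power_mult_distrib field_simps)
  have sin: "sin (of_real pi * z) = \<i> * of_real (sinh (u/2))"
  proof -
    have "of_real pi * z = \<i> * of_real (u / 2)" by (simp add: z_def)
    thus ?thesis
      by (simp only:)
         (simp add: sin_exp_eq sinh_def scaleR_conv_of_real exp_of_real [symmetric],
          simp add: field_simps exp_of_real)
  qed
  have "(\<lambda>n. Im (\<i> * of_real (u / 2 * (\<Prod>k=1..n. 1 + u\<^sup>2 / (4 * pi\<^sup>2 * (real k)\<^sup>2))))) \<longlonglongrightarrow> Im (\<i> * of_real (sinh (u/2)))"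
    using 1 unfolding eq sin by (rule tendsto_Im)
  hence "(\<lambda>n. u / 2 * (\<Prod>k=1..n. 1 + u\<^sup>2 / (4 * pi\<^sup>2 * (real k)\<^sup>2))) \<longlonglongrightarrow> sinh (u/2)"
    by (simp only: Im_i_times Re_complex_of_real)
  hence "(\<lambda>n. ln (u / 2 * (\<Prod>k=1..n. 1 + u\<^sup>2 / (4 * pi\<^sup>2 * (real k)\<^sup>2)))) \<longlonglongrightarrow> ln (sinh (u/2))"
    using assms by (intro tendsto_ln) auto
  also have "(\<lambda>n. ln (u / 2 * (\<Prod>k=1..n. 1 + u\<^sup>2 / (4 * pi\<^sup>2 * (real k)\<^sup>2)))) =
     (\<lambda>n. ln (u/2) + (\<Sum>k<n. ln (1 + u\<^sup>2 / (4 * pi\<^sup>2 * (real (Suc k))\<^sup>2))))"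
  proof
    fix n
    have pos: "1 + u\<^sup>2 / (4 * pi\<^sup>2 * (real k)\<^sup>2) > 0" for k
      by (intro add_pos_nonneg) auto
    have "(\<Prod>k=1..n. 1 + u\<^sup>2 / (4 * pi\<^sup>2 * (real k)\<^sup>2)) > 0" using pos by (intro prod_pos) auto
    hence "ln (u / 2 * (\<Prod>k=1..n. 1 + u\<^sup>2 / (4 * pi\<^sup>2 * (real k)\<^sup>2))) =
       ln (u/2) + ln (\<Prod>k=1..n. 1 + u\<^sup>2 / (4 * pi\<^sup>2 * (real k)\<^sup>2))"
      using assms by (intro ln_mult_pos) auto
    also have "ln (\<Prod>k=1..n. 1 + u\<^sup>2 / (4 * pi\<^sup>2 * (real k)\<^sup>2)) =
       (\<Sum>k=1..n. ln (1 + u\<^sup>2 / (4 * pi\<^sup>2 * (real k)\<^sup>2)))"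
      using pos by (intro ln_prod) (auto simp: less_imp_neq[symmetric])
    also have "\<dots> = (\<Sum>k<n. ln (1 + u\<^sup>2 / (4 * pi\<^sup>2 * (real (Suc k))\<^sup>2)))"
      by (rule sum.reindex_bij_witness[of _ Suc "\<lambda>k. k - 1"]) auto
    finally show "ln (u / 2 * (\<Prod>k=1..n. 1 + u\<^sup>2 / (4 * pi\<^sup>2 * (real k)\<^sup>2))) =
        ln (u/2) + (\<Sum>k<n. ln (1 + u\<^sup>2 / (4 * pi\<^sup>2 * (real (Suc k))\<^sup>2)))" .
  qed
  finally have "(\<lambda>n. ln (u/2) + (\<Sum>k<n. ln (1 + u\<^sup>2 / (4 * pi\<^sup>2 * (real (Suc k))\<^sup>2))) - ln (u/2))
      \<longlonglongrightarrow> ln (sinh (u/2)) - ln (u/2)" by (intro tendsto_intros)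
  thus ?thesis by (simp add: sums_def)
qed

lemma summable_inverse_Suc_squares: "summable (\<lambda>k. 1 / (real (Suc k))\<^sup>2)"
  using inverse_squares_sums by (simp add: sums_iff add.commute)

text \<open>Logarithmic derivative of the product for sinh (u/2), together with coth (u/2) / 2 = 1 /
  (exp u - 1) + 1/2. Termwise differentiation is justified on a bounded interval around u, where the
  derivatives are O(1 / k^2) uniformly.\<close>

lemma coth_partial_fractions:
  fixes u :: real
  assumes "u > 0"
  shows "(\<lambda>k. 2 * u / (u\<^sup>2 + 4 * pi\<^sup>2 * (real (Suc k))\<^sup>2)) sums (1 / (exp u - 1) - 1 / u + 1 / 2)"
proof -
  define S where "S = {0<..<u+1}"
  define f where "f = (\<lambda>k (x::real). ln (1 + x\<^sup>2 / (4 * pi\<^sup>2 * (real (Suc k))\<^sup>2)))"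
  define f' where "f' = (\<lambda>k (x::real). 2 * x / (x\<^sup>2 + 4 * pi\<^sup>2 * (real (Suc k))\<^sup>2))"
  have pos: "x\<^sup>2 + 4 * pi\<^sup>2 * (real (Suc k))\<^sup>2 > 0" for x k
    by (intro add_nonneg_pos) auto
  have deriv: "(f n has_field_derivative f' n x) (at x within S)" if "x \<in> S" for n x
  proof -
    have "1 + x\<^sup>2 / (4 * pi\<^sup>2 * (real (Suc n))\<^sup>2) > 0" by (intro add_pos_nonneg) auto
    thus ?thesis unfolding f_def f'_def using pos[of x n]
      by (auto intro!: derivative_eq_intros simp: field_simps simp del: of_nat_Suc)
  qed
  have unif: "uniformly_convergent_on S (\<lambda>n x. \<Sum>i<n. f' i x)"
  proof (rule Weierstrass_m_test')
    show "summable (\<lambda>k. 2 * (u+1) * (1 / (real (Suc k))\<^sup>2))"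
      by (intro summable_mult summable_inverse_Suc_squares)
  next
    fix n x assume x: "x \<in> S"
    have pi2: "4 * pi\<^sup>2 \<ge> 1" using one_le_power[of pi 2] pi_gt3 by linarith
    have "(real (Suc n))\<^sup>2 \<le> 4 * pi\<^sup>2 * (real (Suc n))\<^sup>2"
      using mult_right_mono[OF pi2, of "(real (Suc n))\<^sup>2"] by simp
    hence "(real (Suc n))\<^sup>2 \<le> x\<^sup>2 + 4 * pi\<^sup>2 * (real (Suc n))\<^sup>2" by (smt (verit) zero_le_power2)
    hence "f' n x \<le> 2 * (u+1) / (real (Suc n))\<^sup>2"
      unfolding f'_def using x assms by (intro frac_le) (auto simp: S_def simp del: of_nat_Suc)
    moreover have "f' n x \<ge> 0" unfolding f'_def using x pos[of x n] by (auto simp: S_def simp del: of_nat_Suc)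
    ultimately show "norm (f' n x) \<le> 2 * (u+1) * (1 / (real (Suc n))\<^sup>2)" by simp
  qed
  have u: "u \<in> S" "u \<in> interior S" using assms by (auto simp: S_def)
  have sm: "summable (\<lambda>n. f n u)" using sinh_product_ln_sums[OF assms] by (simp add: f_def sums_iff)
  have D: "((\<lambda>x. \<Sum>n. f n x) has_field_derivative (\<Sum>n. f' n u)) (at u)"
    by (rule has_field_derivative_series'(2)[OF _ deriv unif u(1) sm u(2)]) (auto simp: S_def)
  have sum: "summable (\<lambda>n. f' n u)"
    using uniformly_convergent_imp_convergent[OF unif u(1)] by (simp add: summable_iff_convergent)
  have ev: "eventually (\<lambda>x. (\<Sum>n. f n x) = ln (sinh (x/2)) - ln (x/2)) (nhds u)"
  proof -
    have "eventually (\<lambda>x. x \<in> {0<..}) (nhds u)" using assms by (intro eventually_nhds_in_open) auto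
    thus ?thesis by eventually_elim (use sinh_product_ln_sums in \<open>simp add: f_def sums_iff\<close>)
  qed
  have "((\<lambda>x. ln (sinh (x/2)) - ln (x/2)) has_field_derivative (\<Sum>n. f' n u)) (at u)"
    using D DERIV_cong_ev[OF refl ev refl] by simp
  moreover have "((\<lambda>x. ln (sinh (x/2)) - ln (x/2)) has_field_derivative
      (cosh (u/2) / (2 * sinh (u/2)) - 1 / u)) (at u)"
    using assms by (auto intro!: derivative_eq_intros simp: field_simps)
  ultimately have "(\<Sum>n. f' n u) = cosh (u/2) / (2 * sinh (u/2)) - 1 / u"
    by (rule DERIV_unique)
  also have "cosh (u/2) / (2 * sinh (u/2)) = 1 / (exp u - 1) + 1/2"
  proof -
    define e where "e = exp (u/2)"
    have e: "e > 1" "exp u = e\<^sup>2" "exp (-(u/2)) = 1/e" using assms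
      by (auto simp: e_def exp_minus field_simps simp flip: exp_of_nat_mult exp_add power2_eq_square)
    have c: "cosh (u/2) = (e + 1/e)/2" "sinh (u/2) = (e - 1/e)/2"
      unfolding cosh_def sinh_def e(3) by (simp_all add: e_def)
    have "e\<^sup>2 > 1" using e(1) by (simp add: one_less_power)
    thus ?thesis unfolding c e(2) using e(1) by (simp add: divide_simps power2_eq_square) (simp add: algebra_simps)
  qed
  finally show ?thesis using sum by (simp add: sums_iff f'_def)
qed

section \<open>Truncation errors of the Lambert series\<close>

lemma decreasing_series_tail:
  fixes f F :: "real \<Rightarrow> real" and J :: nat
  assumes nonneg: "\<And>x. x \<ge> real J \<Longrightarrow> f x \<ge> 0"
    and anti: "\<And>x y. real J \<le> x \<Longrightarrow> x \<le> y \<Longrightarrow> f y \<le> f x"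
    and deriv: "\<And>x. x \<ge> real J \<Longrightarrow> (F has_real_derivative f x) (at x)"
    and lim: "(F \<longlongrightarrow> L) at_top"
  shows "summable (\<lambda>k. f (real (k + J + 1)))"
    and "(\<Sum>k. f (real (k + J + 1))) \<le> L - F (real J)"
    and "L - F (real J) - f (real J) \<le> (\<Sum>k. f (real (k + J + 1)))"
proof -
  define d where "d = (\<lambda>k. F (real (Suc k + J)) - F (real (k + J)))"
  \<comment> \<open>By the mean value theorem, the increment of \<open>F\<close> over a unit
    interval lies between the values of \<open>f\<close> at its ends. The increments telescope,
    which is the integral test with an error of at most \<open>f (real J)\<close>.\<close>
  have d: "f (real (k + J + 1)) \<le> d k \<and> d k \<le> f (real (k + J))" for k
  proof -
    obtain z where z: "real (k + J) < z" "z < real (Suc k + J)"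
       "d k = (real (Suc k + J) - real (k + J)) * f z"
      unfolding d_def using MVT2[of "real (k + J)" "real (Suc k + J)" F f] deriv by auto
    thus ?thesis using anti[of z "real (k + J + 1)"] anti[of "real (k + J)" z] by simp
  qed
  have "(\<lambda>k. F (real (k + J))) \<longlonglongrightarrow> L"
    by (rule filterlim_compose[OF lim]) real_asymp
  hence sums: "d sums (L - F (real J))"
    unfolding d_def using telescope_sums[of "\<lambda>k. F (real (k + J))" L] by simp
  show sm: "summable (\<lambda>k. f (real (k + J + 1)))"
    by (rule summable_comparison_test'[of d 0]) (use sums d nonneg in \<open>auto simp: sums_iff\<close>)
  show "(\<Sum>k. f (real (k + J + 1))) \<le> L - F (real J)"
    using suminf_le[of "\<lambda>k. f (real (k + J + 1))" d] sm d sums by (simp add: sums_iff)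
  have sm': "summable (\<lambda>k. f (real (k + J)))"
    using sm by (subst summable_Suc_iff [symmetric]) simp
  have "L - F (real J) \<le> (\<Sum>k. f (real (k + J)))"
    using suminf_le[of d "\<lambda>k. f (real (k + J))"] sm' d sums by (simp add: sums_iff)
  also have "\<dots> = (\<Sum>k. f (real (k + J + 1))) + f (real J)"
    using suminf_split_head[OF sm'] by simp
  finally show "L - F (real J) - f (real J) \<le> (\<Sum>k. f (real (k + J + 1)))" by simp
qed

text \<open>The integral over [J, \<infinity>) is (pi/2 - arctan (b J / c)) / (b c). The reflection
  formula for arctan gives the form used here, in which the argument c / (b J) later becomes a point
  of a subdivision of [0, 1].\<close>

lemma inverse_quadratic_tail:
  fixes a b c :: real and J :: nat
  assumes "c > 0" "b > 0" "J > 0"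
  defines "S \<equiv> (\<Sum>k. 1 / (c\<^sup>2 + b\<^sup>2 * (real (k + J + 1))\<^sup>2))"
  shows "summable (\<lambda>k. 1 / (c\<^sup>2 + b\<^sup>2 * (real (k + J + 1))\<^sup>2))"
    and "\<bar>S - arctan (c / (b * J)) / (b * c)\<bar> \<le> 1 / (b\<^sup>2 * (real J)\<^sup>2)"
proof -
  define f where "f = (\<lambda>x. 1 / (c\<^sup>2 + b\<^sup>2 * x\<^sup>2))"
  define F where "F = (\<lambda>x. arctan (b * x / c) / (b * c))"
  have pos: "c\<^sup>2 + b\<^sup>2 * x\<^sup>2 > 0" for x using assms by (intro add_pos_nonneg) auto
  have 1: "f x \<ge> 0" for x unfolding f_def using pos[of x] by simp
  have 2: "f y \<le> f x" if "real J \<le> x" "x \<le> y" for x y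
    unfolding f_def using that pos[of x] assms by (intro divide_left_mono mult_pos_pos pos) (auto intro!: mult_left_mono power_mono)
  have 3: "(F has_real_derivative f x) (at x)" for x
  proof -
    have "1 + (b * x / c)\<^sup>2 = (c\<^sup>2 + b\<^sup>2 * x\<^sup>2) / c\<^sup>2" using assms by (simp add: field_simps)
    moreover have "(F has_real_derivative (b / c * inverse (1 + (b * x / c)\<^sup>2) / (b * c))) (at x)"
      unfolding F_def using assms by (auto intro!: derivative_eq_intros)
    moreover have "b / c * inverse (Q / c\<^sup>2) / (b * c) = 1 / Q" if "Q > 0" for Q
      using that assms by (simp add: field_simps power2_eq_square)
    ultimately show ?thesis using pos[of x] by (simp add: f_def)
  qed
  have 4: "(F \<longlongrightarrow> (pi/2) / (b * c)) at_top"
  proof -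
    have "filterlim (\<lambda>x. b * x / c) at_top at_top" using assms by real_asymp
    thus ?thesis unfolding F_def using assms by (intro tendsto_intros filterlim_compose[OF tendsto_arctan_at_top]) auto
  qed
  note * = decreasing_series_tail[of J f F, OF 1 2 3 4]
  show "summable (\<lambda>k. 1 / (c\<^sup>2 + b\<^sup>2 * (real (k + J + 1))\<^sup>2))" using *(1) by (simp add: f_def)
  have "arctan (1 / (b * J / c)) = pi/2 - arctan (b * J / c)"
    using arctan_inverse[of "b * J / c"] assms by auto
  hence eq: "(pi/2) / (b * c) - F J = arctan (c / (b * J)) / (b * c)"
    by (simp add: F_def diff_divide_distrib)
  have "f J \<le> 1 / (b\<^sup>2 * (real J)\<^sup>2)" unfolding f_def using assms
    by (intro divide_left_mono) (auto intro!: mult_pos_pos add_pos_pos)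
  thus "\<bar>S - arctan (c / (b * J)) / (b * c)\<bar> \<le> 1 / (b\<^sup>2 * (real J)\<^sup>2)"
    using *(2,3) unfolding eq S_def f_def [symmetric] by (simp add: f_def)
qed

text \<open>The right Riemann sum of mesh 1/K for the integral of arctan x / x over [0, 1]; the mesh
  has been cancelled against the denominator of the integrand.\<close>

definition arctan_riemann :: "nat \<Rightarrow> real" where
  "arctan_riemann K = (\<Sum>m<K. arctan (real (Suc m) / real K) / real (Suc m))"

definition arctan_quot :: "real \<Rightarrow> real" where
  "arctan_quot x = (if x = 0 then 1 else arctan x / x)"

lemma arctan_quot_antimono:
  assumes "0 \<le> x" "x \<le> y"
  shows "arctan_quot y \<le> arctan_quot x"
proof (cases "x = 0")
  case True
  thus ?thesis using arctan_le_self[of y] assms by (auto simp: arctan_quot_def field_simps)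
next
  case False
  with assms have xy: "0 < x" "0 < y" by auto
  \<comment> \<open>The derivative of arctan t / t has the sign of t / (1 + t^2) - arctan t.\<close>
  have aux: "arctan t - t / (1 + t\<^sup>2) \<ge> 0" if "t \<ge> 0" for t :: real
  proof -
    have "arctan 0 - 0 / (1 + 0\<^sup>2) \<le> arctan t - t / (1 + t\<^sup>2)"
    proof (rule DERIV_nonneg_imp_nondecreasing[OF that])
      fix z :: real
      have p: "1 + z\<^sup>2 > 0" by (intro add_pos_nonneg) auto
      have "((\<lambda>t. arctan t - t / (1 + t\<^sup>2)) has_real_derivative (2 * z\<^sup>2 / (1 + z\<^sup>2)\<^sup>2)) (at z)"
      proof -
        have "((\<lambda>t. arctan t - t / (1 + t\<^sup>2)) has_real_derivative
            (inverse (1 + z\<^sup>2) - (1 * (1 + z\<^sup>2) - z * (2 * z)) / (1 + z\<^sup>2)\<^sup>2)) (at z)"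
          using p by (auto intro!: derivative_eq_intros simp: power2_eq_square)
        also have "inverse (1 + z\<^sup>2) = (1 + z\<^sup>2) / (1 + z\<^sup>2)\<^sup>2"
          using p power2_eq_square[of "1 + z\<^sup>2"] by (simp add: inverse_eq_divide)
        also have "\<dots> - (1 * (1 + z\<^sup>2) - z * (2 * z)) / (1 + z\<^sup>2)\<^sup>2 = 2 * z\<^sup>2 / (1 + z\<^sup>2)\<^sup>2"
          by (simp only: diff_divide_distrib [symmetric]) (simp add: power2_eq_square)
        finally show ?thesis .
      qed
      thus "\<exists>D. ((\<lambda>t. arctan t - t / (1 + t\<^sup>2)) has_real_derivative D) (at z) \<and> 0 \<le> D" using p by fastforce
    qed
    thus ?thesis by simp
  qed
  have "arctan y / y \<le> arctan x / x"
  proof (rule DERIV_nonpos_imp_nonincreasing[OF assms(2)])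
    fix z assume z: "x \<le> z" "z \<le> y"
    have p: "1 + z\<^sup>2 > 0" by (intro add_pos_nonneg) auto
    have "((\<lambda>t. arctan t / t) has_real_derivative (- (arctan z - z / (1 + z\<^sup>2)) / z\<^sup>2)) (at z)"
    proof -
      have "((\<lambda>t. arctan t / t) has_real_derivative ((inverse (1 + z\<^sup>2) * z - arctan z * 1) / (z * z))) (at z)"
        using p z xy by (auto intro!: derivative_eq_intros)
      thus ?thesis by (simp add: power2_eq_square divide_inverse mult.commute)
    qed
    moreover have "- (arctan z - z / (1 + z\<^sup>2)) / z\<^sup>2 \<le> 0"
      using aux[of z] z xy by (intro divide_nonpos_nonneg) auto
    ultimately show "\<exists>D. ((\<lambda>t. arctan t / t) has_real_derivative D) (at z) \<and> D \<le> 0" by blast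
  qed
  thus ?thesis using xy by (simp add: arctan_quot_def)
qed

text \<open>For a decreasing integrand, the values in a cell of the coarse subdivision lie between
  those at the two ends of the cell. The left and the right sum differ by at most the value 1 at 0,
  times the mesh.\<close>

lemma arctan_riemann_refine:
  assumes "K > 0" "L > 0"
  shows "\<bar>arctan_riemann (K * L) - arctan_riemann K\<bar> \<le> 1 / real K"
proof -
  have R: "arctan_riemann n = (\<Sum>m<n. arctan_quot (real (Suc m) / real n)) / real n" if "n > 0" for n
    unfolding arctan_riemann_def arctan_quot_def sum_divide_distrib using that by (intro sum.cong) auto
  have "(\<Sum>m<K*L. arctan_quot (real (Suc m) / real (K * L))) =
        (\<Sum>m<K. \<Sum>j\<in>{m*L..<m*L+L}. arctan_quot (real (Suc j) / real (K * L)))"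
    by (simp add: sum.nat_group)
  also have "\<dots> = (\<Sum>m<K. \<Sum>i<L. arctan_quot (real (Suc (m * L + i)) / real (K * L)))"
  proof (rule sum.cong[OF refl])
    fix m
    show "(\<Sum>j\<in>{m*L..<m*L+L}. arctan_quot (real (Suc j) / real (K * L))) =
          (\<Sum>i<L. arctan_quot (real (Suc (m * L + i)) / real (K * L)))"
      by (rule sum.reindex_bij_witness[of _ "\<lambda>i. m * L + i" "\<lambda>j. j - m * L"]) auto
  qed
  finally have eq: "(\<Sum>m<K*L. arctan_quot (real (Suc m) / real (K * L))) = \<dots>" .
  have lo: "(\<Sum>m<K. \<Sum>i<L. arctan_quot (real (Suc (m * L + i)) / real (K * L))) \<ge>
        (\<Sum>m<K. \<Sum>i<L. arctan_quot (real (Suc m) / real K))"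
  proof (intro sum_mono arctan_quot_antimono)
    fix m i assume "i \<in> {..<L}"
    hence "Suc (m * L + i) \<le> Suc m * L" by simp
    hence "real (Suc (m * L + i)) \<le> real (Suc m) * real L" by (metis of_nat_le_iff of_nat_mult)
    hence "real (Suc (m * L + i)) / real (K * L) \<le> real (Suc m) * real L / real (K * L)"
      by (intro divide_right_mono) auto
    thus "real (Suc (m * L + i)) / real (K * L) \<le> real (Suc m) / real K"
      using assms by simp
  qed (use assms in auto)
  have hi: "(\<Sum>m<K. \<Sum>i<L. arctan_quot (real (Suc (m * L + i)) / real (K * L))) \<le>
        (\<Sum>m<K. \<Sum>i<L. arctan_quot (real m / real K))"
    by (intro sum_mono arctan_quot_antimono) (use assms in \<open>auto simp: field_simps\<close>)
  have "(\<Sum>m<K. arctan_quot (real m / real K)) \<le> 1 + (\<Sum>m<K. arctan_quot (real (Suc m) / real K))"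
  proof -
    have "(\<Sum>m<K. arctan_quot (real m / real K)) \<le> (\<Sum>m<Suc K. arctan_quot (real m / real K))"
      using arctan_quot_antimono[of 0 1] by (simp add: arctan_quot_def)
    also have "\<dots> = 1 + (\<Sum>m<K. arctan_quot (real (Suc m) / real K))"
      by (subst sum.lessThan_Suc_shift) (simp add: arctan_quot_def)
    finally show ?thesis .
  qed
  moreover define T S where "T = (\<Sum>m<K. \<Sum>i<L. arctan_quot (real (Suc (m * L + i)) / real (K * L)))"
    and "S = (\<Sum>m<K. arctan_quot (real (Suc m) / real K))"
  ultimately have "L * S \<le> T" "T \<le> L * (1 + S)"
    using lo hi mult_left_mono[of "\<Sum>m<K. arctan_quot (real m / real K)" "1 + S" "real L"]
    by (simp_all add: sum_distrib_left)
  hence "\<bar>T - L * S\<bar> \<le> L" by (simp add: algebra_simps)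
  moreover have "T / real (K * L) - S / real K = (T - L * S) / real (K * L)"
    using assms by (simp add: field_simps)
  ultimately have "\<bar>T / real (K * L) - S / real K\<bar> \<le> L / real (K * L)"
    using assms by (simp only: abs_divide abs_of_nat) (intro divide_right_mono, auto)
  also have "\<dots> = 1 / real K" using assms by simp
  finally show ?thesis unfolding R[OF assms(1)] R[OF mult_pos_pos[OF assms]] eq T_def S_def .
qed

text \<open>The sums with (n+1) K and (n+1) J points are both compared with their common refinement,
  of mesh 1 / ((n+1) K J).\<close>

lemma arctan_riemann_diff_tendsto:
  assumes "K > 0" "J > 0"
  shows "(\<lambda>n. arctan_riemann (Suc n * K) - arctan_riemann (Suc n * J)) \<longlonglongrightarrow> 0"
proof (rule Lim_null_comparison)
  show "\<forall>\<^sub>F n in sequentially. norm (arctan_riemann (Suc n * K) - arctan_riemann (Suc n * J))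
      \<le> 1 / (real (Suc n) * real K) + 1 / (real (Suc n) * real J)"
  proof (intro always_eventually allI)
    fix n
    have "\<bar>arctan_riemann (Suc n * K * J) - arctan_riemann (Suc n * K)\<bar> \<le> 1 / real (Suc n * K)"
         "\<bar>arctan_riemann (Suc n * J * K) - arctan_riemann (Suc n * J)\<bar> \<le> 1 / real (Suc n * J)"
      using assms by (intro arctan_riemann_refine; simp)+
    moreover have "Suc n * J * K = Suc n * K * J" by (simp add: algebra_simps)
    ultimately show "norm (arctan_riemann (Suc n * K) - arctan_riemann (Suc n * J))
      \<le> 1 / (real (Suc n) * real K) + 1 / (real (Suc n) * real J)"
      unfolding real_norm_def of_nat_mult by (simp only:)
  qed
  show "(\<lambda>n. 1 / (real (Suc n) * real K) + 1 / (real (Suc n) * real J)) \<longlonglongrightarrow> 0"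
    using assms by real_asymp
qed

text \<open>Each term is expanded into partial fractions with u = a m, which are cut at k = J. The
  remaining tail is approximated by an arctan of a m / (2 pi J), and a K = 2 pi J makes this m / K.
  The errors 2 a / (4 pi^2 J^2) of the K terms add up to 1 / (pi J).\<close>

lemma lambert_partial_sum:
  fixes a :: real and K J :: nat
  assumes a: "a > 0" and pos: "K > 0" "J > 0" and ratio: "a * K = 2 * pi * J"
  shows "\<bar>(\<Sum>i<K. 1 / (real (Suc i) * (exp (a * real (Suc i)) - 1))) -
     ((\<Sum>i<K. \<Sum>k<J. 2 * a / (a\<^sup>2 * (real (Suc i))\<^sup>2 + 4 * pi\<^sup>2 * (real (Suc k))\<^sup>2))
        + arctan_riemann K / pi - harm K / 2 + (\<Sum>i<K. 1 / (real (Suc i))\<^sup>2) / a)\<bar> \<le> 1 / (pi * J)"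
proof -
  define \<phi> where "\<phi> = (\<lambda>m k. 2 * a / (a\<^sup>2 * (real m)\<^sup>2 + 4 * pi\<^sup>2 * (real k)\<^sup>2))"
  have one: "\<bar>1 / (real m * (exp (a * real m) - 1)) - ((\<Sum>k<J. \<phi> m (Suc k)) +
      arctan (real m / real K) / real m / pi - inverse (real m) / 2 + 1 / (real m)\<^sup>2 / a)\<bar> \<le> 2 * a / (4 * pi\<^sup>2 * (real J)\<^sup>2)"
    if m: "m > 0" for m
  proof -
    define u where "u = a * real m"
    have u: "u > 0" using m a by (simp add: u_def)
    define f where "f = (\<lambda>k. 2 * u / (u\<^sup>2 + 4 * pi\<^sup>2 * (real (Suc k))\<^sup>2))"
    define S where "S = (\<Sum>k. 1 / (u\<^sup>2 + (2 * pi)\<^sup>2 * (real (k + J + 1))\<^sup>2))"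
    have sums: "f sums (1 / (exp u - 1) - 1 / u + 1 / 2)"
      unfolding f_def by (rule coth_partial_fractions[OF u])
    have "suminf f = (\<Sum>k. f (k + J)) + (\<Sum>k<J. f k)"
      using sums by (intro suminf_split_initial_segment) (simp add: sums_iff)
    moreover have "suminf f = 1 / (exp u - 1) - 1 / u + 1 / 2" using sums by (simp add: sums_iff)
    moreover have "(\<Sum>k. f (k + J)) = 2 * u * S"
      unfolding S_def using inverse_quadratic_tail(1)[of u "2*pi" J] u pos
      by (subst suminf_mult [symmetric]) (auto simp: f_def power_mult_distrib)
    ultimately have eq: "1 / (exp u - 1) = 2 * u * S + (\<Sum>k<J. f k) + 1 / u - 1 / 2" by simp
    have "u / (2 * pi * J) = real m / real K"
      using pos a unfolding ratio [symmetric] by (simp add: u_def)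
    hence S: "\<bar>S - arctan (real m / real K) / (2 * pi * u)\<bar> \<le> 1 / ((2*pi)\<^sup>2 * (real J)\<^sup>2)"
      unfolding S_def using inverse_quadratic_tail(2)[of u "2*pi" J] u pos by simp
    have "1 / (real m * (exp u - 1)) - ((\<Sum>k<J. \<phi> m (Suc k)) +
      arctan (real m / real K) / real m / pi - inverse (real m) / 2 + 1 / (real m)\<^sup>2 / a) =
      2 * a * (S - arctan (real m / real K) / (2 * pi * u))"
    proof -
      have f: "(\<Sum>k<J. \<phi> m (Suc k)) = (\<Sum>k<J. f k) / real m"
        unfolding sum_divide_distrib using m
        by (intro sum.cong) (auto simp: \<phi>_def f_def u_def power_mult_distrib)
      have g: "1 / (real m * (exp u - 1)) = (2 * u * S + (\<Sum>k<J. f k) + 1 / u - 1 / 2) / real m"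
        unfolding eq [symmetric] by simp
      show ?thesis unfolding f g using m a
        by (simp add: u_def field_simps power2_eq_square)
    qed
    also have "\<bar>\<dots>\<bar> \<le> 2 * a * (1 / ((2*pi)\<^sup>2 * (real J)\<^sup>2))"
      unfolding abs_mult using a by (intro mult_mono S) auto
    finally show ?thesis by (simp add: u_def power_mult_distrib)
  qed
  have "\<bar>\<Sum>i<K. 1 / (real (Suc i) * (exp (a * real (Suc i)) - 1)) - ((\<Sum>k<J. \<phi> (Suc i) (Suc k)) +
      arctan (real (Suc i) / real K) / real (Suc i) / pi - inverse (real (Suc i)) / 2 + 1 / (real (Suc i))\<^sup>2 / a)\<bar>
      \<le> (\<Sum>i<K. 2 * a / (4 * pi\<^sup>2 * (real J)\<^sup>2))"
    by (intro order.trans[OF sum_abs] sum_mono one) auto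
  also have "\<dots> = 2 * (a * K) / (4 * pi\<^sup>2 * (real J)\<^sup>2)" by simp
  also have "\<dots> = 1 / (pi * J)" unfolding ratio using pos by (simp add: power2_eq_square)
  finally show ?thesis
    unfolding \<phi>_def sum_subtractf sum.distrib arctan_riemann_def harm_altdef sum_divide_distrib by simp
qed


text \<open>This is ln F(a): the logarithms of the factors of F are expanded, and the resulting
  geometric series in n is summed first (\<open>lnF_of_real\<close>).\<close>

definition lambert :: "real \<Rightarrow> real" where
  "lambert a = (\<Sum>i. 1 / (real (Suc i) * (exp (a * real (Suc i)) - 1)))"

lemma lambert_summable:
  assumes "a > 0"
  shows "summable (\<lambda>i. 1 / (real (Suc i) * (exp (a * real (Suc i)) - 1)))"
proof (rule summable_comparison_test'[of "\<lambda>i. 1 / a * (1 / (real (Suc i))\<^sup>2)" 0])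
  show "summable (\<lambda>i. 1 / a * (1 / (real (Suc i))\<^sup>2))"
    by (intro summable_mult summable_inverse_Suc_squares)
  fix i
  have "exp (a * real (Suc i)) - 1 \<ge> a * real (Suc i)"
    using exp_ge_add_one_self[of "a * real (Suc i)"] by linarith
  hence "1 / (real (Suc i) * (exp (a * real (Suc i)) - 1)) \<le> 1 / (real (Suc i) * (a * real (Suc i)))"
    using assms by (intro divide_left_mono mult_left_mono mult_pos_pos) (auto simp: )
  moreover have "1 / (real (Suc i) * (exp (a * real (Suc i)) - 1)) \<ge> 0" using assms by simp
  ultimately show "norm (1 / (real (Suc i) * (exp (a * real (Suc i)) - 1))) \<le> 1 / a * (1 / (real (Suc i))\<^sup>2)"
    by (simp add: power2_eq_square mult.commute mult.left_commute)
qed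

lemma filterlim_Suc_mult: "K > 0 \<Longrightarrow> filterlim (\<lambda>n. Suc n * K) at_top sequentially"
  by (rule filterlim_subseq) (auto simp: strict_mono_def)

text \<open>
  Up to the swap of a conditionally convergent double series, the transformation is the symmetry of
  \<open>2 a / (a\<^sup>2 m\<^sup>2 + 4 \<pi>\<^sup>2 k\<^sup>2)\<close>. Truncating at \<open>m \<le> K\<close> and \<open>k \<le> J\<close> with \<open>a K = 2 \<pi> J\<close> makes both tails
  Riemann sums for the integral of \<open>arctan x / x\<close>, so that they cancel; the logarithm comes from
  the harmonic numbers.
\<close>

theorem lambert_transformation_rational:
  fixes a :: real and K J :: nat
  assumes a: "a > 0" and pos: "K > 0" "J > 0" and ratio: "a * K = 2 * pi * J"
  shows "lambert a - lambert (4 * pi\<^sup>2 / a) = pi\<^sup>2 / (6 * a) - a / 24 + ln (a / (2 * pi)) / 2"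
proof -
  define a' where "a' = 4 * pi\<^sup>2 / a"
  have a': "a' > 0" using a by (simp add: a'_def)
  have ratio': "a' * J = 2 * pi * K"
    using a ratio by (simp add: a'_def field_simps power2_eq_square)
  define P where "P = (\<lambda>a K. (\<Sum>i<K. 1 / (real (Suc i) * (exp (a * real (Suc i)) - 1))))"
  define Z where "Z = (\<lambda>K. (\<Sum>i<K. 1 / (real (Suc i))\<^sup>2))"
  have P: "P x \<longlonglongrightarrow> lambert x" if "x > 0" for x
    using lambert_summable[OF that] unfolding P_def lambert_def by (rule summable_LIMSEQ)
  have Z: "Z \<longlonglongrightarrow> pi\<^sup>2 / 6"
    using inverse_squares_sums unfolding Z_def sums_def by (simp add: add.commute)
  define E where "E = (\<lambda>n. (arctan_riemann (Suc n * K) - arctan_riemann (Suc n * J)) / pi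
       - (harm (Suc n * K) - harm (Suc n * J)) / 2 + Z (Suc n * K) / a - Z (Suc n * J) / a')"
  have "(\<lambda>n. (P a (Suc n * K) - P a' (Suc n * J)) - E n) \<longlonglongrightarrow> 0"
  proof (rule Lim_null_comparison)
    show "\<forall>\<^sub>F n in sequentially. norm (P a (Suc n * K) - P a' (Suc n * J) - E n)
        \<le> 1 / (pi * (real (Suc n) * real J)) + 1 / (pi * (real (Suc n) * real K))"
    proof (intro always_eventually allI)
      fix n
      define A B where "A = Suc n * K" and "B = Suc n * J"
      have AB: "A > 0" "B > 0" "a * A = 2 * pi * B" "a' * B = 2 * pi * A"
        using pos ratio ratio' by (simp_all only: A_def B_def of_nat_mult mult.left_commute[of _ "real (Suc n)"]) auto
      \<comment> \<open>The truncated double sums for a and 4 pi^2 / a are equal term by term after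
        exchanging the two indices; everything else has been collected in \<open>E\<close>.\<close>
      have swap: "(\<Sum>i<B. \<Sum>k<A. 2 * a' / (a'\<^sup>2 * (real (Suc i))\<^sup>2 + 4 * pi\<^sup>2 * (real (Suc k))\<^sup>2)) =
            (\<Sum>i<A. \<Sum>k<B. 2 * a / (a\<^sup>2 * (real (Suc i))\<^sup>2 + 4 * pi\<^sup>2 * (real (Suc k))\<^sup>2))"
      proof (subst sum.swap, intro sum.cong refl)
        fix i k
        define x y where "x = real (Suc i)" and "y = real (Suc k)"
        have "x > 0" "y > 0" by (auto simp: x_def y_def)
        hence "a\<^sup>2 * x\<^sup>2 + 4 * pi\<^sup>2 * y\<^sup>2 > 0" using a by (intro add_pos_pos) auto
        moreover have "a'\<^sup>2 * y\<^sup>2 + 4 * pi\<^sup>2 * x\<^sup>2 = 4 * pi\<^sup>2 / a\<^sup>2 * (a\<^sup>2 * x\<^sup>2 + 4 * pi\<^sup>2 * y\<^sup>2)"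
          using a by (simp add: a'_def field_simps power2_eq_square)
        moreover have "2 * a' / (4 * pi\<^sup>2 / a\<^sup>2 * Q) = 2 * a / Q" if "Q > 0" for Q
          using that a by (simp add: a'_def field_simps power2_eq_square)
        ultimately show "2 * a' / (a'\<^sup>2 * y\<^sup>2 + 4 * pi\<^sup>2 * x\<^sup>2) = 2 * a / (a\<^sup>2 * x\<^sup>2 + 4 * pi\<^sup>2 * y\<^sup>2)"
          by (simp only:)
      qed
      note 1 = lambert_partial_sum[OF a AB(1,2,3)] and 2 = lambert_partial_sum[OF a' AB(2,1,4)]
      have "norm (P a A - P a' B - E n) \<le> 1 / (pi * B) + 1 / (pi * A)"
        using 1 2 unfolding swap E_def P_def Z_def A_def [symmetric] B_def [symmetric] real_norm_def
          diff_divide_distrib by linarith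
      thus "norm (P a (Suc n * K) - P a' (Suc n * J) - E n)
        \<le> 1 / (pi * (real (Suc n) * real J)) + 1 / (pi * (real (Suc n) * real K))"
        by (simp only: A_def B_def of_nat_mult)
    qed
    show "(\<lambda>n. 1 / (pi * (real (Suc n) * real J)) + 1 / (pi * (real (Suc n) * real K))) \<longlonglongrightarrow> 0"
      using pos by real_asymp
  qed
  moreover have "(\<lambda>n. P a (Suc n * K) - P a' (Suc n * J)) \<longlonglongrightarrow> lambert a - lambert a'"
    by (intro tendsto_diff filterlim_compose[OF P filterlim_Suc_mult] a a' pos)
  ultimately have "E \<longlonglongrightarrow> lambert a - lambert a'"
    using tendsto_diff by fastforce
  moreover have "E \<longlonglongrightarrow> 0 / pi - ln (K / J) / 2 + (pi\<^sup>2 / 6) / a - (pi\<^sup>2 / 6) / a'"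
    unfolding E_def
  proof (intro tendsto_intros arctan_riemann_diff_tendsto pos filterlim_compose[OF Z filterlim_Suc_mult])
    have h: "(\<lambda>n. harm n - ln (real n)) \<longlonglongrightarrow> (euler_mascheroni :: real)" by (rule euler_mascheroni_LIMSEQ)
    \<comment> \<open>Euler's constant cancels, and only ln (K / J) = - ln (a / (2 pi)) survives.
      Halved, it is the logarithm of the square root in the transformation.\<close>
    have "(\<lambda>n. (harm (Suc n * K) - ln (real (Suc n * K))) - (harm (Suc n * J) - ln (real (Suc n * J))) + ln (K / J))
       \<longlonglongrightarrow> euler_mascheroni - euler_mascheroni + ln (K / J)"
      by (intro tendsto_intros filterlim_compose[OF h filterlim_Suc_mult] pos)
    also have "(\<lambda>n. (harm (Suc n * K) - ln (real (Suc n * K))) - (harm (Suc n * J) - ln (real (Suc n * J))) + ln (K / J))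
       = (\<lambda>n. harm (Suc n * K) - harm (Suc n * J))"
      using pos by (auto simp: ln_div ln_mult_pos simp del: of_nat_Suc mult_Suc)
    finally show "(\<lambda>n. harm (Suc n * K) - harm (Suc n * J)) \<longlonglongrightarrow> ln (K / J)" by simp
  qed (use a a' in auto)
  ultimately have "lambert a - lambert a' = 0 / pi - ln (K / J) / 2 + (pi\<^sup>2 / 6) / a - (pi\<^sup>2 / 6) / a'"
    by (rule LIMSEQ_unique)
  moreover have "ln (K / J) = - ln (a / (2 * pi))"
  proof -
    have "a / (2 * pi) = J / K" using ratio pos a by (simp add: field_simps)
    thus ?thesis using pos by (simp add: ln_div)
  qed
  ultimately show ?thesis using a by (simp add: a'_def field_simps power2_eq_square)
qed

section \<open>The logarithm of F as a holomorphic function\<close>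

abbreviation lnF_term :: "complex \<Rightarrow> nat \<Rightarrow> complex" where
  "lnF_term z n \<equiv> - Ln (1 - exp (-(of_nat (Suc n) * z)))"

text \<open>A sum of principal logarithms. For Re z > 0 each 1 - exp (- n z) has positive real part,
  so that no branch cut is met and the sum is a holomorphic logarithm of F that is real on the
  positive axis. The index is shifted by one.\<close>

definition lnF :: "complex \<Rightarrow> complex" where
  "lnF z = (\<Sum>n. lnF_term z n)"

lemma minus_Ln_one_minus_sums:
  fixes w :: complex
  assumes "norm w < 1"
  shows "(\<lambda>n. w ^ Suc n / of_nat (Suc n)) sums (- Ln (1 - w))"
proof -
  have "(\<lambda>n. (-1) ^ Suc n / of_nat n * (-w) ^ n) sums Ln (1 + (-w))"
    using assms by (intro Ln_series) simp
  also have "(\<lambda>n. (-1) ^ Suc n / of_nat n * (-w) ^ n) = (\<lambda>n. - (w ^ n / of_nat n))"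
  proof
    fix n
    have "(-1) ^ n * (-w) ^ n = w ^ n" by (simp flip: power_mult_distrib)
    thus "(-1) ^ Suc n / of_nat n * (-w) ^ n = - (w ^ n / of_nat n)" by simp
  qed
  finally have "(\<lambda>n. w ^ n / of_nat n) sums (- Ln (1 - w))"
    using sums_minus by fastforce
  thus ?thesis by (subst sums_Suc_iff) simp
qed

lemma minus_ln_one_minus_sums:
  fixes x :: real
  assumes "\<bar>x\<bar> < 1"
  shows "(\<lambda>n. x ^ Suc n / of_nat (Suc n)) sums (- ln (1 - x))"
proof -
  have "(\<lambda>n. of_real x ^ Suc n / of_nat (Suc n)) sums (- Ln (1 - of_real x))"
    using assms by (intro minus_Ln_one_minus_sums) simp
  also have "(\<lambda>n. of_real x ^ Suc n / of_nat (Suc n)) = (\<lambda>n. complex_of_real (x ^ Suc n / of_nat (Suc n)))"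
    by (intro ext) (simp del: of_nat_Suc)
  also have "- Ln (1 - of_real x) = complex_of_real (- ln (1 - x))"
    using assms Ln_of_real[of "1 - x"] by simp
  finally show ?thesis by (simp only: sums_of_real_iff)
qed

lemma minus_ln_one_minus_bounds:
  fixes x :: real
  assumes "0 \<le> x" "x < 1"
  shows "x \<le> - ln (1 - x)" "- ln (1 - x) \<le> x / (1 - x)"
proof -
  show "x \<le> - ln (1 - x)" using ln_le_minus_one[of "1 - x"] assms by simp
  have "ln (1 / (1 - x)) \<le> 1 / (1 - x) - 1" using assms by (intro ln_le_minus_one) auto
  also have "ln (1 / (1 - x)) = - ln (1 - x)" using assms by (simp add: ln_div)
  also have "1 / (1 - x) - 1 = x / (1 - x)" using assms by (simp add: field_simps)
  finally show "- ln (1 - x) \<le> x / (1 - x)" .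
qed

lemma norm_Ln_one_minus_le:
  fixes w :: complex
  assumes "norm w < 1"
  shows "norm (- Ln (1 - w)) \<le> - ln (1 - norm w)"
proof -
  have 1: "(\<lambda>n. norm w ^ Suc n / of_nat (Suc n)) sums (- ln (1 - norm w))"
    using assms by (intro minus_ln_one_minus_sums) auto
  have "norm (\<Sum>n. w ^ Suc n / of_nat (Suc n)) \<le> (\<Sum>n. norm w ^ Suc n / of_nat (Suc n))"
    by (intro norm_suminf_le) (use 1 in \<open>auto simp: sums_iff norm_divide norm_mult norm_power simp del: of_nat_Suc\<close>)
  thus ?thesis using 1 minus_Ln_one_minus_sums[OF assms] by (simp add: sums_iff)
qed

lemma norm_exp_neg_mult: "norm (exp (-(of_nat n * z)) :: complex) = exp (- Re z) ^ n"
  by (simp add: norm_exp_eq_Re exp_of_nat_mult [symmetric])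

text \<open>A geometric majorant that depends on Re z only. It gives summability, locally uniform
  convergence and the size of \<open>lnF\<close>.\<close>

lemma lnF_term_bound:
  assumes "Re z > 0"
  shows "norm (lnF_term z n) \<le> exp (- Re z) ^ Suc n / (1 - exp (- Re z))"
proof -
  define x where "x = exp (- Re z)"
  have x: "0 < x" "x < 1" using assms by (auto simp: x_def)
  have xn: "x ^ Suc n \<le> x" using x by (simp add: mult_left_le power_le_one)
  hence xn1: "x ^ Suc n < 1" using x by linarith
  have "norm (lnF_term z n) \<le> - ln (1 - x ^ Suc n)"
    by (rule norm_Ln_one_minus_le[of "exp (-(of_nat (Suc n) * z))", unfolded norm_exp_neg_mult, folded x_def])
       (rule xn1)
  also have "\<dots> \<le> x ^ Suc n / (1 - x ^ Suc n)"
    by (intro minus_ln_one_minus_bounds(2) xn1) (use x in auto)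
  also have "\<dots> \<le> x ^ Suc n / (1 - x)"
    by (intro divide_left_mono mult_pos_pos) (use x xn xn1 in \<open>auto simp del: power_Suc\<close>)
  finally show ?thesis by (simp only: x_def)
qed

lemma summable_lnF_bound:
  assumes "Re z > 0"
  shows "(\<lambda>n. exp (- Re z) ^ Suc n / (1 - exp (- Re z))) sums (exp (- Re z) / (1 - exp (- Re z))\<^sup>2)"
proof -
  have "(\<lambda>n. exp (- Re z) * exp (- Re z) ^ n / (1 - exp (- Re z))) sums (exp (- Re z) * (1 / (1 - exp (- Re z))) / (1 - exp (- Re z)))"
    using assms by (intro sums_divide sums_mult geometric_sums) simp
  thus ?thesis by (simp add: power2_eq_square)
qed

lemma summable_lnF:
  assumes "Re z > 0"
  shows "summable (\<lambda>n. lnF_term z n)"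
    and "summable (\<lambda>n. norm (lnF_term z n))"
proof -
  have s: "summable (\<lambda>n. exp (- Re z) ^ Suc n / (1 - exp (- Re z)))"
    using summable_lnF_bound[OF assms] by (simp add: sums_iff)
  show "summable (\<lambda>n. lnF_term z n)"
    by (rule summable_comparison_test'[OF s]) (rule lnF_term_bound[OF assms])
  show "summable (\<lambda>n. norm (lnF_term z n))"
    by (rule summable_comparison_test'[OF s]) (simp only: real_norm_def abs_norm_cancel lnF_term_bound[OF assms])
qed

lemma norm_lnF_le:
  assumes "Re z > 0"
  shows "norm (lnF z) \<le> exp (- Re z) / (1 - exp (- Re z))\<^sup>2"
  unfolding lnF_def using summable_lnF_bound[OF assms]
  by (subst sums_unique[OF summable_lnF_bound[OF assms]], intro norm_suminf_le lnF_term_bound assms)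
     (auto simp: sums_iff)

lemma one_minus_exp_nonpos:
  assumes "Re z > 0"
  shows "1 - exp (-(of_nat (Suc n) * z)) \<notin> \<real>\<^sub>\<le>\<^sub>0"
proof
  assume "1 - exp (-(of_nat (Suc n) * z)) \<in> \<real>\<^sub>\<le>\<^sub>0"
  hence "Re (1 - exp (-(of_nat (Suc n) * z))) \<le> 0" by (auto simp: complex_nonpos_Reals_iff)
  moreover have "Re (exp (-(of_nat (Suc n) * z))) \<le> norm (exp (-(of_nat (Suc n) * z)))"
    by (rule complex_Re_le_cmod)
  moreover have "norm (exp (-(of_nat (Suc n) * z))) < 1"
    unfolding norm_exp_neg_mult using assms by (intro power_Suc_less_one) auto
  ultimately show False unfolding minus_complex.simps one_complex.simps by linarith
qed

lemma holomorphic_lnF: "lnF holomorphic_on {z. Re z > 0}"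
proof (rule holomorphic_uniform_sequence[where f = "\<lambda>N z. \<Sum>n<N. lnF_term z n"])
  show "open {z. Re z > 0}" by (rule open_halfspace_Re_gt)
  show "(\<lambda>z. \<Sum>n<N. lnF_term z n) holomorphic_on {z. Re z > 0}" for N
    by (intro holomorphic_intros) (use one_minus_exp_nonpos in auto)
  fix z :: complex assume z: "z \<in> {z. Re z > 0}"
  define d where "d = Re z / 2"
  have d: "d > 0" using z by (simp add: d_def)
  have Re: "Re w \<ge> d" if "w \<in> cball z d" for w
    using abs_Re_le_cmod[of "z - w"] that by (auto simp: dist_norm d_def)
  have "uniform_limit (cball z d) (\<lambda>N z. \<Sum>n<N. lnF_term z n) lnF sequentially"
    unfolding lnF_def
  proof (rule Weierstrass_m_test)
    show "summable (\<lambda>n. exp (- d) ^ Suc n / (1 - exp (- d)))"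
      using summable_lnF_bound[of "of_real d"] d by (simp add: sums_iff)
    fix n w assume "w \<in> cball z d"
    note r = Re[OF this]
    have "norm (lnF_term w n) \<le> exp (- Re w) ^ Suc n / (1 - exp (- Re w))"
      using r d by (intro lnF_term_bound) auto
    also have "\<dots> \<le> exp (- d) ^ Suc n / (1 - exp (- d))"
      using r d by (intro frac_le power_mono) auto
    finally show "norm (lnF_term w n) \<le> exp (- d) ^ Suc n / (1 - exp (- d))" .
  qed
  moreover have "cball z d \<subseteq> {z. Re z > 0}" using Re d by fastforce
  ultimately show "\<exists>d>0. cball z d \<subseteq> {z. 0 < Re z} \<and>
      uniform_limit (cball z d) (\<lambda>N z. \<Sum>n<N. lnF_term z n) lnF sequentially"
    using d by blast
qed

lemma infsum_nonneg_eq_suminf: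
  fixes g :: "nat \<Rightarrow> real"
  assumes "summable g" "\<And>n. g n \<ge> 0"
  shows "infsum g UNIV = suminf g" "g summable_on UNIV"
  using sums_nonneg_imp_has_sum[of g "suminf g"] assms
  by (auto simp: summable_sums infsumI has_sum_imp_summable)

lemma suminf_swap_nonneg:
  fixes f :: "nat \<Rightarrow> nat \<Rightarrow> real"
  assumes nonneg: "\<And>n m. f n m \<ge> 0" and 1: "\<And>n. summable (f n)" and 2: "summable (\<lambda>n. suminf (f n))"
    and 3: "\<And>m. summable (\<lambda>n. f n m)"
  shows "(\<Sum>n. \<Sum>m. f n m) = (\<Sum>m. \<Sum>n. f n m)"
proof -
  note i = infsum_nonneg_eq_suminf
  have nn: "suminf (f n) \<ge> 0" for n using 1 nonneg by (intro suminf_nonneg) auto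
  have "(\<lambda>p. norm (f (fst p) (snd p))) summable_on (UNIV \<times> UNIV)"
    unfolding Infinite_Sum.abs_summable_on_Sigma_iff using i[OF 1] i[OF 2] nonneg nn by simp
  hence s: "(\<lambda>(n,m). f n m) summable_on (UNIV \<times> UNIV)"
    using nonneg by (simp add: case_prod_unfold)
  have "bij (prod.swap :: nat \<times> nat \<Rightarrow> nat \<times> nat)" by (rule bij_swap)
  hence "(\<lambda>(m,n). f n m) summable_on (UNIV \<times> UNIV)"
    using summable_on_reindex_bij_betw[of prod.swap UNIV UNIV "\<lambda>(n,m). f n m"] s
    by (simp add: case_prod_unfold)
  hence "(\<lambda>m. infsum (\<lambda>n. f n m) UNIV) summable_on UNIV"
    by (rule summable_on_Sigma_banach)
  hence "summable (\<lambda>m. \<Sum>n. f n m)"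
    using i(1)[OF 3] nonneg by (simp add: summable_on_imp_summable)
  hence "infsum (\<lambda>m. infsum (\<lambda>n. f n m) UNIV) UNIV = (\<Sum>m. \<Sum>n. f n m)"
    using i(1)[OF 3] nonneg by (simp add: i(1) suminf_nonneg 3)
  moreover have "infsum (\<lambda>n. infsum (\<lambda>m. f n m) UNIV) UNIV = (\<Sum>n. \<Sum>m. f n m)"
    using i(1)[OF 1] i(1)[OF 2] nonneg nn by simp
  ultimately show ?thesis using infsum_swap_banach[OF s] by simp
qed

lemma lnF_of_real:
  assumes a: "a > 0"
  shows "lnF (of_real a) = of_real (lambert a)"
proof -
  define f where "f = (\<lambda>n m. exp (- (a * real (Suc n) * real (Suc m))) / real (Suc m))"
  have inner: "(\<lambda>m. f n m) sums (- ln (1 - exp (- (a * real (Suc n)))))" for n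
  proof -
    have "exp (- (a * real (Suc n))) < 1" using a by simp
    hence "(\<lambda>m. exp (- (a * real (Suc n))) ^ Suc m / of_nat (Suc m)) sums (- ln (1 - exp (- (a * real (Suc n)))))"
      by (intro minus_ln_one_minus_sums) simp
    also have "(\<lambda>m. exp (- (a * real (Suc n))) ^ Suc m / of_nat (Suc m)) = (\<lambda>m. f n m)"
      unfolding f_def by (intro ext) (simp only: exp_of_nat_mult [symmetric], simp add: algebra_simps)
    finally show ?thesis .
  qed
  have outer: "(\<lambda>n. f n m) sums (1 / (real (Suc m) * (exp (a * real (Suc m)) - 1)))" for m
  proof -
    define y where "y = exp (- (a * real (Suc m)))"
    have y: "0 < y" "y < 1" using a by (auto simp: y_def)
    have "(\<lambda>n. y * y ^ n / real (Suc m)) sums (y * (1 / (1 - y)) / real (Suc m))"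
      using y by (intro sums_mult sums_divide geometric_sums) auto
    also have "(\<lambda>n. y * y ^ n / real (Suc m)) = (\<lambda>n. f n m)"
      unfolding f_def y_def power_Suc [symmetric]
      by (intro ext) (simp only: exp_of_nat_mult [symmetric], simp add: algebra_simps)
    also have "y * (1 / (1 - y)) = 1 / (exp (a * real (Suc m)) - 1)"
      using y unfolding y_def exp_minus by (simp add: field_simps)
    finally show ?thesis by (simp add: mult.commute)
  qed
  have eqn: "- Ln (1 - exp (-(of_nat (Suc n) * of_real a))) = complex_of_real (- ln (1 - exp (- (a * real (Suc n)))))" for n
  proof -
    have "exp (- (a * real (Suc n))) < 1" using a by simp
    moreover have "exp (-(of_nat (Suc n) * of_real a)) = complex_of_real (exp (- (a * real (Suc n))))"
      by (simp add: exp_of_real [symmetric] algebra_simps)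
    ultimately show ?thesis by (simp add: Ln_of_real [symmetric] del: Ln_of_real of_nat_Suc)
  qed
  have sm: "summable (\<lambda>n. - ln (1 - exp (- (a * real (Suc n)))))"
    using summable_lnF(1)[of "of_real a"] a unfolding eqn summable_of_real_iff by simp
  have "lambert a = (\<Sum>m. \<Sum>n. f n m)"
    using outer by (simp add: lambert_def sums_iff)
  also have "\<dots> = (\<Sum>n. \<Sum>m. f n m)"
    by (rule suminf_swap_nonneg [symmetric]) (use inner outer sm in \<open>auto simp: f_def sums_iff\<close>)
  also have "\<dots> = (\<Sum>n. - ln (1 - exp (- (a * real (Suc n)))))"
    using inner by (simp add: sums_iff)
  also have "complex_of_real \<dots> = lnF (of_real a)"
    unfolding lnF_def eqn using sm by (rule suminf_of_real)
  finally show ?thesis by simp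
qed

text \<open>Serves \<open>lnF_ray_bounds\<close>, where the values at u and -u have to be
  conjugate.\<close>

lemma lnF_cnj:
  assumes "Re z > 0"
  shows "lnF (cnj z) = cnj (lnF z)"
proof -
  have "- Ln (1 - exp (-(of_nat (Suc n) * cnj z))) = cnj (lnF_term z n)" for n
  proof -
    have "1 - exp (-(of_nat (Suc n) * cnj z)) = cnj (1 - exp (-(of_nat (Suc n) * z)))"
      by (simp add: exp_cnj)
    moreover have "cnj (lnF_term z n) = - Ln (cnj (1 - exp (-(of_nat (Suc n) * z))))"
      by (subst cnj_Ln[OF one_minus_exp_nonpos[OF assms, of n], symmetric]) (rule complex_cnj_minus)
    ultimately show ?thesis by (simp only:)
  qed
  moreover have "(\<lambda>n. cnj (lnF_term z n)) sums cnj (lnF z)"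
    unfolding lnF_def sums_cnj by (rule summable_sums[OF summable_lnF(1)[OF assms]])
  ultimately have "(\<lambda>n. lnF_term (cnj z) n) sums cnj (lnF z)"
    by (simp only:)
  thus ?thesis unfolding lnF_def[of "cnj z"] by (rule sums_unique [symmetric])
qed

text \<open>Both sides are holomorphic on the right half-plane, and they agree at the points 2 pi
  (n+2) / (n+1) by the rational case with K = n+1, J = n+2. These points differ from their limit 2
  pi, which lies inside the half-plane, so analytic continuation applies.\<close>

theorem lnF_transformation:
  fixes z :: complex
  assumes "Re z > 0"
  shows "lnF z = lnF (4 * pi\<^sup>2 / z) + pi\<^sup>2 / (6 * z) - z / 24 + Ln (z / (2 * pi)) / 2"
proof -
  define T where "T = (\<lambda>z::complex. lnF z - lnF (4 * pi\<^sup>2 / z) - (pi\<^sup>2 / (6 * z) - z / 24 + Ln (z / (2 * pi)) / 2))"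
  define H where "H = {z. Re z > 0}"
  have Re: "Re (4 * pi\<^sup>2 / z) > 0" if "Re z > 0" for z :: complex
  proof -
    have "Re (complex_of_real (4 * pi\<^sup>2) / z) > 0"
      using that by (simp add: Re_divide add_pos_nonneg)
    thus ?thesis by simp
  qed
  have holo: "T holomorphic_on H"
  proof -
    have "(\<lambda>z. lnF (4 * pi\<^sup>2 / z)) holomorphic_on H"
    proof (rule holomorphic_on_compose_gen[of "\<lambda>z::complex. 4 * pi\<^sup>2 / z" H lnF H, unfolded o_def])
      show "(\<lambda>z::complex. 4 * pi\<^sup>2 / z) holomorphic_on H"
        by (intro holomorphic_intros) (auto simp: H_def)
      show "lnF holomorphic_on H" unfolding H_def by (rule holomorphic_lnF)
      show "(\<lambda>z::complex. 4 * pi\<^sup>2 / z) ` H \<subseteq> H" unfolding H_def using Re by blast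
    qed
    moreover have "z / (2 * pi) \<notin> \<real>\<^sub>\<le>\<^sub>0" if "z \<in> H" for z
    proof -
      have "Re (z / complex_of_real (2 * pi)) > 0"
        using that unfolding Re_divide_of_real H_def by simp
      thus ?thesis unfolding complex_nonpos_Reals_iff by linarith
    qed
    ultimately show ?thesis unfolding T_def using holomorphic_lnF
      by (intro holomorphic_intros) (auto simp: H_def)
  qed
  define U where "U = (\<lambda>n. complex_of_real (2 * pi * real (Suc (Suc n)) / real (Suc n))) ` UNIV"
  have T0: "T (of_real a) = 0" if "a * real K = 2 * pi * real J" "K > 0" "J > 0" "a > 0" for a K J
  proof -
    have "4 * (complex_of_real pi)\<^sup>2 / of_real a = of_real (4 * pi\<^sup>2 / a)" by simp
    moreover have "Ln (of_real a / (2 * of_real pi)) = complex_of_real (ln (a / (2 * pi)))"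
      using that Ln_of_real[of "a / (2 * pi)"] by simp
    moreover have "lnF (of_real (4 * pi\<^sup>2 / a)) = of_real (lambert (4 * pi\<^sup>2 / a))"
      by (rule lnF_of_real) (use that in simp)
    ultimately have "T (of_real a) = of_real (lambert a - lambert (4 * pi\<^sup>2 / a) - (pi\<^sup>2 / (6 * a) - a / 24 + ln (a / (2 * pi)) / 2))"
      unfolding T_def lnF_of_real[OF that(4)] by simp
    thus ?thesis using lambert_transformation_rational[OF that(4,2,3,1)] by simp
  qed
  have "T z = 0"
  proof (rule analytic_continuation[OF holo, where U = U and \<xi> = "of_real (2 * pi)"])
    show "open H" unfolding H_def by (rule open_halfspace_Re_gt)
    show "connected H" unfolding H_def by (intro convex_connected convex_halfspace_Re_gt)
    show "U \<subseteq> H" by (auto simp: U_def H_def)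
    show "z \<in> H" using assms by (simp add: H_def)
    show "of_real (2 * pi) \<in> H" by (simp add: H_def)
    show "complex_of_real (2 * pi) islimpt U"
      unfolding islimpt_sequential
    proof (intro exI conjI allI)
      fix n
      show "complex_of_real (2 * pi * real (Suc (Suc n)) / real (Suc n)) \<in> U - {of_real (2 * pi)}"
      proof -
        have "2 * pi * real (Suc (Suc n)) / real (Suc n) \<noteq> 2 * pi" by (simp add: field_simps)
        thus ?thesis unfolding U_def using of_real_eq_iff by blast
      qed
      have "(\<lambda>n. 2 * pi * real (Suc (Suc n)) / real (Suc n)) \<longlonglongrightarrow> 2 * pi" by real_asymp
      thus "(\<lambda>n. complex_of_real (2 * pi * real (Suc (Suc n)) / real (Suc n))) \<longlonglongrightarrow> of_real (2 * pi)"
        by (rule tendsto_of_real)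
    qed
    fix w assume "w \<in> U"
    then obtain n where "w = complex_of_real (2 * pi * real (Suc (Suc n)) / real (Suc n))" by (auto simp: U_def)
    moreover have "T (complex_of_real (2 * pi * real (Suc (Suc n)) / real (Suc n))) = 0"
      by (rule T0[of _ "Suc n" "Suc (Suc n)"]) (simp_all del: of_nat_Suc)
    ultimately show "T w = 0" by (simp only:)
  qed
  thus ?thesis by (simp add: T_def algebra_simps)
qed

section \<open>Generating functions of partitions with restricted parts\<close>

definition restricted_partitions :: "nat set \<Rightarrow> nat \<Rightarrow> nat multiset set" where
  "restricted_partitions A N = {M \<in> partitions N. set_mset M \<subseteq> A}"

definition part_count :: "nat set \<Rightarrow> nat \<Rightarrow> nat" where
  "part_count A N = card (restricted_partitions A N)"

abbreviation part_upto :: "nat set \<Rightarrow> nat \<Rightarrow> nat \<Rightarrow> nat" where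
  "part_upto A d \<equiv> part_count (A \<inter> {..d})"

lemma num_partitions_eq_part_count: "num_partitions N = part_count UNIV N"
  by (simp add: num_partitions_def part_count_def restricted_partitions_def)

lemma num_regular_partitions_eq_part_count:
  "num_regular_partitions N t = part_count {n. \<not> (t + 1) dvd n} N"
  unfolding num_regular_partitions_def part_count_def restricted_partitions_def
  by (rule arg_cong[of _ _ card]) auto

lemma finite_restricted_partitions: "finite (restricted_partitions A N)"
  using finite_partitions[of N] by (simp add: restricted_partitions_def)

lemma part_count_mono: "A \<subseteq> B \<Longrightarrow> part_count A N \<le> part_count B N"
  unfolding part_count_def
  by (intro card_mono finite_restricted_partitions) (auto simp: restricted_partitions_def)

lemma part_le_sum_mset: "x \<in># M \<Longrightarrow> x \<le> sum_mset M" for M :: "nat multiset"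
  by (metis le_add1 multi_member_split sum_mset.add_mset)

lemma part_count_truncate:
  assumes "N \<le> d"
  shows "part_upto A d N = part_count A N"
proof -
  have "x \<le> d" if "M \<in> partitions N" "x \<in># M" for M x
    using part_le_sum_mset[OF that(2)] that(1) assms by (simp add: partitions_def)
  hence "restricted_partitions (A \<inter> {..d}) N = restricted_partitions A N"
    by (auto simp: restricted_partitions_def)
  thus ?thesis by (simp add: part_count_def)
qed

lemma part_count_empty: "part_upto A 0 N = (if N = 0 then 1 else 0)"
proof -
  have "restricted_partitions (A \<inter> {..0}) N = (if N = 0 then {{#}} else {})"
  proof -
    have *: "M = {#} \<and> N = 0" if "M \<in> restricted_partitions (A \<inter> {..0}) N" for M
    proof -
      have "x \<notin># M" for x using that by (auto simp: restricted_partitions_def partitions_def)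
      hence "M = {#}" by (meson multiset_nonemptyE)
      thus ?thesis using that by (auto simp: restricted_partitions_def partitions_def)
    qed
    have **: "{#} \<in> restricted_partitions (A \<inter> {..0}) 0"
      by (simp add: restricted_partitions_def partitions_def)
    show ?thesis
    proof (cases "N = 0")
      case True
      have "restricted_partitions (A \<inter> {..0}) N = {{#}}"
        using * ** unfolding True by (intro equalityI subsetI) simp_all
      thus ?thesis using True by simp
    next
      case False
      hence "restricted_partitions (A \<inter> {..0}) N = {}" using * by (intro equalityI subsetI) simp_all
      thus ?thesis using False by simp
    qed
  qed
  thus ?thesis by (simp add: part_count_def)
qed

text \<open>A partition either avoids the part d+1 or yields a partition of N - (d+1) when one copy
  is removed. For generating functions this is multiplication by 1 / (1 - x^(d+1)).\<close>

lemma part_count_rec: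
  assumes "Suc d \<in> A"
  shows "part_upto A (Suc d) N = part_upto A d N +
           (if Suc d \<le> N then part_upto A (Suc d) (N - Suc d) else 0)"
proof -
  let ?R = "restricted_partitions"
  define X where "X = {M \<in> ?R (A \<inter> {..Suc d}) N. Suc d \<in># M}"
  have split: "?R (A \<inter> {..Suc d}) N = ?R (A \<inter> {..d}) N \<union> X" "?R (A \<inter> {..d}) N \<inter> X = {}"
    by (auto simp: X_def restricted_partitions_def le_Suc_eq)
  have "card (?R (A \<inter> {..Suc d}) N) = card (?R (A \<inter> {..d}) N) + card X"
    unfolding split(1) using split(2)
    by (intro card_Un_disjoint finite_restricted_partitions)
       (auto simp: X_def finite_restricted_partitions)
  moreover have "card X = (if Suc d \<le> N then card (?R (A \<inter> {..Suc d}) (N - Suc d)) else 0)"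
  proof (cases "Suc d \<le> N")
    case True
    have "bij_betw (add_mset (Suc d)) (?R (A \<inter> {..Suc d}) (N - Suc d)) X"
    proof (rule bij_betwI[where g = "\<lambda>M. M - {#Suc d#}"])
      show "add_mset (Suc d) \<in> ?R (A \<inter> {..Suc d}) (N - Suc d) \<rightarrow> X"
        using True assms by (auto simp: X_def restricted_partitions_def partitions_def)
      show "(\<lambda>M. M - {#Suc d#}) \<in> X \<rightarrow> ?R (A \<inter> {..Suc d}) (N - Suc d)"
      proof
        fix M assume M: "M \<in> X"
        then obtain M' where "M = add_mset (Suc d) M'" by (auto simp: X_def dest: multi_member_split)
        thus "M - {#Suc d#} \<in> ?R (A \<inter> {..Suc d}) (N - Suc d)"
          using M by (auto simp: X_def restricted_partitions_def partitions_def)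
      qed
    qed (auto simp: X_def)
    thus ?thesis using True by (simp add: bij_betw_same_card)
  next
    case False
    have "X = {}" using False part_le_sum_mset by (force simp: X_def restricted_partitions_def partitions_def)
    thus ?thesis using False by simp
  qed
  ultimately show ?thesis by (simp add: part_count_def)
qed

lemma part_count_skip:
  assumes "Suc d \<notin> A"
  shows "part_upto A (Suc d) N = part_upto A d N"
proof -
  have "A \<inter> {..Suc d} = A \<inter> {..d}" using assms by (auto simp: le_Suc_eq)
  thus ?thesis by simp
qed

text \<open>Convergence has to precede the functional equation. The recursion bounds the K-th
  partial sum of the new series by that of the old one plus r^(d+1) times itself; solving this
  inequality bounds all partial sums.\<close>

lemma part_gf_step_real:
  fixes r :: real
  assumes r: "0 \<le> r" "r < 1" and A: "Suc d \<in> A"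
    and sm: "summable (\<lambda>N. real (part_upto A d N) * r ^ N)"
  shows "summable (\<lambda>N. real (part_upto A (Suc d) N) * r ^ N)"
proof -
  define c where "c = (\<lambda>N. real (part_upto A d N) * r ^ N)"
  define c' where "c' = (\<lambda>N. real (part_upto A (Suc d) N) * r ^ N)"
  define e where "e = Suc d"
  have nn: "c N \<ge> 0" "c' N \<ge> 0" for N using r by (auto simp: c_def c'_def)
  have re: "r ^ e < 1" "r ^ e \<ge> 0" using r power_strict_mono[of r 1 e] by (auto simp: e_def)
  have rec: "c' N = c N + (if e \<le> N then r ^ e * c' (N - e) else 0)" for N
  proof (cases "e \<le> N")
    case True
    hence "r ^ N = r ^ e * r ^ (N - e)" by (simp flip: power_add)
    thus ?thesis using True part_count_rec[OF A, of N]
      unfolding c'_def c_def e_def [symmetric] by (simp add: distrib_right)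
  next
    case False
    thus ?thesis using part_count_rec[OF A, of N] by (simp add: c'_def c_def e_def)
  qed
  have bound: "sum c' {..<K} \<le> suminf c / (1 - r ^ e)" for K
  proof -
    have "(\<Sum>N<K. if e \<le> N then r ^ e * c' (N - e) else 0) = (\<Sum>N\<in>{e..<K}. r ^ e * c' (N - e))"
      by (intro sum.mono_neutral_cong_right) auto
    also have "\<dots> = (\<Sum>N<K - e. r ^ e * c' N)"
      by (rule sum.reindex_bij_witness[of _ "\<lambda>i. i + e" "\<lambda>i. i - e"]) auto
    also have "\<dots> \<le> (\<Sum>N<K. r ^ e * c' N)"
      by (intro sum_mono2) (use nn re in auto)
    also have "\<dots> = r ^ e * sum c' {..<K}" by (simp add: sum_distrib_left)
    finally have "sum c' {..<K} \<le> sum c {..<K} + r ^ e * sum c' {..<K}"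
      by (subst sum.cong[OF refl rec]) (simp add: sum.distrib)
    also have "sum c {..<K} \<le> suminf c" by (rule sum_le_suminf) (use sm nn in \<open>auto simp: c_def\<close>)
    finally have "sum c' {..<K} * (1 - r ^ e) \<le> suminf c" by (simp add: algebra_simps)
    thus ?thesis using re by (simp add: field_simps)
  qed
  have "summable c'"
    by (rule summableI_nonneg_bounded[OF nn(2) bound])
  thus ?thesis by (simp add: c'_def)
qed

lemma part_gf_step:
  fixes x :: complex
  assumes x: "norm x < 1" and A: "Suc d \<in> A"
    and sm: "summable (\<lambda>N. norm (of_nat (part_upto A d N) * x ^ N))"
  shows "summable (\<lambda>N. norm (of_nat (part_upto A (Suc d) N) * x ^ N))"
    and "(\<Sum>N. of_nat (part_upto A (Suc d) N) * x ^ N) =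
         (\<Sum>N. of_nat (part_upto A d N) * x ^ N) / (1 - x ^ Suc d)"
proof -
  define c where "c = (\<lambda>N. of_nat (part_upto A d N) * x ^ N)"
  define c' where "c' = (\<lambda>N. of_nat (part_upto A (Suc d) N) * x ^ N)"
  define e where "e = Suc d"
  show sm': "summable (\<lambda>N. norm (of_nat (part_upto A (Suc d) N) * x ^ N))"
    using part_gf_step_real[of "norm x" d A] x A sm by (simp add: norm_mult norm_power)
  have rec: "c' N = c N + (if e \<le> N then x ^ e * c' (N - e) else 0)" for N
  proof (cases "e \<le> N")
    case True
    hence "x ^ N = x ^ e * x ^ (N - e)" by (simp flip: power_add)
    thus ?thesis using True part_count_rec[OF A, of N]
      unfolding c'_def c_def e_def [symmetric] by (simp add: distrib_right)
  next
    case False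
    thus ?thesis using part_count_rec[OF A, of N] by (simp add: c'_def c_def e_def)
  qed
  have s: "summable c" "summable c'"
    using sm sm' by (auto simp: c_def c'_def intro: summable_norm_cancel)
  have "(\<lambda>N. x ^ e * c' N) sums (x ^ e * suminf c')" by (intro sums_mult summable_sums s)
  hence "(\<lambda>N. if e \<le> N then x ^ e * c' (N - e) else 0) sums (x ^ e * suminf c')"
    by (subst sums_zero_iff_shift[of e, symmetric]) simp_all
  hence "(\<lambda>N. c N + (if e \<le> N then x ^ e * c' (N - e) else 0)) sums (suminf c + x ^ e * suminf c')"
    by (intro sums_add summable_sums s)
  hence "c' sums (suminf c + x ^ e * suminf c')" by (simp only: rec [symmetric])
  hence "suminf c' = suminf c + x ^ e * suminf c'" by (simp add: sums_iff)
  moreover have "norm (x ^ e) < 1" using x power_strict_mono[of "norm x" 1 e] by (simp add: e_def norm_power del: power_Suc)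
  hence "1 - x ^ e \<noteq> 0" by auto
  ultimately have "suminf c' = suminf c / (1 - x ^ e)" by (simp add: field_simps)
  thus "(\<Sum>N. of_nat (part_upto A (Suc d) N) * x ^ N) =
         (\<Sum>N. of_nat (part_upto A d N) * x ^ N) / (1 - x ^ Suc d)"
    unfolding c_def c'_def e_def .
qed

text \<open>The logarithm of the generating function, in x = exp (- z), of the partitions with all
  parts in \<open>A\<close>, again as a sum of principal logarithms.\<close>

definition lnG :: "nat set \<Rightarrow> complex \<Rightarrow> complex" where
  "lnG A z = (\<Sum>n. if Suc n \<in> A then lnF_term z n else 0)"

lemma summable_lnG:
  assumes "Re z > 0"
  shows "summable (\<lambda>n. if Suc n \<in> A then lnF_term z n else 0)"
  by (rule summable_comparison_test'[OF summable_lnF(2)[OF assms]]) simp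

lemma part_gf_truncated:
  assumes z: "Re z > 0"
  defines "x \<equiv> exp (- z)"
  shows "summable (\<lambda>N. norm (of_nat (part_upto A d N) * x ^ N)) \<and>
    (\<Sum>N. of_nat (part_upto A d N) * x ^ N) =
      exp (\<Sum>n<d. if Suc n \<in> A then lnF_term z n else 0)"
proof (induction d)
  case 0
  have eq: "of_nat (part_upto A 0 N) * x ^ N = (if N = 0 then 1 else 0)" for N
    unfolding part_count_empty by simp
  have "(\<lambda>N. if N = 0 then 1 else 0 :: complex) sums 1"
    using sums_single[of 0 "\<lambda>_. 1 :: complex"] by simp
  moreover have "summable (\<lambda>N. norm (if N = 0 then 1 else 0 :: complex))"
    by (rule summable_finite[of "{0}"]) auto
  ultimately show ?case unfolding eq by (simp add: sums_iff)
next
  case (Suc d)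
  have x: "norm x < 1" using z by (simp add: x_def)
  show ?case
  proof (cases "Suc d \<in> A")
    case True
    note step = part_gf_step[OF x True Suc.IH[THEN conjunct1]]
    have xe: "x ^ Suc d = exp (-(of_nat (Suc d) * z))"
      by (simp only: x_def exp_of_nat_mult [symmetric]) simp
    have "norm (x ^ Suc d) < 1" using x power_strict_mono[of "norm x" 1 "Suc d"] by (simp add: norm_power del: power_Suc)
    hence "1 - x ^ Suc d \<noteq> 0" by auto
    hence "exp (- Ln (1 - x ^ Suc d)) = 1 / (1 - x ^ Suc d)"
      by (simp add: exp_minus field_simps)
    hence "(\<Sum>N. of_nat (part_upto A (Suc d) N) * x ^ N) =
      exp (\<Sum>n<d. if Suc n \<in> A then lnF_term z n else 0) * exp (- Ln (1 - x ^ Suc d))"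
      unfolding step(2) Suc.IH[THEN conjunct2] by simp
    thus ?thesis using step(1) True
      by (simp only: sum.lessThan_Suc exp_add if_True xe [symmetric] simp_thms)
  next
    case False
    thus ?thesis using Suc.IH by (simp add: part_count_skip)
  qed
qed

theorem part_gf:
  assumes z: "Re z > 0"
  shows "summable (\<lambda>N. real (part_count A N) * exp (- Re z) ^ N)"
    and "(\<lambda>N. of_nat (part_count A N) * exp (- z) ^ N) sums exp (lnG A z)"
proof -
  define a where "a = Re z"
  define B where "B = (\<Sum>n. norm (lnF_term (complex_of_real a) n))"
  have a: "Re (complex_of_real a) > 0" using z by (simp add: a_def)
  note tr = part_gf_truncated[OF a]
  have eqr: "of_nat (part_count S N) * exp (- complex_of_real a) ^ N = of_real (real (part_count S N) * exp (-a) ^ N)" for S N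
  proof -
    have "exp (- complex_of_real a) = of_real (exp (- a))" using exp_of_real[of "- a"] by simp
    thus ?thesis by simp
  qed
  have normr: "norm (complex_of_nat (part_count S N) * exp (- complex_of_real a) ^ N) = real (part_count S N) * exp (-a) ^ N" for S N
    unfolding eqr by (simp add: norm_mult norm_power)
  have bound: "(\<Sum>N<K. real (part_count A N) * exp (- a) ^ N) \<le> exp B" for K
  proof -
    have sK: "summable (\<lambda>N. real (part_upto A K N) * exp (-a) ^ N)"
      using tr[THEN conjunct1, of A K] unfolding normr .
    have "(\<Sum>N<K. real (part_count A N) * exp (- a) ^ N) = (\<Sum>N<K. real (part_upto A K N) * exp (- a) ^ N)"
      by (intro sum.cong refl) (simp add: part_count_truncate)
    also have "\<dots> \<le> (\<Sum>N. real (part_upto A K N) * exp (- a) ^ N)"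
      by (rule sum_le_suminf[OF sK]) auto
    also have "\<dots> = norm (complex_of_real \<dots>)" using sK by (simp add: suminf_nonneg)
    also have "complex_of_real (\<Sum>N. real (part_upto A K N) * exp (- a) ^ N) =
       exp (\<Sum>n<K. if Suc n \<in> A then lnF_term (complex_of_real a) n else 0)"
      using tr[THEN conjunct2, of A K] suminf_of_real[OF sK, where 'a = complex] unfolding eqr by simp
    also have "norm \<dots> \<le> exp (norm (\<Sum>n<K. if Suc n \<in> A then lnF_term (complex_of_real a) n else 0))"
      by (rule norm_exp)
    also have "\<dots> \<le> exp (\<Sum>n<K. norm (lnF_term (complex_of_real a) n))"
      unfolding exp_le_cancel_iff by (intro sum_norm_le) auto
    also have "\<dots> \<le> exp B"
      unfolding exp_le_cancel_iff B_def by (intro sum_le_suminf summable_lnF(2) a) auto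
    finally show ?thesis .
  qed
  show sm: "summable (\<lambda>N. real (part_count A N) * exp (- Re z) ^ N)"
    unfolding a_def [symmetric] by (rule summableI_nonneg_bounded[OF _ bound]) simp
  have nx: "norm (exp (- z)) = exp (- a)" by (simp add: a_def norm_exp_eq_Re)
  have "(\<lambda>d. \<Sum>N. of_nat (part_upto A d N) * exp (- z) ^ N) \<longlonglongrightarrow> (\<Sum>N. of_nat (part_count A N) * exp (- z) ^ N)"
  proof (rule tannerys_theorem[THEN conjunct2, THEN conjunct2])
    show "summable (\<lambda>N. real (part_count A N) * exp (- a) ^ N)" using sm by (simp add: a_def)
    show "\<forall>\<^sub>F (N, d) in sequentially \<times>\<^sub>F sequentially. norm (of_nat (part_upto A d N) * exp (- z) ^ N) \<le> real (part_count A N) * exp (- a) ^ N"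
      unfolding norm_mult norm_power nx by (intro always_eventually) (auto intro!: mult_right_mono part_count_mono)
    fix N
    have "\<forall>\<^sub>F d in sequentially. of_nat (part_upto A d N) * exp (- z) ^ N = of_nat (part_count A N) * exp (- z) ^ N"
      using eventually_ge_at_top[of N] by eventually_elim (simp add: part_count_truncate)
    thus "(\<lambda>d. of_nat (part_upto A d N) * exp (- z) ^ N) \<longlonglongrightarrow> of_nat (part_count A N) * exp (- z) ^ N"
      by (rule tendsto_eventually)
  qed simp
  moreover have "(\<lambda>d. \<Sum>N. of_nat (part_upto A d N) * exp (- z) ^ N) \<longlonglongrightarrow> exp (lnG A z)"
    unfolding part_gf_truncated[OF z, THEN conjunct2] lnG_def
    by (intro tendsto_exp summable_LIMSEQ summable_lnG z)
  ultimately have "(\<Sum>N. of_nat (part_count A N) * exp (- z) ^ N) = exp (lnG A z)"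
    by (rule LIMSEQ_unique)
  moreover have "summable (\<lambda>N. of_nat (part_count A N) * exp (- z) ^ N)"
    by (rule summable_norm_cancel) (use sm in \<open>simp add: norm_mult norm_power nx a_def\<close>)
  ultimately show "(\<lambda>N. of_nat (part_count A N) * exp (- z) ^ N) sums exp (lnG A z)"
    by (simp add: sums_iff)
qed

lemma lnG_UNIV: "lnG UNIV z = lnF z"
  by (simp add: lnG_def lnF_def)

lemma multiples_sums:
  fixes t :: "nat \<Rightarrow> 'a :: real_normed_vector"
  assumes q: "q > 0" and "(\<lambda>k. t (q * Suc k)) sums S"
  shows "(\<lambda>n. if q dvd Suc n then t (Suc n) else 0) sums S"
proof -
  define g where "g = (\<lambda>k. q * Suc k - 1)"
  have g: "Suc (g k) = q * Suc k" for k using q by (simp add: g_def)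
  have mono: "strict_mono g" unfolding strict_mono_Suc_iff
  proof
    fix k
    have "Suc (g k) < Suc (g (Suc k))" unfolding g using q by simp
    thus "g k < g (Suc k)" by simp
  qed
  have "(\<lambda>k. if q dvd Suc (g k) then t (Suc (g k)) else 0) sums S"
    using assms(2) by (simp only: g dvd_triv_left if_True)
  also have "(\<lambda>k. if q dvd Suc (g k) then t (Suc (g k)) else 0) sums S \<longleftrightarrow>
      (\<lambda>n. if q dvd Suc n then t (Suc n) else 0) sums S"
  proof (rule sums_mono_reindex[OF mono])
    fix n assume "n \<notin> range g"
    hence "\<not> q dvd Suc n"
    proof (rule contrapos_nn)
      assume "q dvd Suc n"
      then obtain j where j: "Suc n = q * j" by (auto elim: dvdE)
      then obtain k where "j = Suc k" by (cases j) auto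
      with j have "n = g k" using g[of k] by simp
      thus "n \<in> range g" by simp
    qed
    thus "(if q dvd Suc n then t (Suc n) else 0) = 0" by simp
  qed
  finally show ?thesis .
qed

lemma lnG_regular:
  assumes z: "Re z > 0" and q: "q > 0"
  shows "lnG {n. \<not> q dvd n} z = lnF z - lnF (of_nat q * z)"
proof -
  define t where "t = (\<lambda>n. - Ln (1 - exp (-(of_nat n * z))))"
  have qz: "Re (of_nat q * z) > 0" using z q by simp
  have assoc: "of_nat (q * Suc k) * z = of_nat (Suc k) * (of_nat q * z)" for k
    unfolding of_nat_mult by (simp only: mult.assoc mult.commute mult.left_commute)
  have "(\<lambda>k. t (q * Suc k)) sums lnF (of_nat q * z)"
    unfolding t_def assoc lnF_def by (rule summable_sums[OF summable_lnF(1)[OF qz]])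
  hence "(\<lambda>n. if q dvd Suc n then t (Suc n) else 0) sums lnF (of_nat q * z)"
    by (rule multiples_sums[OF q])
  moreover have "(\<lambda>n. t (Suc n)) sums lnF z"
    unfolding t_def lnF_def by (rule summable_sums[OF summable_lnF(1)[OF z]])
  ultimately have "(\<lambda>n. t (Suc n) - (if q dvd Suc n then t (Suc n) else 0)) sums (lnF z - lnF (of_nat q * z))"
    by (rule sums_diff[rotated])
  also have "(\<lambda>n. t (Suc n) - (if q dvd Suc n then t (Suc n) else 0)) =
     (\<lambda>n. if Suc n \<in> {n. \<not> q dvd n} then lnF_term z n else 0)"
    by (auto simp: t_def)
  finally show ?thesis unfolding lnG_def by (simp only: sums_iff)
qed

section \<open>Cauchy integrals and the decay away from the real axis\<close>

lemma exp_int_has_integral: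
  fixes m :: int and s :: real
  shows "((\<lambda>\<theta>. exp (of_int m * Complex s \<theta>)) has_integral (if m = 0 then of_real (2 * pi) else 0)) {-pi..pi}"
proof (cases "m = 0")
  case True
  thus ?thesis using has_integral_const_real[of "1::complex" "-pi" pi] by (simp add: scaleR_conv_of_real)
next
  case False
  define F where "F = (\<lambda>\<theta>. exp (of_int m * Complex s \<theta>) / (of_int m * \<i>))"
  have C: "Complex s \<theta> = of_real s + \<i> * of_real \<theta>" for \<theta> by (simp add: complex_eq_iff)
  have "((\<lambda>\<theta>. exp (of_int m * Complex s \<theta>)) has_integral (F pi - F (-pi))) {-pi..pi}"
  proof (rule fundamental_theorem_of_calculus)
    fix x assume "x \<in> {-pi..pi}"
    have "((\<lambda>\<theta>. exp (of_int m * (of_real s + \<i> * \<theta>)) / (of_int m * \<i>)) has_field_derivative exp (of_int m * Complex s x)) (at (of_real x))"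
      unfolding C using False by (auto intro!: derivative_eq_intros simp: field_simps)
    hence "((\<lambda>\<theta>. exp (of_int m * (of_real s + \<i> * of_real \<theta>)) / (of_int m * \<i>)) has_vector_derivative exp (of_int m * Complex s x)) (at x)"
      by (rule has_vector_derivative_real_field)
    thus "(F has_vector_derivative exp (of_int m * Complex s x)) (at x within {-pi..pi})"
      unfolding F_def C by (rule has_vector_derivative_at_within)
  qed simp
  moreover have "F pi = F (-pi)"
  proof -
    have "exp (of_int m * Complex s pi) = exp (of_int m * Complex s (-pi) + 2 * of_int m * of_real pi * \<i>)"
      unfolding C by (rule arg_cong[of _ _ exp]) (simp add: algebra_simps)
    also have "\<dots> = exp (of_int m * Complex s (-pi)) * exp (2 * of_int m * of_real pi * \<i>)"
      by (rule exp_add)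
    also have "exp (2 * of_int m * of_real pi * \<i>) = (1::complex)"
      using exp_integer_2pi[of "of_int m"] by (simp add: mult_ac)
    finally show ?thesis by (simp add: F_def)
  qed
  ultimately show ?thesis using False by simp
qed

text \<open>Cauchy's coefficient formula on the circle of radius exp (- s), parametrised by x = exp
  (- s - i \<theta>). The power series converges uniformly there, and orthogonality of the
  exponentials keeps only the N-th coefficient.\<close>

theorem part_count_integral:
  assumes s: "s > 0"
  shows "((\<lambda>\<theta>. exp (lnG A (Complex s \<theta>) + of_nat N * Complex s \<theta>)) has_integral
            of_real (2 * pi * real (part_count A N))) {-pi..pi}"
proof -
  define f where "f = (\<lambda>k \<theta>. of_nat (part_count A k) * exp (of_int (int N - int k) * Complex s \<theta>))"
  have f: "f k \<theta> = of_nat (part_count A k) * exp (- Complex s \<theta>) ^ k * exp (of_nat N * Complex s \<theta>)" for k \<theta>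
  proof -
    have "exp (of_int (int N - int k) * Complex s \<theta>) = exp (of_nat k * (- Complex s \<theta>) + of_nat N * Complex s \<theta>)"
      by (rule arg_cong[of _ _ exp]) (simp add: algebra_simps)
    also have "\<dots> = exp (- Complex s \<theta>) ^ k * exp (of_nat N * Complex s \<theta>)"
      by (simp only: exp_add exp_of_nat_mult)
    finally show ?thesis by (simp add: f_def)
  qed
  have lim: "uniform_limit {-pi..pi} (\<lambda>n \<theta>. \<Sum>k<n. f k \<theta>) (\<lambda>\<theta>. exp (lnG A (Complex s \<theta>) + of_nat N * Complex s \<theta>)) sequentially"
  proof -
    have "uniform_limit {-pi..pi} (\<lambda>n \<theta>. \<Sum>k<n. f k \<theta>) (\<lambda>\<theta>. \<Sum>k. f k \<theta>) sequentially"
    proof (rule Weierstrass_m_test)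
      show "summable (\<lambda>k. real (part_count A k) * exp (- s) ^ k * exp (real N * s))"
        using part_gf(1)[of "of_real s" A] s by (intro summable_mult2) simp
      show "norm (f k \<theta>) \<le> real (part_count A k) * exp (- s) ^ k * exp (real N * s)" for k \<theta>
        unfolding f by (simp add: norm_mult norm_power norm_exp_eq_Re)
    qed
    moreover have "(\<Sum>k. f k \<theta>) = exp (lnG A (Complex s \<theta>) + of_nat N * Complex s \<theta>)" for \<theta>
      unfolding f exp_add using sums_mult2[OF part_gf(2)[of "Complex s \<theta>" A]] s
      by (intro sums_unique [symmetric]) simp
    ultimately show ?thesis by simp
  qed
  have cont: "continuous_on {-pi..pi} (\<lambda>\<theta>. \<Sum>k<n. f k \<theta>)" for n
    unfolding f_def by (intro continuous_intros)
  obtain I J where IJ: "\<And>n. ((\<lambda>\<theta>. \<Sum>k<n. f k \<theta>) has_integral I n) {-pi..pi}"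
      "((\<lambda>\<theta>. exp (lnG A (Complex s \<theta>) + of_nat N * Complex s \<theta>)) has_integral J) {-pi..pi}" "I \<longlonglongrightarrow> J"
    using uniform_limit_integral[OF lim cont] by auto
  have "I n = of_real (2 * pi * real (part_count A N))" if "n > N" for n
  proof -
    have "((\<lambda>\<theta>. \<Sum>k<n. f k \<theta>) has_integral (\<Sum>k<n. of_nat (part_count A k) * (if int N - int k = 0 then of_real (2 * pi) else 0))) {-pi..pi}"
      unfolding f_def by (intro has_integral_sum has_integral_mult_right exp_int_has_integral) auto
    also have "(\<Sum>k<n. of_nat (part_count A k) * (if int N - int k = 0 then of_real (2 * pi) else 0)) =
       (\<Sum>k\<in>{N}. of_nat (part_count A k) * complex_of_real (2 * pi))"
      using that by (intro sum.mono_neutral_cong_right) auto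
    finally show ?thesis using IJ(1)[of n] by (simp add: has_integral_unique mult_ac)
  qed
  hence "I \<longlonglongrightarrow> of_real (2 * pi * real (part_count A N))"
    by (intro tendsto_eventually) (auto simp: eventually_at_top_linorder intro!: exI[of _ "Suc N"])
  hence "J = of_real (2 * pi * real (part_count A N))" using IJ(3) LIMSEQ_unique by blast
  thus ?thesis using IJ(2) by simp
qed

section \<open>Comparison of the integrand with its value on the real axis\<close>

lemma abs_sin_mult_le: "\<bar>sin (real n * x)\<bar> \<le> real n * \<bar>sin x\<bar>"
proof (induction n)
  case (Suc n)
  have "\<bar>sin (real (Suc n) * x)\<bar> = \<bar>sin (real n * x) * cos x + cos (real n * x) * sin x\<bar>"
  proof -
    have "real (Suc n) * x = real n * x + x" by (simp add: algebra_simps)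
    thus ?thesis by (simp only: sin_add)
  qed
  also have "\<dots> \<le> \<bar>sin (real n * x)\<bar> * \<bar>cos x\<bar> + \<bar>cos (real n * x)\<bar> * \<bar>sin x\<bar>"
    unfolding abs_mult [symmetric] by (rule abs_triangle_ineq)
  also have "\<dots> \<le> \<bar>sin (real n * x)\<bar> * 1 + 1 * \<bar>sin x\<bar>"
    by (intro add_mono mult_mono) auto
  also have "\<dots> \<le> real (Suc n) * \<bar>sin x\<bar>" using Suc.IH by (simp add: algebra_simps)
  finally show ?case .
qed simp

lemma sinh_mult_ge: "x \<ge> 0 \<Longrightarrow> sinh (real n * x) \<ge> real n * sinh (x::real)"
proof (induction n)
  case (Suc n)
  have "real n * sinh x * 1 + 1 * sinh x \<le> sinh (real n * x) * cosh x + cosh (real n * x) * sinh x"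
    using Suc by (intro add_mono mult_mono) (auto simp: cosh_real_ge_1)
  also have "\<dots> = sinh (real (Suc n) * x)"
  proof -
    have "real (Suc n) * x = real n * x + x" by (simp add: algebra_simps)
    thus ?thesis by (simp only: sinh_add)
  qed
  finally show ?case by (simp add: algebra_simps)
qed simp

lemma cosh_double_sinh: "cosh (2 * x) = 1 + 2 * (sinh x)\<^sup>2" for x :: real
  using cosh_add[of x x] cosh_square_eq[of x] by (simp add: power2_eq_square)

lemma cosh_gt_one:
  fixes x :: real
  assumes "x > 0"
  shows "cosh x > 1"
  using cosh_double_sinh[of "x/2"] assms by simp

text \<open>Up to the factor coth (s/2) / 2, this is the sum over n \<ge> 1 of r^n - Re x^n for r =
  exp (- s) and x = exp (- s - i \<theta>), that is, the loss suffered by a geometric series at the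
  angle \<theta> (\<open>geometric_cos_sum\<close>).\<close>

definition kernel_quot :: "real \<Rightarrow> real \<Rightarrow> real" where
  "kernel_quot s \<theta> = (1 - cos \<theta>) / (cosh s - cos \<theta>)"

lemma cosh_minus_cos_pos: "s > 0 \<Longrightarrow> cosh s - cos \<theta> > (0::real)"
  using cosh_gt_one[of s] cos_le_one[of \<theta>] by linarith

text \<open>In half angles the quotient has the form a / (a + b) with a = 2 sin^2 (\<theta>/2) and b
  = 2 sinh^2 (s/2). Scaling by q multiplies a by at most q^2 and b by at least q^2.\<close>

lemma kernel_quot_scale:
  assumes s: "s > 0" and q: "q > 0"
  shows "kernel_quot (real q * s) (real q * \<theta>) \<le> kernel_quot s \<theta>"
proof -
  define a b a' b' where "a = 1 - cos \<theta>" and "b = cosh s - 1" and "a' = 1 - cos (q * \<theta>)" and "b' = cosh (q * s) - 1"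
  have dbl: "1 - cos t = 2 * (sin (t/2))\<^sup>2" "cosh t - 1 = 2 * (sinh (t/2))\<^sup>2" for t :: real
    using cos_double_sin[of "t/2"] cosh_double_sinh[of "t/2"] by auto
  have pos: "b > 0" "b' > 0" "a \<ge> 0" "a' \<ge> 0"
    using s q cosh_gt_one[of s] cosh_gt_one[of "q * s"] by (auto simp: a_def b_def a'_def b'_def)
  have "a' \<le> q\<^sup>2 * a"
  proof -
    have "\<bar>sin (q * (\<theta>/2))\<bar>\<^sup>2 \<le> (q * \<bar>sin (\<theta>/2)\<bar>)\<^sup>2" by (intro power_mono abs_sin_mult_le) auto
    thus ?thesis unfolding a_def a'_def dbl by (simp add: power_mult_distrib)
  qed
  moreover have "q\<^sup>2 * b \<le> b'"
  proof -
    have "(q * sinh (s/2))\<^sup>2 \<le> (sinh (q * (s/2)))\<^sup>2" using s by (intro power_mono sinh_mult_ge) auto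
    thus ?thesis unfolding b_def b'_def dbl by (simp add: power_mult_distrib)
  qed
  ultimately have "a' * b \<le> (q\<^sup>2 * a) * b" "a * (q\<^sup>2 * b) \<le> a * b'"
    using pos by (intro mult_right_mono mult_left_mono; simp)+
  hence "a' * b \<le> a * b'" by (simp add: mult_ac)
  hence "a' / (b' + a') \<le> a / (b + a)" using pos by (simp add: divide_simps) (simp add: algebra_simps)
  thus ?thesis by (simp add: kernel_quot_def a_def b_def a'_def b'_def algebra_simps)
qed

lemma geometric_cos_sum:
  assumes s: "s > 0"
  shows "(\<lambda>n. exp (- s) ^ Suc n - Re (exp (- Complex s \<theta>) ^ Suc n)) sums
           ((1 + exp (- s)) / (1 - exp (- s)) * kernel_quot s \<theta> / 2)"
proof -
  define r x where "r = exp (- s)" and "x = exp (- Complex s \<theta>)"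
  have r: "0 < r" "r < 1" using s by (auto simp: r_def)
  have x: "Re x = r * cos \<theta>" "norm x = r" by (auto simp: x_def r_def Re_exp norm_exp_eq_Re)
  have geo: "(\<lambda>n. y ^ Suc n) sums (y / (1 - y))" if "norm y < 1" for y :: "'a :: {real_normed_field, banach}"
    using sums_mult[OF geometric_sums[OF that], of y] by simp
  have "(\<lambda>n. Re (x ^ Suc n)) sums Re (x / (1 - x))"
    using x r by (intro sums_Re geo) simp
  hence sums: "(\<lambda>n. r ^ Suc n - Re (x ^ Suc n)) sums (r / (1 - r) - Re (x / (1 - x)))"
    using r by (intro sums_diff geo) simp_all
  define k c where "k = cos \<theta>" and "c = cosh s"
  have ck: "c - k > 0" using cosh_minus_cos_pos[OF s] by (simp add: c_def k_def)
  have rc: "1 + r\<^sup>2 = 2 * r * c"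
  proof -
    have "exp s = 1 / r" by (simp add: r_def exp_minus field_simps)
    hence "c = (1 / r + r) / 2" by (simp add: c_def cosh_def r_def)
    thus ?thesis using r by (simp add: field_simps power2_eq_square)
  qed
  have n1: "(norm (1 - x))\<^sup>2 = 2 * r * (c - k)"
  proof -
    have "(norm (1 - x))\<^sup>2 = 1 - 2 * Re x + (norm x)\<^sup>2"
      by (simp add: cmod_power2 power2_diff)
    also have "\<dots> = (1 + r\<^sup>2) - 2 * r * k" by (simp add: x k_def)
    finally show ?thesis unfolding rc by (simp add: algebra_simps)
  qed
  have "Re (x / (1 - x)) = Re (x * cnj (1 - x)) / (norm (1 - x))\<^sup>2"
    by (subst complex_div_cnj) (simp add: Re_divide_of_real flip: of_real_power)
  also have "Re (x * cnj (1 - x)) = Re x - (norm x)\<^sup>2"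
    unfolding cmod_power2 by (simp add: power2_eq_square algebra_simps)
  also have "(Re x - (norm x)\<^sup>2) / (norm (1 - x))\<^sup>2 = (k - r) / (2 * (c - k))"
    unfolding n1 x using r ck by (simp add: k_def field_simps power2_eq_square)
  finally have "r / (1 - r) - Re (x / (1 - x)) = r / (1 - r) - (k - r) / (2 * (c - k))" by simp
  also have "\<dots> = (2 * r * (c - k) - (k - r) * (1 - r)) / (2 * (1 - r) * (c - k))"
    using r ck by (simp add: divide_simps) (simp add: algebra_simps)
  also have "2 * r * (c - k) - (k - r) * (1 - r) = (1 + r) * (1 - k)"
    using rc by (simp add: algebra_simps power2_eq_square)
  also have "(1 + r) * (1 - k) / (2 * (1 - r) * (c - k)) = (1 + r) / (1 - r) * kernel_quot s \<theta> / 2"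
    by (simp add: kernel_quot_def k_def c_def)
  finally show ?thesis using sums by (simp add: r_def x_def)
qed

text \<open>In the series of the logarithm every difference (norm w)^n / n - Re (w^n) / n is
  nonnegative, so that the total gap is at least its first term.\<close>

lemma Re_minus_Ln_one_minus_le:
  fixes w :: complex
  assumes "norm w < 1"
  shows "Re (- Ln (1 - w)) \<le> - ln (1 - norm w) - (norm w - Re w)"
proof -
  have 1: "(\<lambda>n. Re (w ^ Suc n / of_nat (Suc n))) sums Re (- Ln (1 - w))"
    by (intro sums_Re minus_Ln_one_minus_sums assms)
  have 2: "(\<lambda>n. norm w ^ Suc n / of_nat (Suc n)) sums (- ln (1 - norm w))"
    using assms by (intro minus_ln_one_minus_sums) simp
  have "(\<lambda>n. norm w ^ Suc n / of_nat (Suc n) - Re (w ^ Suc n / of_nat (Suc n))) sums (- ln (1 - norm w) - Re (- Ln (1 - w)))"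
    by (intro sums_diff 1 2)
  moreover have "norm w ^ Suc n / of_nat (Suc n) - Re (w ^ Suc n / of_nat (Suc n)) \<ge> 0" for n
    using complex_Re_le_cmod[of "w ^ Suc n / of_nat (Suc n)"] by (simp add: norm_divide norm_power norm_mult del: of_nat_Suc)
  ultimately have "(\<Sum>n\<in>{0}. norm w ^ Suc n / of_nat (Suc n) - Re (w ^ Suc n / of_nat (Suc n))) \<le> - ln (1 - norm w) - Re (- Ln (1 - w))"
    by (intro sum_le_suminf[THEN order.trans]) (auto simp: sums_iff)
  thus ?thesis by simp
qed

lemma Re_lnG_le:
  assumes s: "s > 0" and T: "(\<lambda>n. if Suc n \<in> A then exp (- s) ^ Suc n - Re (exp (- Complex s \<theta>) ^ Suc n) else 0) sums T"
  shows "Re (lnG A (Complex s \<theta>)) \<le> Re (lnG A (of_real s)) - T"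
proof -
  have e: "exp (-(of_nat (Suc n) * z)) = exp (- z) ^ Suc n" for z :: complex and n
    by (simp only: exp_of_nat_mult [symmetric]) (simp add: algebra_simps)
  have z: "Re (Complex s \<theta>) > 0" "Re (of_real s) > 0" using s by auto
  have 1: "(\<lambda>n. Re (if Suc n \<in> A then lnF_term (Complex s \<theta>) n else 0)) sums Re (lnG A (Complex s \<theta>))"
    unfolding lnG_def by (intro sums_Re summable_sums summable_lnG z)
  have 2: "(\<lambda>n. Re (if Suc n \<in> A then lnF_term (of_real s) n else 0)) sums Re (lnG A (of_real s))"
    unfolding lnG_def by (intro sums_Re summable_sums summable_lnG z)
  show ?thesis
  proof (rule sums_le[OF _ 1 sums_diff[OF 2 T]])
    fix n
    define w where "w = exp (- Complex s \<theta>) ^ Suc n"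
    define r where "r = exp (- s) ^ Suc n"
    have nw: "norm w = r" by (simp add: w_def r_def norm_power norm_mult norm_exp_eq_Re)
    have r: "r < 1" "r \<ge> 0" unfolding r_def using s power_strict_mono[of "exp (-s)" 1 "Suc n"] by (auto simp del: power_Suc)
    have "exp (- complex_of_real s) ^ Suc n = of_real r"
      using exp_of_real[of "-s", where 'a = complex] by (simp add: r_def)
    moreover have "Re (- Ln (1 - of_real r)) = - ln (1 - r)"
      using r Ln_of_real[of "1 - r"] by simp
    moreover have "Re (- Ln (1 - w)) \<le> - ln (1 - r) - (r - Re w)"
      using Re_minus_Ln_one_minus_le[of w] r unfolding nw by blast
    ultimately show "Re (if Suc n \<in> A then lnF_term (Complex s \<theta>) n else 0)
      \<le> Re (if Suc n \<in> A then lnF_term (of_real s) n else 0) -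
         (if Suc n \<in> A then exp (- s) ^ Suc n - Re (exp (- Complex s \<theta>) ^ Suc n) else 0)"
      unfolding e w_def [symmetric] r_def [symmetric] by auto
  qed
qed

text \<open>The quotients are coth (s/2) and coth (y/2). The latter is at most coth s, and coth
  (s/2) - coth s = 1 / sinh s.\<close>

lemma coth_half_diff:
  fixes s :: real
  assumes s: "s > 0" and "y \<ge> 2 * s"
  shows "(1 + exp (- s)) / (1 - exp (- s)) - (1 + exp (- y)) / (1 - exp (- y)) \<ge> 1 / sinh s"
proof -
  define r where "r = exp (- s)"
  have r: "0 < r" "r < 1" using s by (auto simp: r_def)
  have r2: "r\<^sup>2 < 1" using r by (simp add: power_less_one_iff abs_square_less_1)
  have y: "exp (- y) \<le> r\<^sup>2" using assms by (simp add: r_def flip: exp_of_nat_mult)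
  have "(1 + exp (- y)) / (1 - exp (- y)) \<le> (1 + r\<^sup>2) / (1 - r\<^sup>2)"
    using y r2 by (intro frac_le) auto
  moreover have "(1 + r) / (1 - r) - (1 + r\<^sup>2) / (1 - r\<^sup>2) = 2 * r / (1 - r\<^sup>2)"
  proof -
    have "(1 + r) / (1 - r) = (1 + r)\<^sup>2 / (1 - r\<^sup>2)"
      using r r2 by (simp add: divide_simps) (simp add: power2_eq_square algebra_simps)
    thus ?thesis by (simp add: diff_divide_distrib [symmetric] power2_eq_square algebra_simps)
  qed
  moreover have "1 / sinh s = 2 * r / (1 - r\<^sup>2)"
  proof -
    have "exp s = 1 / r" by (simp add: r_def exp_minus field_simps)
    hence "sinh s = (1 / r - r) / 2" by (simp add: sinh_def r_def)
    also have "\<dots> = (1 - r\<^sup>2) / (2 * r)" using r by (simp add: field_simps power2_eq_square)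
    finally show ?thesis by simp
  qed
  ultimately show ?thesis by (simp add: r_def)
qed

lemma Re_lnG_UNIV_le:
  assumes s: "s > 0"
  shows "Re (lnG UNIV (Complex s \<theta>)) \<le> Re (lnG UNIV (of_real s)) - kernel_quot s \<theta> / (2 * sinh s)"
proof -
  have k: "kernel_quot s \<theta> \<ge> 0" using cosh_minus_cos_pos[OF s, of \<theta>] by (simp add: kernel_quot_def)
  have "1 / sinh s \<le> (1 + exp (- s)) / (1 - exp (- s))"
  proof -
    have "(1 + exp (- (2 * s))) / (1 - exp (- (2 * s))) \<ge> 0" using s by (intro divide_nonneg_nonneg) auto
    thus ?thesis using coth_half_diff[OF s, of "2 * s"] by linarith
  qed
  moreover define C where "C = (1 + exp (- s)) / (1 - exp (- s))"
  ultimately have "1 / sinh s * kernel_quot s \<theta> \<le> C * kernel_quot s \<theta>"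
    using k by (intro mult_right_mono) auto
  moreover define D where "D = 1 / sinh s * kernel_quot s \<theta>"
  moreover have "Re (lnG UNIV (Complex s \<theta>)) \<le> Re (lnG UNIV (of_real s)) - C * kernel_quot s \<theta> / 2"
    unfolding C_def using geometric_cos_sum[OF s, of \<theta>] by (intro Re_lnG_le s) simp
  moreover have "kernel_quot s \<theta> / (2 * sinh s) = D / 2" by (simp add: D_def)
  ultimately show ?thesis by simp
qed

text \<open>Omitting the multiples of q subtracts the loss of the geometric series at (q s, q
  \<theta>). By \<open>kernel_quot_scale\<close> this is at most coth (q s / 2) / 2 times the same
  quotient at (s, \<theta>), and q \<ge> 2 lets \<open>coth_half_diff\<close> leave a positive
  multiple.\<close>

lemma Re_lnG_regular_le:
  assumes s: "s > 0" and q: "q \<ge> 2"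
  shows "Re (lnG {n. \<not> q dvd n} (Complex s \<theta>)) \<le> Re (lnG {n. \<not> q dvd n} (of_real s)) - kernel_quot s \<theta> / (2 * sinh s)"
proof -
  define t where "t = (\<lambda>n. exp (- s) ^ n - Re (exp (- Complex s \<theta>) ^ n))"
  define C where "C = (\<lambda>s. (1 + exp (- s)) / (1 - exp (- s)) :: real)"
  have qs: "real q * s > 0" using s q by simp
  have C: "C (real q * s) \<ge> 0" using qs unfolding C_def by (intro divide_nonneg_nonneg) auto
  have k: "kernel_quot s \<theta> \<ge> 0" using cosh_minus_cos_pos[OF s, of \<theta>] by (simp add: kernel_quot_def)
  have t: "t (q * n) = exp (- (real q * s)) ^ n - Re (exp (- Complex (real q * s) (real q * \<theta>)) ^ n)" for n
  proof -
    have "exp (- s) ^ (q * n) = exp (- (real q * s)) ^ n"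
      unfolding exp_of_nat_mult [symmetric] by simp
    moreover have "exp (- Complex s \<theta>) ^ (q * n) = exp (- Complex (real q * s) (real q * \<theta>)) ^ n"
    proof -
      have "Complex (real q * s) (real q * \<theta>) = of_nat q * Complex s \<theta>" by (simp add: complex_eq_iff)
      thus ?thesis unfolding exp_of_nat_mult [symmetric] by (simp add: algebra_simps)
    qed
    ultimately show ?thesis by (simp add: t_def)
  qed
  have "(\<lambda>n. t (Suc n) - (if q dvd Suc n then t (Suc n) else 0)) sums
      (C s * kernel_quot s \<theta> / 2 - C (real q * s) * kernel_quot (real q * s) (real q * \<theta>) / 2)"
  proof (intro sums_diff multiples_sums)
    show "(\<lambda>n. t (Suc n)) sums (C s * kernel_quot s \<theta> / 2)"
      unfolding t_def C_def by (rule geometric_cos_sum[OF s])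
    show "(\<lambda>k. t (q * Suc k)) sums (C (real q * s) * kernel_quot (real q * s) (real q * \<theta>) / 2)"
      unfolding t C_def by (rule geometric_cos_sum[OF qs])
  qed (use q in auto)
  also have "(\<lambda>n. t (Suc n) - (if q dvd Suc n then t (Suc n) else 0)) =
     (\<lambda>n. if Suc n \<in> {n. \<not> q dvd n} then exp (- s) ^ Suc n - Re (exp (- Complex s \<theta>) ^ Suc n) else 0)"
    by (auto simp: t_def)
  finally have *: "Re (lnG {n. \<not> q dvd n} (Complex s \<theta>)) \<le> Re (lnG {n. \<not> q dvd n} (of_real s)) -
      (C s * kernel_quot s \<theta> / 2 - C (real q * s) * kernel_quot (real q * s) (real q * \<theta>) / 2)"
    by (rule Re_lnG_le[OF s])
  have "1 / sinh s * kernel_quot s \<theta> \<le> (C s - C (real q * s)) * kernel_quot s \<theta>"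
    unfolding C_def using s q by (intro mult_right_mono coth_half_diff k) auto
  moreover have "C (real q * s) * kernel_quot (real q * s) (real q * \<theta>) \<le> C (real q * s) * kernel_quot s \<theta>"
    using s q C by (intro mult_left_mono kernel_quot_scale) auto
  moreover have "kernel_quot s \<theta> / (2 * sinh s) = (1 / sinh s * kernel_quot s \<theta>) / 2" by simp
  ultimately show ?thesis using * by (simp add: left_diff_distrib)
qed

lemma kernel_bound:
  assumes s: "0 < s" "s \<le> 1" and \<theta>: "s \<le> \<bar>\<theta>\<bar>" "\<bar>\<theta>\<bar> \<le> pi"
  shows "kernel_quot s \<theta> / (2 * sinh s) \<ge> 1 / (68 * s)"
proof -
  have sinh_le: "sinh x \<le> 2 * x" if "0 \<le> x" "x \<le> 1" for x :: real
  proof -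
    have "exp x \<le> 1 + x + x\<^sup>2" using that by (rule exp_bound)
    moreover have "x\<^sup>2 \<le> x" using that by (simp add: power2_eq_square mult_left_le)
    moreover have "exp (- x) \<ge> 1 - x" using exp_ge_add_one_self[of "-x"] by simp
    ultimately show ?thesis using that by (simp add: sinh_def)
  qed
  define a b where "a = 1 - cos \<theta>" and "b = cosh s - 1"
  have "sin (s/2) \<ge> s/4"
  proof -
    obtain \<xi> where \<xi>: "0 < \<xi>" "\<xi> < s/2" "sin (s/2) - sin 0 = (s/2 - 0) * cos \<xi>"
      using MVT2[of 0 "s/2" sin cos] s by auto
    have "cos (pi/3) \<le> cos \<xi>"
      using \<xi> s pi_gt3 by (intro cos_monotone_0_pi_le) auto
    hence "s/2 * (1/2) \<le> s/2 * cos \<xi>" using s by (intro mult_left_mono) (auto simp: cos_60)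
    thus ?thesis using \<xi>(3) by simp
  qed
  hence "(s/4)\<^sup>2 \<le> (sin (s/2))\<^sup>2" using s by (intro power_mono) auto
  hence "s\<^sup>2/8 \<le> 1 - cos s" using cos_double_sin[of "s/2"] by (simp add: power2_eq_square)
  also have "\<dots> \<le> 1 - cos \<bar>\<theta>\<bar>" using cos_monotone_0_pi_le[of s "\<bar>\<theta>\<bar>"] s \<theta> by simp
  finally have a: "s\<^sup>2/8 \<le> a" by (simp add: a_def)
  have "(sinh (s/2))\<^sup>2 \<le> s\<^sup>2" using sinh_le[of "s/2"] s by (intro power_mono) auto
  hence b: "b \<le> 2 * s\<^sup>2" "0 < b" using cosh_double_sinh[of "s/2"] s cosh_gt_one[of s] by (auto simp: b_def)
  have "s\<^sup>2 > 0" using s by simp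
  \<comment> \<open>From a \<ge> s^2 / 8 and b \<le> 2 s^2. Hence the quotient is at least 1/17, and
    68 = 17 * 4 because 2 sinh s \<le> 4 s.\<close>
  hence "b \<le> 16 * a" "a > 0" using a b by linarith+
  hence "1 / 17 \<le> a / (b + a)" using b by (simp add: field_simps)
  hence "1 / 17 \<le> kernel_quot s \<theta>" by (simp add: kernel_quot_def a_def b_def)
  moreover have "sinh s \<le> 2 * s" "sinh s > 0" using s sinh_le[of s] by auto
  ultimately have "(1/17) / (2 * (2 * s)) \<le> kernel_quot s \<theta> / (2 * sinh s)"
    using s by (intro frac_le) auto
  thus ?thesis by simp
qed

section \<open>The saddle point integral\<close>

lemma gaussian_has_integral:
  assumes "c > 0"
  shows "((\<lambda>x. exp (- c * x\<^sup>2)) has_integral sqrt (pi / c)) UNIV"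
proof -
  define \<sigma> where "\<sigma> = sqrt (1 / (2 * c))"
  have \<sigma>: "\<sigma> > 0" "\<sigma>\<^sup>2 = 1 / (2 * c)" using assms by (auto simp: \<sigma>_def)
  have eq: "normal_density 0 \<sigma> x = exp (- c * x\<^sup>2) / sqrt (pi / c)" for x
    unfolding normal_density_def \<sigma>(2) using assms by (simp add: field_simps)
  have "(normal_density 0 \<sigma> has_integral integral\<^sup>L lborel (normal_density 0 \<sigma>)) UNIV"
    using integrable_normal_density[OF \<sigma>(1)] by (rule has_integral_integral_lborel)
  hence "(normal_density 0 \<sigma> has_integral 1) UNIV"
    using \<sigma>(1) by simp
  hence "((\<lambda>x. exp (- c * x\<^sup>2) / sqrt (pi / c)) has_integral 1) UNIV"
    by (simp only: eq[abs_def])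
  from has_integral_mult_left[OF this, of "sqrt (pi / c)"]
  show ?thesis using assms by simp
qed

definition ker :: "real \<Rightarrow> real \<Rightarrow> complex" where
  "ker X u = exp (- of_real (X * u\<^sup>2) / (1 + \<i> * of_real u))"

lemma one_plus_i_nz: "1 + \<i> * of_real u \<noteq> 0"
  by (simp add: complex_eq_iff)

lemma continuous_on_ker [continuous_intros]: "continuous_on S (ker X)"
  unfolding ker_def by (intro continuous_intros) (use one_plus_i_nz in auto)

text \<open>The damping is quadratic in u and the phase only cubic: at the Gaussian scale u ~
  X^(-1/2) the phase is O(X^(-1/2)), and its square is O(1 / X).\<close>

lemma ker_polar:
  "ker X u = of_real (exp (- (X * u\<^sup>2 / (1 + u\<^sup>2)))) * cis (X * u^3 / (1 + u\<^sup>2))"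
proof -
  have p: "1 + u\<^sup>2 > 0" by (intro add_pos_nonneg) auto
  have "- of_real (X * u\<^sup>2) / (1 + \<i> * of_real u) = Complex (- (X * u\<^sup>2 / (1 + u\<^sup>2))) (X * u^3 / (1 + u\<^sup>2))"
    using p by (simp add: complex_eq_iff Re_divide Im_divide power2_eq_square power3_eq_cube)
  thus ?thesis unfolding ker_def by (simp add: exp_eq_polar)
qed

lemma norm_ker: "norm (ker X u) = exp (- (X * u\<^sup>2 / (1 + u\<^sup>2)))"
  unfolding ker_polar by (simp add: norm_mult)

text \<open>With v = X u^2, polynomial factors are paid for by half of the exponent, since exp (v/4)
  \<ge> (1 + v/12)^3; the constant is 1728 = 12^3.\<close>

lemma cubic_exp_bound:
  fixes v :: real
  assumes "v \<ge> 0"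
  shows "(1 + v + v\<^sup>2 + v^3) * exp (- v / 2) \<le> 1728 * exp (- v / 4)"
proof -
  have "(1 + v / 12) ^ 3 \<le> exp (v / 12) ^ 3"
    using assms by (intro power_mono) auto
  also have "exp (v / 12) ^ 3 = exp (v / 4)" by (simp flip: exp_of_nat_mult)
  finally have "1728 * (1 + v / 12) ^ 3 \<le> 1728 * exp (v / 4)" by simp
  moreover have "1 + v + v\<^sup>2 + v^3 \<le> 1728 * (1 + v / 12) ^ 3"
  proof -
    have "1728 * (1 + v / 12) ^ 3 = 1728 + 432 * v + 36 * v\<^sup>2 + v^3"
      by (simp add: power3_eq_cube power2_eq_square field_simps)
    thus ?thesis using assms zero_le_power2[of v] by linarith
  qed
  ultimately have "(1 + v + v\<^sup>2 + v^3) * exp (- v / 2) \<le> 1728 * exp (v / 4) * exp (- v / 2)"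
    by (intro mult_right_mono) auto
  also have "\<dots> = 1728 * exp (- v / 4)" by (simp flip: exp_add)
  finally show ?thesis .
qed

text \<open>For \<bar>u\<bar> \<le> 1 the damping P lies between v/2 and v, and v - P = P u^2 \<le>
  v^2 / X.\<close>

lemma damping_bounds:
  fixes X u :: real
  assumes X: "X > 0" and u: "\<bar>u\<bar> \<le> 1"
  defines "v \<equiv> X * u\<^sup>2" and "P \<equiv> X * u\<^sup>2 / (1 + u\<^sup>2)"
  shows "exp (- P) \<le> exp (- v / 2)" "\<bar>exp (- P) - exp (- v)\<bar> \<le> v\<^sup>2 / X * exp (- v / 2)"
proof -
  have u2: "u\<^sup>2 \<le> 1" "0 \<le> u\<^sup>2" using u by (auto simp: abs_square_le_1)
  have w: "1 + u\<^sup>2 > 0" "1 \<le> 1 + u\<^sup>2" using zero_le_power2[of u] by linarith+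
  have v: "v \<ge> 0" using X by (simp add: v_def)
  have P: "P = v / (1 + u\<^sup>2)" by (simp add: P_def v_def)
  have "v / 2 \<le> P" unfolding P using divide_left_mono[of "1 + u\<^sup>2" 2 v] u2 v w by simp
  thus 1: "exp (- P) \<le> exp (- v / 2)" by simp
  have Pv: "P \<le> v" unfolding P using divide_left_mono[OF w(2) v] w by simp
  have "1 + u\<^sup>2 \<noteq> 0" using w(1) by linarith
  hence "P * (1 + u\<^sup>2) = v" unfolding P by simp
  hence "v - P = P * u\<^sup>2" by (simp add: algebra_simps)
  also have "\<dots> \<le> v * u\<^sup>2" using Pv by (intro mult_right_mono) auto
  also have "v * u\<^sup>2 = v\<^sup>2 / X" using X by (simp add: v_def power2_eq_square)
  finally have vP: "v - P \<le> v\<^sup>2 / X" .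
  have "1 - exp (- (v - P)) \<le> v - P" using exp_ge_add_one_self[of "-(v - P)"] by linarith
  hence "(1 - exp (- (v - P))) * exp (- P) \<le> v\<^sup>2 / X * exp (- v / 2)"
    using 1 vP Pv X by (intro mult_mono) auto
  moreover have "(1 - exp (- (v - P))) * exp (- P) = exp (- P) - exp (- v)"
    by (simp add: left_diff_distrib flip: exp_add)
  ultimately show "\<bar>exp (- P) - exp (- v)\<bar> \<le> v\<^sup>2 / X * exp (- v / 2)" using Pv by simp
qed

text \<open>The Gaussian keeps the coefficient 1 and only the O(1 / X) correction goes into the
  wider one. This keeps the leading constant in \<open>upper_bound\<close> sharp enough for range
  (ii).\<close>

lemma abs_ker_pointwise:
  fixes X u :: real
  assumes X: "X > 0" and u: "\<bar>u\<bar> \<le> 1"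
  shows "norm (ker X u) \<le> exp (- X * u\<^sup>2) + 1728 / X * exp (- (X / 4) * u\<^sup>2)"
proof -
  define v where "v = X * u\<^sup>2"
  have v: "v \<ge> 0" using X by (simp add: v_def)
  have "norm (ker X u) - exp (- v) \<le> v\<^sup>2 / X * exp (- v / 2)"
    using damping_bounds(2)[OF X u] unfolding norm_ker v_def by linarith
  also have "v\<^sup>2 / X * exp (- v / 2) \<le> 1 / X * ((1 + v + v\<^sup>2 + v^3) * exp (- v / 2))"
    using X v by (simp add: divide_simps)
  also have "\<dots> \<le> 1 / X * (1728 * exp (- v / 4))"
    using X by (intro mult_left_mono cubic_exp_bound v) auto
  finally show ?thesis by (simp add: v_def)
qed

text \<open>In terms of v = X u^2 all errors are polynomials in v of degree at most 3, multiplied by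
  1 / X or by \<delta>, so that \<open>cubic_exp_bound\<close> absorbs them. The parameter \<delta>
  admits perturbations that do not vanish at u = 0.\<close>

lemma saddle_pointwise:
  fixes X \<delta> a K u :: real and w :: complex
  assumes X: "X > 0" and \<delta>: "0 \<le> \<delta>" and u: "\<bar>u\<bar> \<le> 1" and K: "K \<ge> 0"
    and w1: "\<bar>Re w - a\<bar> \<le> K * (u\<^sup>2 + \<delta>)" and w2: "\<bar>Im w\<bar> \<le> K * (\<bar>u\<bar> + \<delta>)"
  shows "\<bar>Re (w * ker X u) - a * exp (- X * u\<^sup>2)\<bar> \<le> 1728 * (\<bar>a\<bar> + K) * (1 / X + \<delta>) * exp (- (X / 4) * u\<^sup>2)"
proof -
  define v P \<phi> where "v = X * u\<^sup>2" and "P = X * u\<^sup>2 / (1 + u\<^sup>2)" and "\<phi> = X * u^3 / (1 + u\<^sup>2)"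
  define e where "e = exp (- v / 2)"
  have e: "e > 0" by (simp add: e_def)
  have v: "v \<ge> 0" using X by (simp add: v_def)
  have u2: "u\<^sup>2 \<le> 1" "0 \<le> u\<^sup>2" using u by (auto simp: abs_square_le_1)
  have D: "exp (- P) \<le> e" "\<bar>exp (- P) - exp (- v)\<bar> \<le> v\<^sup>2 / X * e"
    using damping_bounds[OF X u] by (auto simp: e_def v_def P_def)
  have uv: "u\<^sup>2 = v / X" using X by (simp add: v_def)
  have \<phi>: "\<bar>\<phi>\<bar> \<le> X * \<bar>u\<bar>^3"
  proof -
    have "\<bar>\<phi>\<bar> = X * \<bar>u\<bar>^3 / (1 + u\<^sup>2)" using X by (simp add: \<phi>_def abs_mult power_abs)
    also have "\<dots> \<le> X * \<bar>u\<bar>^3 / 1"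
      using X zero_le_power2[of u] by (intro divide_left_mono mult_pos_pos) (linarith | simp)+
    finally show ?thesis by simp
  qed
  have \<phi>2: "\<phi>\<^sup>2 \<le> v^3 / X"
  proof -
    have "\<phi>\<^sup>2 \<le> (X * \<bar>u\<bar>^3)\<^sup>2" using power_mono[OF \<phi>, of 2] by simp
    also have "\<dots> = X\<^sup>2 * (u\<^sup>2)^3"
      by (simp add: power_mult_distrib flip: power_mult power_abs)
    also have "\<dots> = v^3 / X" using X unfolding uv by (simp add: power2_eq_square power3_eq_cube)
    finally show ?thesis .
  qed
  have c1: "1 - cos \<phi> \<le> v^3 / X"
  proof -
    have "1 - cos \<phi> = 2 * (sin (\<phi>/2))\<^sup>2" using cos_double_sin[of "\<phi>/2"] by simp
    also have "(sin (\<phi>/2))\<^sup>2 \<le> (\<phi>/2)\<^sup>2"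
      using abs_sin_le_one abs_sin_x_le_abs_x[of "\<phi>/2"] by (metis abs_le_square_iff)
    also have "2 * (\<phi>/2)\<^sup>2 \<le> \<phi>\<^sup>2" by (simp add: power2_eq_square)
    finally show ?thesis using \<phi>2 by simp
  qed
  \<comment> \<open>A first order imaginary part times the cubic phase is X u^4 = v^2 / X, which is
    of the same order as the other errors.\<close>
  have c2: "\<bar>Im w\<bar> * \<bar>sin \<phi>\<bar> \<le> K * (v\<^sup>2 / X + \<delta> * v)"
  proof -
    have "\<bar>Im w\<bar> * \<bar>sin \<phi>\<bar> \<le> (K * (\<bar>u\<bar> + \<delta>)) * (X * \<bar>u\<bar>^3)"
      using abs_sin_x_le_abs_x[of \<phi>] \<phi> w2 K \<delta> by (intro mult_mono) auto
    also have "\<dots> = K * (X * (u\<^sup>2)\<^sup>2 + \<delta> * (X * u\<^sup>2) * \<bar>u\<bar>)"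
      by (simp add: algebra_simps power2_eq_square power3_eq_cube abs_mult_self_eq)
    also have "\<dots> \<le> K * (X * (u\<^sup>2)\<^sup>2 + \<delta> * (X * u\<^sup>2) * 1)"
      using K \<delta> X u by (intro mult_left_mono add_left_mono) auto
    also have "X * (u\<^sup>2)\<^sup>2 = v\<^sup>2 / X" using X unfolding uv by (simp add: power2_eq_square)
    finally show ?thesis by (simp add: v_def)
  qed
  have "Re (w * ker X u) - a * exp (- v) =
      exp (- P) * ((Re w - a) * cos \<phi> - a * (1 - cos \<phi>) - Im w * sin \<phi>) + a * (exp (- P) - exp (- v))"
    unfolding ker_polar P_def \<phi>_def by (simp add: algebra_simps)
  also have "\<bar>\<dots>\<bar> \<le> exp (- P) * (\<bar>Re w - a\<bar> + \<bar>a\<bar> * (1 - cos \<phi>) + \<bar>Im w\<bar> * \<bar>sin \<phi>\<bar>) + \<bar>a\<bar> * \<bar>exp (- P) - exp (- v)\<bar>"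
  proof -
    have "\<bar>(Re w - a) * cos \<phi> - a * (1 - cos \<phi>) - Im w * sin \<phi>\<bar> \<le>
       \<bar>Re w - a\<bar> * \<bar>cos \<phi>\<bar> + \<bar>a\<bar> * \<bar>1 - cos \<phi>\<bar> + \<bar>Im w\<bar> * \<bar>sin \<phi>\<bar>"
      unfolding abs_mult [symmetric] by linarith
    also have "\<dots> \<le> \<bar>Re w - a\<bar> * 1 + \<bar>a\<bar> * (1 - cos \<phi>) + \<bar>Im w\<bar> * \<bar>sin \<phi>\<bar>"
      by (intro add_mono mult_left_mono) auto
    finally have "exp (- P) * \<bar>(Re w - a) * cos \<phi> - a * (1 - cos \<phi>) - Im w * sin \<phi>\<bar> \<le>
       exp (- P) * (\<bar>Re w - a\<bar> + \<bar>a\<bar> * (1 - cos \<phi>) + \<bar>Im w\<bar> * \<bar>sin \<phi>\<bar>)"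
      by (intro mult_left_mono) auto
    thus ?thesis
      by (intro order.trans[OF abs_triangle_ineq] add_mono) (auto simp: abs_mult)
  qed
  also have "\<dots> \<le> e * (K * (v / X + \<delta>) + \<bar>a\<bar> * (v^3 / X) + K * (v\<^sup>2 / X + \<delta> * v)) + \<bar>a\<bar> * (v\<^sup>2 / X * e)"
  proof (rule add_mono)
    have "\<bar>Re w - a\<bar> \<le> K * (v / X + \<delta>)" using w1 by (simp add: uv)
    moreover have "\<bar>a\<bar> * (1 - cos \<phi>) \<le> \<bar>a\<bar> * (v^3 / X)" using c1 by (rule mult_left_mono) simp
    ultimately show "exp (- P) * (\<bar>Re w - a\<bar> + \<bar>a\<bar> * (1 - cos \<phi>) + \<bar>Im w\<bar> * \<bar>sin \<phi>\<bar>)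
        \<le> e * (K * (v / X + \<delta>) + \<bar>a\<bar> * (v^3 / X) + K * (v\<^sup>2 / X + \<delta> * v))"
      using D(1) e c2 by (intro mult_mono) auto
    show "\<bar>a\<bar> * \<bar>exp (- P) - exp (- v)\<bar> \<le> \<bar>a\<bar> * (v\<^sup>2 / X * e)"
      using D(2) by (rule mult_left_mono) simp
  qed
  also have "\<dots> \<le> (\<bar>a\<bar> + K) * (1 / X + \<delta>) * ((1 + v + v\<^sup>2 + v^3) * e)"
  proof -
    have "(\<bar>a\<bar> + K) * (1 / X + \<delta>) * ((1 + v + v\<^sup>2 + v^3) * e) -
       (e * (K * (v / X + \<delta>) + \<bar>a\<bar> * (v^3 / X) + K * (v\<^sup>2 / X + \<delta> * v)) + \<bar>a\<bar> * (v\<^sup>2 / X * e)) =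
       e * (K * ((1 + v^3) * (1 / X) + \<delta> * (v\<^sup>2 + v^3)) + \<bar>a\<bar> * ((1 + v) * (1 / X) + \<delta> * (1 + v + v\<^sup>2 + v^3)))"
      by (simp add: algebra_simps add_divide_distrib)
    also have "\<dots> \<ge> 0" using e K X \<delta> v by (intro mult_nonneg_nonneg add_nonneg_nonneg) auto
    finally show ?thesis by simp
  qed
  also have "\<dots> \<le> (\<bar>a\<bar> + K) * (1 / X + \<delta>) * (1728 * exp (- v / 4))"
    unfolding e_def using K X \<delta> by (intro mult_left_mono cubic_exp_bound v) auto
  finally have F: "\<bar>Re (w * ker X u) - a * exp (- v)\<bar> \<le> (\<bar>a\<bar> + K) * (1 / X + \<delta>) * (1728 * exp (- v / 4))" .
  have e: "- X * u\<^sup>2 = - v" "-(X / 4) * u\<^sup>2 = - v / 4" by (simp_all add: v_def)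
  show ?thesis unfolding e using F by (simp only: mult_ac)
qed

lemma sqrt_quarter: "X > 0 \<Longrightarrow> sqrt (pi / (X / 4)) = 2 * sqrt (pi / X)"
proof -
  assume "X > 0"
  have "pi / (X / 4) = 4 * (pi / X)" by simp
  thus ?thesis by (simp only: real_sqrt_mult real_sqrt_four)
qed

abbreviation saddle_int :: "real \<Rightarrow> (real \<Rightarrow> complex) \<Rightarrow> complex" where
  "saddle_int X f \<equiv> integral {-1..1} (\<lambda>u. f u * ker X u)"

text \<open>
  The imaginary part of \<open>f\<close> may be of first order in \<open>u\<close>: in the real part of the product it meets
  only the sine of the phase of the kernel, which is \<open>O(X u\<^sup>3)\<close>.
\<close>

theorem saddle_integral:
  fixes X \<delta> a K :: real and f :: "real \<Rightarrow> complex"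
  assumes X: "X > 0" and \<delta>: "0 \<le> \<delta>" and K: "K \<ge> 0"
    and cont: "continuous_on {-1..1} f"
    and f1: "\<And>u. \<bar>u\<bar> \<le> 1 \<Longrightarrow> \<bar>Re (f u) - a\<bar> \<le> K * (u\<^sup>2 + \<delta>)"
    and f2: "\<And>u. \<bar>u\<bar> \<le> 1 \<Longrightarrow> \<bar>Im (f u)\<bar> \<le> K * (\<bar>u\<bar> + \<delta>)"
  shows "\<bar>Re (saddle_int X f) - a * sqrt (pi / X)\<bar>
           \<le> 3456 * (\<bar>a\<bar> + K) * (1 / X + \<delta>) * sqrt (pi / X)"
proof -
  define B where "B = 1728 * (\<bar>a\<bar> + K) * (1 / X + \<delta>)"
  have B: "B \<ge> 1728 * \<bar>a\<bar> / X" "B \<ge> 0"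
  proof -
    have "1728 * (\<bar>a\<bar> * (1 / X)) \<le> 1728 * ((\<bar>a\<bar> + K) * (1 / X + \<delta>))" using K X \<delta> by (intro mult_left_mono mult_mono) auto
    moreover have "1728 * \<bar>a\<bar> / X = 1728 * (\<bar>a\<bar> * (1 / X))" by simp
    ultimately show "B \<ge> 1728 * \<bar>a\<bar> / X" by (simp only: B_def mult.assoc)
    show "B \<ge> 0" using K X \<delta> by (simp add: B_def)
  qed
  define h where "h = (\<lambda>u. if u \<in> {-1..1} then Re (f u * ker X u) else 0)"
  have int: "(\<lambda>u. f u * ker X u) integrable_on {-1..1}"
    by (intro integrable_continuous_real continuous_intros cont)
  have "((\<lambda>u. Re (f u * ker X u)) has_integral Re (saddle_int X f)) {-1..1}"
    using int by (intro has_integral_Re integrable_integral)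
  hence h: "(h has_integral Re (saddle_int X f)) UNIV"
    unfolding h_def by (subst has_integral_restrict_UNIV)
  have g1: "((\<lambda>u. a * exp (- X * u\<^sup>2)) has_integral (a * sqrt (pi / X))) UNIV"
    by (intro has_integral_mult_right gaussian_has_integral X)
  \<comment> \<open>Widening the Gaussian by X / 4 doubles its integral, hence 3456 = 2 *
    1728.\<close>
  have g2: "((\<lambda>u. B * exp (- (X / 4) * u\<^sup>2)) has_integral (B * (2 * sqrt (pi / X)))) UNIV"
    using gaussian_has_integral[of "X / 4"] X sqrt_quarter[OF X] by (intro has_integral_mult_right) auto
  have "norm (Re (saddle_int X f) - a * sqrt (pi / X)) \<le> B * (2 * sqrt (pi / X))"
    unfolding integral_unique[OF has_integral_diff[OF h g1], symmetric] integral_unique[OF g2, symmetric]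
  proof (rule integral_norm_bound_integral)
    show "(\<lambda>u. h u - a * exp (- X * u\<^sup>2)) integrable_on UNIV"
      using has_integral_diff[OF h g1] by (rule has_integral_integrable)
    show "(\<lambda>u. B * exp (- (X / 4) * u\<^sup>2)) integrable_on UNIV" using g2 by (rule has_integral_integrable)
    fix u :: real
    show "norm (h u - a * exp (- X * u\<^sup>2)) \<le> B * exp (- (X / 4) * u\<^sup>2)"
    proof (cases "\<bar>u\<bar> \<le> 1")
      case True
      thus ?thesis using saddle_pointwise[OF X \<delta> True K f1[OF True] f2[OF True]]
        by (auto simp: h_def B_def)
    next
      case False
      \<comment> \<open>Outside [-1, 1] the integrand \<open>h\<close> is 0 and only the Gaussian
        tail is left. There v \<ge> X, and three quarters of the exponent yield the factor 1 /
        X.\<close>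
      define v where "v = X * u\<^sup>2"
      have "1 \<le> \<bar>u\<bar>\<^sup>2" using False by (intro one_le_power) auto
      hence v: "v \<ge> X" using X by (simp add: v_def mult_le_cancel_left1)
      have "exp (- v) = exp (- v / 4) * exp (- (3 * v / 4))" by (simp flip: exp_add)
      also have "exp (- (3 * v / 4)) \<le> 1728 / X"
      proof -
        have "X / 1728 \<le> 1 + 3 * v / 4" using v X by simp
        also have "\<dots> \<le> exp (3 * v / 4)" by simp
        finally show ?thesis using X by (simp add: exp_minus field_simps)
      qed
      finally have "exp (- v) \<le> exp (- v / 4) * (1728 / X)" by simp
      hence "\<bar>a\<bar> * exp (- v) \<le> \<bar>a\<bar> * (exp (- v / 4) * (1728 / X))" by (rule mult_left_mono) simp
      also have "\<dots> = (1728 * \<bar>a\<bar> / X) * exp (- v / 4)" by simp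
      also have "\<dots> \<le> B * exp (- v / 4)" using B by (intro mult_right_mono) auto
      finally show ?thesis using False by (auto simp: h_def v_def abs_mult)
    qed
  qed
  moreover have "B * (2 * sqrt (pi / X)) = 3456 * (\<bar>a\<bar> + K) * (1 / X + \<delta>) * sqrt (pi / X)"
    by (simp add: B_def)
  ultimately show ?thesis by (simp only: real_norm_def)
qed

theorem saddle_integral_bound:
  fixes X B :: real and g :: "real \<Rightarrow> complex"
  assumes X: "X > 0" and cont: "continuous_on {-1..1} g"
    and g: "\<And>u. \<bar>u\<bar> \<le> 1 \<Longrightarrow> norm (g u * ker X u) \<le> b * exp (- X * u\<^sup>2) + B * exp (- (X / 4) * u\<^sup>2)"
    and B: "B \<ge> 0" "b \<ge> 0"
  shows "norm (saddle_int X g) \<le> (b + 2 * B) * sqrt (pi / X)"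
proof -
  have i1: "((\<lambda>u. b * exp (- X * u\<^sup>2) + B * exp (- (X / 4) * u\<^sup>2)) has_integral (b * sqrt (pi / X) + B * (2 * sqrt (pi / X)))) UNIV"
    using gaussian_has_integral[of "X / 4"] gaussian_has_integral[of X] X sqrt_quarter[OF X]
    by (intro has_integral_add has_integral_mult_right) auto
  have i2: "(\<lambda>u. b * exp (- X * u\<^sup>2) + B * exp (- (X / 4) * u\<^sup>2)) integrable_on {-1..1}"
    by (intro integrable_continuous_real continuous_intros)
  have "norm (saddle_int X g) \<le> integral {-1..1} (\<lambda>u. b * exp (- X * u\<^sup>2) + B * exp (- (X / 4) * u\<^sup>2))"
  proof (rule integral_norm_bound_integral[OF _ i2])
    show "(\<lambda>u. g u * ker X u) integrable_on {-1..1}"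
      by (intro integrable_continuous_real continuous_intros cont)
  qed (rule g, simp add: abs_le_iff)
  also have "\<dots> \<le> integral UNIV (\<lambda>u. b * exp (- X * u\<^sup>2) + B * exp (- (X / 4) * u\<^sup>2))"
    by (rule integral_subset_le[OF _ i2]) (use i1 B in \<open>auto simp: has_integral_integrable\<close>)
  also have "\<dots> = (b + 2 * B) * sqrt (pi / X)"
    using i1 by (simp add: integral_unique algebra_simps)
  finally show ?thesis .
qed

text \<open>The common frame for all ranges: the hypothesis splits the exponent on the central arc
  \<bar>\<theta>\<bar> \<le> s into a constant, the kernel and a remainder \<open>H\<close>. On the
  rest of the circle the integrand is at most its value at the saddle point times exp (- 1 / (68
  s)).\<close>

theorem saddle_part_count:
  fixes s X c0 :: real and H :: "real \<Rightarrow> complex"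
  assumes A: "A = UNIV \<or> (\<exists>q\<ge>2. A = {n. \<not> q dvd n})"
    and s: "0 < s" "s \<le> 1"
    and H: "\<And>u. \<bar>u\<bar> \<le> 1 \<Longrightarrow> lnG A (Complex s (s * u)) + of_nat N * Complex s (s * u) =
              of_real (c0 + 2 * X) - of_real (X * u\<^sup>2) / (1 + \<i> * of_real u) + H u"
  shows "\<bar>real (part_count A N) - exp (c0 + 2 * X) * s / (2 * pi) * Re (saddle_int X (\<lambda>u. exp (H u)))\<bar>
           \<le> exp (c0 + 2 * X + Re (H 0) - 1 / (68 * s))"
proof -
  define E where "E = (\<lambda>\<theta>. exp (lnG A (Complex s \<theta>) + of_nat N * Complex s \<theta>))"
  define b where "b = exp (c0 + 2 * X + Re (H 0) - 1 / (68 * s))"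
  have s_pi: "s \<le> pi" using s pi_gt3 by linarith
  have J: "(E has_integral of_real (2 * pi * real (part_count A N))) {-pi..pi}"
    unfolding E_def by (rule part_count_integral[OF s(1)])
  hence int: "E integrable_on {-pi..pi}" by (rule has_integral_integrable)
  have int': "E integrable_on {l..r}" if "-pi \<le> l" "r \<le> pi" for l r
    using integrable_subinterval_real[OF int] that by auto
  have split: "of_real (2 * pi * real (part_count A N)) = integral {-pi..-s} E + integral {-s..s} E + integral {s..pi} E"
  proof -
    have "integral {-pi..-s} E + integral {-s..pi} E = integral {-pi..pi} E"
      using s s_pi int by (intro Henstock_Kurzweil_Integration.integral_combine) auto
    moreover have "integral {-s..s} E + integral {s..pi} E = integral {-s..pi} E"
      using s s_pi int' by (intro Henstock_Kurzweil_Integration.integral_combine) auto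
    ultimately show ?thesis using J by (simp add: integral_unique add.assoc)
  qed
  \<comment> \<open>The hypothesis at u = 0 expresses the value at the saddle point, against which
    the remaining arcs are measured.\<close>
  have Re0: "Re (lnG A (of_real s)) + N * s = c0 + 2 * X + Re (H 0)"
  proof -
    have "Re (lnG A (Complex s (s * 0)) + of_nat N * Complex s (s * 0)) = c0 + 2 * X + Re (H 0)"
      by (subst H) auto
    thus ?thesis by (simp add: complex_of_real_def)
  qed
  have E_bound: "norm (E \<theta>) \<le> b" if "s \<le> \<bar>\<theta>\<bar>" "\<bar>\<theta>\<bar> \<le> pi" for \<theta>
  proof -
    have "Re (lnG A (Complex s \<theta>)) \<le> Re (lnG A (of_real s)) - kernel_quot s \<theta> / (2 * sinh s)"
      using A Re_lnG_UNIV_le[OF s(1)] Re_lnG_regular_le[OF s(1)] by auto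
    also have "\<dots> \<le> Re (lnG A (of_real s)) - 1 / (68 * s)"
      using kernel_bound[OF s that] by simp
    finally show ?thesis unfolding E_def b_def norm_exp_eq_Re using Re0 by simp
  qed
  have tail: "\<bar>Re (integral {l..r} E)\<bar> \<le> pi * b" if "-pi \<le> l" "l \<le> r" "r \<le> pi" "r - l \<le> pi"
    "\<And>\<theta>. \<theta> \<in> {l..r} \<Longrightarrow> s \<le> \<bar>\<theta>\<bar> \<and> \<bar>\<theta>\<bar> \<le> pi" for l r
  proof -
    have "\<bar>Re (integral {l..r} E)\<bar> \<le> norm (integral {l..r} E)" by (rule abs_Re_le_cmod)
    also have "\<dots> \<le> integral {l..r} (\<lambda>_. b)"
      by (rule integral_norm_bound_integral) (use int'[of l r] that E_bound in auto)
    also have "\<dots> = b * (r - l)" using that by simp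
    also have "\<dots> \<le> b * pi" using that by (intro mult_left_mono) (auto simp: b_def)
    finally show ?thesis by (simp add: mult.commute)
  qed
  have central: "integral {-s..s} E = of_real (exp (c0 + 2 * X) * s) * saddle_int X (\<lambda>u. exp (H u))"
  proof -
    have img: "(\<lambda>x. x / s) ` {-s..s} = {-1..1}"
      using s by (auto simp: image_iff field_simps intro!: bexI[of _ "s * _"])
    have "((\<lambda>u. E (s * u)) has_integral (1 / \<bar>s\<bar>) *\<^sub>R integral {-s..s} E) ((\<lambda>x. x / s) ` {-s..s})"
      using s s_pi int'[of "-s" s] by (intro has_integral_stretch_real integrable_integral) auto
    hence "((\<lambda>u. E (s * u)) has_integral (1 / s) *\<^sub>R integral {-s..s} E) {-1..1}"
      unfolding img using s by simp
    moreover have "E (s * u) = of_real (exp (c0 + 2 * X)) * (exp (H u) * ker X u)" if "u \<in> {-1..1}" for u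
    proof -
      define r where "r = c0 + 2 * X"
      have "E (s * u) = exp (of_real r + (- of_real (X * u\<^sup>2) / (1 + \<i> * of_real u)) + H u)"
        unfolding E_def r_def using that by (subst H) (auto simp: abs_le_iff)
      also have "\<dots> = of_real (exp r) * (exp (H u) * ker X u)"
        unfolding ker_def exp_add exp_of_real by (simp only: mult_ac)
      finally show ?thesis by (simp only: r_def)
    qed
    ultimately have "((\<lambda>u. of_real (exp (c0 + 2 * X)) * (exp (H u) * ker X u)) has_integral (1 / s) *\<^sub>R integral {-s..s} E) {-1..1}"
      by (rule has_integral_eq[rotated])
    hence "integral {-1..1} (\<lambda>u. of_real (exp (c0 + 2 * X)) * (exp (H u) * ker X u)) = (1 / s) *\<^sub>R integral {-s..s} E"
      by (rule integral_unique)
    hence "of_real (exp (c0 + 2 * X)) * saddle_int X (\<lambda>u. exp (H u)) = (1 / s) *\<^sub>R integral {-s..s} E"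
      by simp
    thus ?thesis using s by (simp add: scaleR_conv_of_real field_simps)
  qed
  have "2 * pi * real (part_count A N) = Re (of_real (2 * pi * real (part_count A N)))" by simp
  also have "\<dots> = Re (integral {-pi..-s} E) + Re (integral {-s..s} E) + Re (integral {s..pi} E)"
    unfolding split by simp
  also have "Re (integral {-s..s} E) = exp (c0 + 2 * X) * s * Re (saddle_int X (\<lambda>u. exp (H u)))"
  proof -
    have "Re (of_real r * w) = r * Re w" for r w by simp
    thus ?thesis unfolding central by (simp only:)
  qed
  finally have eq: "2 * pi * real (part_count A N) - exp (c0 + 2 * X) * s * Re (saddle_int X (\<lambda>u. exp (H u)))
      = Re (integral {-pi..-s} E) + Re (integral {s..pi} E)" by linarith
  have "\<bar>Re (integral {-pi..-s} E)\<bar> \<le> pi * b" "\<bar>Re (integral {s..pi} E)\<bar> \<le> pi * b"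
    using s s_pi by (intro tail; auto)+
  hence "\<bar>2 * pi * real (part_count A N) - exp (c0 + 2 * X) * s * Re (saddle_int X (\<lambda>u. exp (H u)))\<bar> \<le> 2 * pi * b"
    unfolding eq by linarith
  hence "\<bar>2 * pi * real (part_count A N) - exp (c0 + 2 * X) * s * Re (saddle_int X (\<lambda>u. exp (H u)))\<bar> / (2 * pi) \<le> b"
    by (simp add: field_simps)
  also have "\<bar>2 * pi * real (part_count A N) - exp (c0 + 2 * X) * s * Re (saddle_int X (\<lambda>u. exp (H u)))\<bar> / (2 * pi) =
    \<bar>(2 * pi * real (part_count A N) - exp (c0 + 2 * X) * s * Re (saddle_int X (\<lambda>u. exp (H u)))) / (2 * pi)\<bar>"
    by simp
  also have "(2 * pi * real (part_count A N) - exp (c0 + 2 * X) * s * Re (saddle_int X (\<lambda>u. exp (H u)))) / (2 * pi) =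
    real (part_count A N) - exp (c0 + 2 * X) * s / (2 * pi) * Re (saddle_int X (\<lambda>u. exp (H u)))"
    by (simp add: diff_divide_distrib)
  finally show ?thesis unfolding b_def .
qed

text \<open>Makes the arc error O(s) relative to the Gaussian main term: exp (- y) \<le> 27 / y^3
  supplies s^3, and s \<le> sqrt (pi / X) trades one factor s for the Gaussian integral. The
  constant covers 2 pi * 27 * 68^3.\<close>

lemma tail_relative:
  fixes s X :: real
  assumes s: "0 < s" "s \<le> 1" and X: "0 < X" "X \<le> 2 / s"
  shows "exp (- (1 / (68 * s))) \<le> 10^8 * s * (s * sqrt (pi / X) / (2 * pi))"
proof -
  define y where "y = 1 / (68 * s)"
  have y: "y > 0" using s by (simp add: y_def)
  have "(y / 3) ^ 3 \<le> exp (y / 3) ^ 3" using y exp_ge_add_one_self[of "y/3"] by (intro power_mono) linarith+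
  also have "exp (y / 3) ^ 3 = exp y" by (simp flip: exp_of_nat_mult)
  finally have "exp (- y) \<le> 27 / y ^ 3" using y by (simp add: power_divide exp_minus field_simps)
  also have "\<dots> = 27 * 68 ^ 3 * s ^ 3" by (simp add: y_def power_divide power_mult_distrib)
  also have "\<dots> \<le> 10^8 / (2 * pi) * s ^ 3"
    using pi_less_4 s by (intro mult_right_mono) (auto simp: field_simps)
  also have "s ^ 3 \<le> s * s * sqrt (pi / X)"
  proof -
    have "s\<^sup>2 \<le> s" using s by (simp add: power2_eq_square mult_left_le)
    also have "s \<le> 2 / X" using s X by (simp add: field_simps)
    also have "\<dots> \<le> pi / X" using X pi_ge_two by (intro divide_right_mono) auto
    finally have "s \<le> sqrt (pi / X)" by (rule real_le_rsqrt)
    thus ?thesis using s by (simp add: power3_eq_cube mult_left_mono)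
  qed
  finally show ?thesis by (simp add: y_def mult_left_mono mult_ac divide_right_mono)
qed

section \<open>Regular partitions with small modulus\<close>

lemma exp_3_ge: "exp 3 \<ge> (39 / 2 :: real)"
proof -
  have "(41 / 32 :: real) ^ 12 \<le> exp (1 / 4) ^ 12"
    using exp_lower_Taylor_quadratic[of "1/4 :: real"] by (intro power_mono) (auto simp: power2_eq_square)
  also have "exp (1 / 4 :: real) ^ 12 = exp 3" by (simp flip: exp_of_nat_mult)
  finally show ?thesis by (simp add: power_divide)
qed

lemma exp_minus_le_of_ge_3: "x \<ge> 3 \<Longrightarrow> exp (- x) \<le> (2 / 39 :: real)"
proof -
  assume "x \<ge> 3"
  hence "exp (- x) \<le> exp (- 3)" by simp
  also have "\<dots> \<le> 2 / 39" using exp_3_ge by (simp add: exp_minus field_simps)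
  finally show ?thesis .
qed

text \<open>Here exp (- Re z) \<le> 2/39, and 28/25 exceeds (39/37)^2.\<close>

lemma norm_lnF_small:
  assumes "Re z \<ge> 3"
  shows "norm (lnF z) \<le> (28/25) * exp (- Re z)"
proof -
  define x where "x = exp (- Re z)"
  have x: "0 < x" "x \<le> 2 / 39" using exp_minus_le_of_ge_3[OF assms] by (auto simp: x_def)
  have "norm (lnF z) \<le> x / (1 - x)\<^sup>2" using norm_lnF_le[of z] assms by (simp add: x_def)
  also have "(37 / 39)\<^sup>2 \<le> (1 - x)\<^sup>2" using x by (intro power_mono) auto
  hence "x / (1 - x)\<^sup>2 \<le> x / (37 / 39)\<^sup>2" using x by (intro divide_left_mono mult_pos_pos) auto
  also have "\<dots> \<le> (28/25) * x" using x by (simp add: power2_eq_square field_simps)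
  finally show ?thesis by (simp add: x_def)
qed

lemma one_plus_iu_reciprocal:
  "1 / (1 + \<i> * of_real u) + (1 + \<i> * of_real u) = 2 - of_real (u\<^sup>2) / (1 + \<i> * of_real u)"
  using one_plus_i_nz[of u] by (simp add: field_simps power2_eq_square)

lemma Complex_scaled: "Complex s (s * u) = of_real s * (1 + \<i> * of_real u)"
  by (simp add: complex_eq_iff)

lemma Re_inverse_scaled: "Re (of_real c / Complex s (s * u)) = c / (s * (1 + u\<^sup>2))" if "s > 0"
proof -
  have "1 + u\<^sup>2 > 0" by (intro add_pos_nonneg) auto
  thus ?thesis using that by (simp add: Re_divide power_mult_distrib power2_eq_square divide_simps) (simp add: algebra_simps)
qed

lemma continuous_on_lnF_compose:
  assumes "continuous_on S f" "\<And>x. x \<in> S \<Longrightarrow> Re (f x) > 0"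
  shows "continuous_on S (\<lambda>x. lnF (f x))"
proof -
  have "continuous_on {z. Re z > 0} lnF"
    by (rule holomorphic_on_imp_continuous_on[OF holomorphic_lnF])
  from continuous_on_compose2[OF this assms(1)] assms(2) show ?thesis by auto
qed

lemma lnG_regular_transformation:
  assumes z: "Re z > 0" and q: "q > 0"
  shows "lnG {n. \<not> q dvd n} z = lnF (of_real (4 * pi\<^sup>2) / z) - lnF (of_real (4 * pi\<^sup>2 / q) / z)
     + of_real (pi\<^sup>2 / 6 * (1 - 1 / q)) / z + of_real ((real q - 1) / 24) * z - of_real (ln q / 2)"
proof -
  have z0: "z \<noteq> 0" using z by auto
  have qz: "Re (of_nat q * z) > 0" using z q by simp
  have L: "Ln (of_nat q * z / of_real (2 * pi)) = of_real (ln q) + Ln (z / of_real (2 * pi))"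
  proof -
    have "of_nat q * z / of_real (2 * pi) = of_real (real q) * (z / of_real (2 * pi))" by simp
    thus ?thesis using Ln_times_of_real[of "real q" "z / of_real (2 * pi)"] Ln_of_real[of "real q"] q z0
      by (simp del: of_real_of_nat_eq)
  qed
  have e: "of_real (4 * pi\<^sup>2) / (of_nat q * z) = of_real (4 * pi\<^sup>2 / q) / z" by simp
  have "lnG {n. \<not> q dvd n} z = lnF z - lnF (of_nat q * z)" by (rule lnG_regular[OF z q])
  also have "\<dots> = (lnF (of_real (4 * pi\<^sup>2) / z) + of_real (pi\<^sup>2) / (6 * z) - z / 24 + Ln (z / of_real (2 * pi)) / 2)
      - (lnF (of_real (4 * pi\<^sup>2) / (of_nat q * z)) + of_real (pi\<^sup>2) / (6 * (of_nat q * z)) - of_nat q * z / 24 + Ln (of_nat q * z / of_real (2 * pi)) / 2)"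
    using lnF_transformation[OF z] lnF_transformation[OF qz] by simp
  also have "\<dots> = lnF (of_real (4 * pi\<^sup>2) / z) - lnF (of_real (4 * pi\<^sup>2 / q) / z)
     + (of_real (pi\<^sup>2) / (6 * z) - of_real (pi\<^sup>2) / (6 * (of_nat q * z))) + (of_nat q * z / 24 - z / 24) - of_real (ln q / 2)"
    unfolding L e by (simp add: add_divide_distrib)
  also have "of_real (pi\<^sup>2) / (6 * z) - of_real (pi\<^sup>2) / (6 * (of_nat q * z)) = of_real (pi\<^sup>2 / 6 * (1 - 1 / q)) / z"
    using z0 q by (simp add: field_simps)
  also have "of_nat q * z / 24 - z / 24 = of_real ((real q - 1) / 24) * z"
    by (simp add: field_simps)
  finally show ?thesis .
qed

text \<open>The setting of ranges (i) and (ii). Of the two transformed arguments 4 pi^2 / z and 4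
  pi^2 / (q z), the second is the smaller one, and \<eta> is its value at the saddle point. The
  bound \<eta> \<ge> 2 pi is what both ranges provide.\<close>

locale regular_saddle =
  fixes N t :: nat and M q a s X \<eta> :: real
  assumes t: "t \<ge> 1" and N: "t + 1 \<le> N"
    and M_def: "M = real N + real t / 24"
    and q_def: "q = real t + 1"
    and a_def: "a = pi\<^sup>2 * real t / (6 * q)"
    and s_def: "s = sqrt (a / M)"
    and X_def: "X = s * M"
    and \<eta>_def: "\<eta> = 4 * pi\<^sup>2 / (q * s)"
    and \<eta>_ge: "\<eta> \<ge> 2 * pi"
begin

lemma \<eta>_pos: "\<eta> > 0" using \<eta>_ge pi_gt_zero by linarith

lemma M_pos: "M \<ge> N" "M > 0" using N by (auto simp: M_def)

lemma q_ge: "q \<ge> 2" using t by (simp add: q_def)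

lemma a_bounds: "1 / 2 \<le> a" "a \<le> pi\<^sup>2 / 6" "a \<le> 2"
proof -
  have tq: "1 / 2 \<le> real t / q" "real t / q \<le> 1" using t by (auto simp: q_def field_simps)
  have a: "a = pi\<^sup>2 / 6 * (real t / q)" by (simp add: a_def)
  have p9: "9 \<le> pi\<^sup>2" using power_mono[of 3 pi 2] pi_gt3 by simp
  have p12: "pi\<^sup>2 \<le> 12" using power_mono[of pi "16/5" 2] pi_approx(2) by (simp add: power2_eq_square)
  have "9 / 6 * (1 / 2) \<le> pi\<^sup>2 / 6 * (real t / q)" using tq p9 by (intro mult_mono) auto
  thus "1 / 2 \<le> a" by (simp add: a)
  have "pi\<^sup>2 / 6 * (real t / q) \<le> pi\<^sup>2 / 6 * 1" using tq by (intro mult_left_mono) auto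
  thus "a \<le> pi\<^sup>2 / 6" by (simp add: a)
  thus "a \<le> 2" using p12 by simp
qed

lemma s_sq: "s\<^sup>2 = a / M"
  unfolding s_def using a_bounds M_pos by simp

lemma s_pos: "s > 0"
  unfolding s_def using a_bounds M_pos by simp

lemma s_le_1: "s \<le> 1"
proof -
  have "M \<ge> 2" using M_pos t N by linarith
  hence "a / M \<le> 1" using a_bounds by simp
  thus ?thesis unfolding s_def by simp
qed

lemma X_eq: "X = a / s"
  using s_sq s_pos M_pos unfolding X_def by (simp add: field_simps power2_eq_square)

lemma X_pos: "X > 0" unfolding X_eq using a_bounds s_pos by simp

lemma X_le: "X \<le> 2 / s"
  unfolding X_eq using a_bounds s_pos by (intro divide_right_mono) auto

lemma inverse_X_le: "1 / X \<le> 2 * s"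
  unfolding X_eq using a_bounds s_pos by (simp add: field_simps)

lemma \<eta>_eq: "\<eta> = 24 * X / t"
  unfolding \<eta>_def X_eq a_def using t s_pos q_ge by (simp add: field_simps)

definition H :: "real \<Rightarrow> complex" where
  "H u = lnF (of_real (4 * pi\<^sup>2) / Complex s (s * u)) - lnF (of_real (4 * pi\<^sup>2 / q) / Complex s (s * u))"

lemma lnG_eq:
  "lnG {n. \<not> (t + 1) dvd n} (Complex s (s * u)) + of_nat N * Complex s (s * u) =
     of_real (- ln q / 2 + 2 * X) - of_real (X * u\<^sup>2) / (1 + \<i> * of_real u) + H u"
proof -
  define w where "w = 1 + \<i> * complex_of_real u"
  have w: "w \<noteq> 0" using one_plus_i_nz by (simp add: w_def)
  define z where "z = Complex s (s * u)"
  have z: "z = of_real s * w" by (simp add: z_def w_def Complex_scaled)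
  have q: "real (t + 1) = q" by (simp add: q_def)
  have ap: "pi\<^sup>2 / 6 * (1 - 1 / q) = a" using q_ge by (simp add: a_def q_def field_simps)
  have "of_real a / z + of_real M * z = of_real X * (1 / w + w)"
  proof -
    have "a = X * s" using s_pos by (simp add: X_eq)
    hence "of_real a / z = of_real X * (1 / w)" using s_pos by (simp add: z)
    moreover have "of_real M * z = of_real X * w" by (simp add: z X_def)
    ultimately show ?thesis by (simp only: distrib_left)
  qed
  also have "\<dots> = of_real (2 * X) - of_real (X * u\<^sup>2) / w"
    unfolding w_def one_plus_iu_reciprocal by (simp add: algebra_simps)
  finally have key: "of_real a / z + of_real M * z = of_real (2 * X) - of_real (X * u\<^sup>2) / w" .
  have "lnG {n. \<not> (t + 1) dvd n} z + of_nat N * z =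
     lnF (of_real (4 * pi\<^sup>2) / z) - lnF (of_real (4 * pi\<^sup>2 / q) / z)
     + of_real a / z + of_real ((q - 1) / 24) * z - of_real (ln q / 2) + of_nat N * z"
    using lnG_regular_transformation[of z "t + 1"] s_pos unfolding q ap by (simp add: z_def)
  also have "\<dots> = H u + (of_real a / z + of_real M * z) - of_real (ln q / 2)"
  proof -
    have tq: "q - 1 = real t" by (simp add: q_def)
    have Hz: "H u = lnF (of_real (4 * pi\<^sup>2) / z) - lnF (of_real (4 * pi\<^sup>2 / q) / z)"
      by (simp only: H_def z_def)
    show ?thesis unfolding Hz tq M_def by (simp add: algebra_simps)
  qed
  finally show ?thesis unfolding key by (simp add: z_def w_def)
qed

text \<open>The size of exp (- 4 pi^2 / (q z)) at z = s (1 + i u). It grows from exp (- \<eta>) at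
  the saddle point to exp (- \<eta>/2) at the ends of the central arc.\<close>

definition Y :: "real \<Rightarrow> real" where
  "Y u = exp (- (\<eta> / (1 + u\<^sup>2)))"

lemma Y_le: "\<bar>u\<bar> \<le> 1 \<Longrightarrow> Y u \<le> exp (- \<eta> / 2)" "\<bar>u\<bar> \<le> 1 \<Longrightarrow> Y u \<le> 2 / 39"
proof -
  assume u: "\<bar>u\<bar> \<le> 1"
  have "u\<^sup>2 \<le> 1" using u by (simp add: abs_square_le_1)
  moreover have "1 + u\<^sup>2 > 0" by (intro add_pos_nonneg) auto
  ultimately have "\<eta> / 2 \<le> \<eta> / (1 + u\<^sup>2)" using \<eta>_pos
    by (intro divide_left_mono) auto
  thus 1: "Y u \<le> exp (- \<eta> / 2)" by (simp add: Y_def)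
  have "\<eta> / 2 \<ge> 3" using \<eta>_ge pi_gt3 by linarith
  thus "Y u \<le> 2 / 39" using 1 exp_minus_le_of_ge_3[of "\<eta> / 2"] by simp
qed

lemma norm_H_le: "\<bar>u\<bar> \<le> 1 \<Longrightarrow> norm (H u) \<le> (56/25) * Y u"
proof -
  assume u: "\<bar>u\<bar> \<le> 1"
  have u2: "u\<^sup>2 \<le> 1" "1 + u\<^sup>2 > 0" using u by (auto simp: abs_square_le_1 intro: add_pos_nonneg)
  have r1: "Re (of_real (4 * pi\<^sup>2 / q) / Complex s (s * u)) = \<eta> / (1 + u\<^sup>2)"
    unfolding Re_inverse_scaled[OF s_pos] \<eta>_def by simp
  have r2: "Re (of_real (4 * pi\<^sup>2) / Complex s (s * u)) = q * (\<eta> / (1 + u\<^sup>2))"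
    unfolding Re_inverse_scaled[OF s_pos] \<eta>_def using q_ge by simp
  have "\<eta> / 2 \<le> \<eta> / (1 + u\<^sup>2)" using \<eta>_pos u2
    by (intro divide_left_mono) auto
  hence ge: "\<eta> / (1 + u\<^sup>2) \<ge> 3" using \<eta>_ge pi_gt3 by linarith
  have ge': "q * (\<eta> / (1 + u\<^sup>2)) \<ge> \<eta> / (1 + u\<^sup>2)" using mult_right_mono[of 1 q "\<eta> / (1 + u\<^sup>2)"] ge q_ge by simp
  have "norm (lnF (of_real (4 * pi\<^sup>2 / q) / Complex s (s * u))) \<le> (28/25) * Y u"
    using norm_lnF_small[of "of_real (4 * pi\<^sup>2 / q) / Complex s (s * u)"] ge unfolding r1 Y_def by simp
  moreover have "norm (lnF (of_real (4 * pi\<^sup>2) / Complex s (s * u))) \<le> (28/25) * exp (- (q * (\<eta> / (1 + u\<^sup>2))))"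
    using norm_lnF_small[of "of_real (4 * pi\<^sup>2) / Complex s (s * u)"] ge ge' unfolding r2 by simp
  moreover have "exp (- (q * (\<eta> / (1 + u\<^sup>2)))) \<le> Y u" using ge' by (simp add: Y_def)
  ultimately show ?thesis unfolding H_def by (intro order.trans[OF norm_triangle_ineq4]) linarith
qed

lemma norm_H_le': "\<bar>u\<bar> \<le> 1 \<Longrightarrow> norm (H u) \<le> (23/200)"
  using norm_H_le[of u] Y_le(2)[of u] by simp

text \<open>The number 23/200 is just above (56/25) (2/39). The value 1129/1000 has to stay below
  the slack in range (ii), see \<open>upper_slack\<close>.\<close>

lemma exp_const: "exp (23/200) \<le> ((1129/1000) :: real)"
  using exp_bound[of "(23/200) :: real"] by (simp add: power2_eq_square)

lemma continuous_on_H: "continuous_on {-1..1} H"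
proof -
  have c: "continuous_on {-1..1} (\<lambda>u. of_real k / Complex s (s * u))" for k
    unfolding Complex_scaled using s_pos one_plus_i_nz by (intro continuous_intros) auto
  have r: "Re (of_real k / Complex s (s * u)) > 0" if "k > 0" for k u
  proof -
    have "1 + u\<^sup>2 > 0" by (intro add_pos_nonneg) auto
    thus ?thesis unfolding Re_inverse_scaled[OF s_pos] using s_pos that by simp
  qed
  have "4 * pi\<^sup>2 / q > 0" "4 * pi\<^sup>2 > 0" using q_ge by auto
  thus ?thesis unfolding H_def[abs_def]
    by (intro continuous_on_diff continuous_on_lnF_compose c r)
qed

definition main :: real where
  "main = exp (- ln q / 2 + 2 * X) * s / (2 * pi) * sqrt (pi / X)"

lemma main_pos: "main > 0"
  unfolding main_def using s_pos X_pos by simp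

lemma part_count_central:
  "\<bar>real (num_regular_partitions N t) - exp (- ln q / 2 + 2 * X) * s / (2 * pi) * Re (saddle_int X (\<lambda>u. exp (H u)))\<bar>
     \<le> 2 * 10^8 * s * main"
proof -
  define c where "c = - ln q / 2 + 2 * X"
  have "\<bar>real (num_regular_partitions N t) - exp c * s / (2 * pi) * Re (saddle_int X (\<lambda>u. exp (H u)))\<bar>
     \<le> exp (c + Re (H 0) - 1 / (68 * s))"
    unfolding num_regular_partitions_eq_part_count c_def
    by (intro saddle_part_count s_pos s_le_1 lnG_eq disjI2 exI[of _ "t + 1"]) (use t in auto)
  also have "exp (c + Re (H 0) - 1 / (68 * s)) = exp c * (exp (Re (H 0)) * exp (- (1 / (68 * s))))"
    by (simp flip: exp_add)
  also have "exp (Re (H 0)) \<le> 2"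
  proof -
    have "Re (H 0) \<le> (23/200)" using norm_H_le'[of 0] complex_Re_le_cmod[of "H 0"] by simp
    hence "exp (Re (H 0)) \<le> exp (23/200)" by simp
    also have "\<dots> \<le> 2" using exp_const by linarith
    finally show ?thesis .
  qed
  hence "exp c * (exp (Re (H 0)) * exp (- (1 / (68 * s)))) \<le> exp c * (2 * (10^8 * s * (s * sqrt (pi / X) / (2 * pi))))"
    by (intro mult_left_mono mult_mono tail_relative s_pos s_le_1 X_pos X_le) auto
  also have "\<dots> = 2 * 10^8 * s * main" by (simp add: main_def c_def)
  finally show ?thesis unfolding c_def .
qed

text \<open>Writing exp H = 1 + (exp H - 1), the first summand gives the Gaussian integral. The
  second must be bounded by exp (- \<eta>), its size at the saddle point, although on the arc it may
  be as large as exp (- \<eta>/2); the decay of the kernel has to make up for this.\<close>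

lemma asymptotic:
  "\<bar>real (num_regular_partitions N t) - main\<bar> \<le> 10^9 * (s + exp (- \<eta>)) * main"
proof -
  define R where "R = sqrt (pi / X)"
  define c where "c = exp (- ln q / 2 + 2 * X) * s / (2 * pi)"
  have c: "c > 0" using s_pos by (simp add: c_def)
  have R: "R > 0" using X_pos by (simp add: R_def)
  have main: "main = c * R" by (simp add: main_def c_def R_def)
  define I where "I = saddle_int X (\<lambda>u. exp (H u))"
  define I1 where "I1 = integral {-1..1} (\<lambda>u. 1 * ker X u)"
  define I2 where "I2 = integral {-1..1} (\<lambda>u. (exp (H u) - 1) * ker X u)"
  have "I1 + I2 = I"
  proof -
    have "I1 + I2 = integral {-1..1} (\<lambda>u. 1 * ker X u + (exp (H u) - 1) * ker X u)"
      unfolding I1_def I2_def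
      by (intro integral_add [symmetric] integrable_continuous_real continuous_intros continuous_on_H)
    thus ?thesis by (simp add: I_def algebra_simps)
  qed
  have I1: "\<bar>Re I1 - 1 * R\<bar> \<le> 3456 * (\<bar>1\<bar> + 0) * (1 / X + 0) * R"
    unfolding I1_def R_def by (rule saddle_integral[OF X_pos]) auto
  have "norm I2 \<le> (0 + 2 * (3 * (exp (- \<eta>) + 4 / X))) * R"
    unfolding I2_def R_def
  proof (rule saddle_integral_bound[OF X_pos])
    show "continuous_on {-1..1} (\<lambda>u. exp (H u) - 1)" by (intro continuous_intros continuous_on_H)
    show "0 \<le> 3 * (exp (- \<eta>) + 4 / X)" using X_pos by simp
    fix u :: real assume u: "\<bar>u\<bar> \<le> 1"
    have u2: "1 + u\<^sup>2 > 0" by (intro add_pos_nonneg) auto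
    define v P where "v = X * u\<^sup>2" and "P = X * u\<^sup>2 / (1 + u\<^sup>2)"
    have v: "v \<ge> 0" using X_pos by (simp add: v_def)
    have Pv: "exp (- P) \<le> exp (- v / 2)" using damping_bounds(1)[OF X_pos u] by (simp add: v_def P_def)
    have "norm (exp (H u) - 1) \<le> exp \<bar>Re (H u)\<bar> * norm (H u)"
      using Taylor_exp[of "H u" 0] by simp
    also have "\<dots> \<le> (1129/1000) * ((56/25) * Y u)"
    proof (intro mult_mono norm_H_le u)
      have "\<bar>Re (H u)\<bar> \<le> (23/200)" using norm_H_le'[OF u] abs_Re_le_cmod[of "H u"] by linarith
      thus "exp \<bar>Re (H u)\<bar> \<le> (1129/1000)" using exp_const by (meson exp_le_cancel_iff order_trans)
    qed auto
    also have "\<dots> \<le> 3 * Y u" by (simp add: Y_def)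
    finally have e1: "norm (exp (H u) - 1) \<le> 3 * Y u" .
    \<comment> \<open>By \<open>\<eta> = 24 X / t\<close>, the factor \<open>Y u\<close> either costs at most half of the decay of the kernel or is
      itself exponentially small in \<open>X\<close>.\<close>
    have Yu: "Y u * exp (- P) \<le> (exp (- \<eta>) + 4 / X) * exp (- v / 4)"
    proof (cases "t \<ge> 48")
      case True
      have "\<eta> \<le> X / 2" unfolding \<eta>_eq using True X_pos by (simp add: field_simps)
      hence "\<eta> * (u\<^sup>2 / (1 + u\<^sup>2)) \<le> X / 2 * (u\<^sup>2 / (1 + u\<^sup>2))" using u2 by (intro mult_right_mono) auto
      moreover have "\<eta> / (1 + u\<^sup>2) = \<eta> - \<eta> * (u\<^sup>2 / (1 + u\<^sup>2))" using u2 by (simp add: field_simps)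
      moreover have "X / 2 * (u\<^sup>2 / (1 + u\<^sup>2)) = P / 2" by (simp add: P_def)
      ultimately have "- (\<eta> / (1 + u\<^sup>2)) - P \<le> - \<eta> - P / 2" by linarith
      moreover have "P \<ge> v / 2" using Pv by simp
      ultimately have "- (\<eta> / (1 + u\<^sup>2)) - P \<le> - \<eta> - v / 4" by linarith
      hence "exp (- (\<eta> / (1 + u\<^sup>2)) - P) \<le> exp (- \<eta> - v / 4)" by (simp only: exp_le_cancel_iff)
      hence "Y u * exp (- P) \<le> exp (- \<eta>) * exp (- v / 4)" by (simp add: Y_def flip: exp_add)
      also have "\<dots> \<le> (exp (- \<eta>) + 4 / X) * exp (- v / 4)" using X_pos by (intro mult_right_mono) auto
      finally show ?thesis .
    next
      case False
      have "\<eta> \<ge> X / 2" unfolding \<eta>_eq using False X_pos t by (simp add: field_simps)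
      hence "exp (- \<eta> / 2) \<le> exp (- (X / 4))" by simp
      also have "\<dots> \<le> 4 / X"
      proof -
        have "X / 4 \<le> exp (X / 4)" using exp_ge_add_one_self[of "X/4"] by linarith
        thus ?thesis using X_pos by (simp add: exp_minus field_simps)
      qed
      finally have "Y u \<le> exp (- \<eta>) + 4 / X" using Y_le(1)[OF u] exp_gt_zero[of "- \<eta>"] by linarith
      moreover have "exp (- P) \<le> exp (- v / 4)" proof -
        have "exp (- v / 2) \<le> exp (- v / 4)" using v by simp
        thus ?thesis using Pv by linarith
      qed
      ultimately show ?thesis using X_pos by (intro mult_mono) auto
    qed
    have "norm ((exp (H u) - 1) * ker X u) \<le> 3 * Y u * exp (- P)"
      unfolding norm_mult norm_ker P_def by (intro mult_right_mono e1) auto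
    also have "\<dots> \<le> 3 * ((exp (- \<eta>) + 4 / X) * exp (- v / 4))" using Yu by simp
    also have "exp (- v / 4) = exp (- (X / 4) * u\<^sup>2)" by (simp add: v_def)
    finally show "norm ((exp (H u) - 1) * ker X u) \<le> 0 * exp (- X * u\<^sup>2) + 3 * (exp (- \<eta>) + 4 / X) * exp (- (X / 4) * u\<^sup>2)"
      by (simp only: mult_zero_left add_0_left mult.assoc)
  qed simp
  hence I2: "\<bar>Re I2\<bar> \<le> (6 * exp (- \<eta>) + 24 / X) * R"
    using abs_Re_le_cmod[of I2] by (simp add: algebra_simps)
  have "\<bar>Re I - R\<bar> \<le> 3456 * (1 / X) * R + (6 * exp (- \<eta>) + 24 / X) * R"
    using I1 I2 \<open>I1 + I2 = I\<close> by auto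
  also have "\<dots> = (3480 * (1 / X) + 6 * exp (- \<eta>)) * R" by (simp add: algebra_simps)
  also have "\<dots> \<le> (3480 * (2 * s) + 6 * exp (- \<eta>)) * R"
    using inverse_X_le R by (intro mult_right_mono add_right_mono mult_left_mono) auto
  finally have *: "c * \<bar>Re I - R\<bar> \<le> c * ((6960 * s + 6 * exp (- \<eta>)) * R)"
    using c by (intro mult_left_mono) auto
  hence "\<bar>c * Re I - main\<bar> \<le> (6960 * s + 6 * exp (- \<eta>)) * main"
  proof -
    have "c * Re I - main = c * (Re I - R)" by (simp only: main right_diff_distrib)
    hence "\<bar>c * Re I - main\<bar> = c * \<bar>Re I - R\<bar>" using c by (simp only: abs_mult abs_of_pos)
    moreover have "c * ((6960 * s + 6 * exp (- \<eta>)) * R) = (6960 * s + 6 * exp (- \<eta>)) * main"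
      by (simp only: main mult.left_commute)
    ultimately show ?thesis using * by (simp only:)
  qed
  moreover have "\<bar>real (num_regular_partitions N t) - c * Re I\<bar> \<le> 2 * 10^8 * s * main"
    using part_count_central by (simp add: c_def I_def)
  ultimately have "\<bar>real (num_regular_partitions N t) - main\<bar> \<le> (6960 * s + 6 * exp (- \<eta>)) * main + 2 * 10^8 * s * main"
    by linarith
  also have "\<dots> = (6960 * s + 6 * exp (- \<eta>) + 2 * 10^8 * s) * main" by (simp add: distrib_right)
  also have "\<dots> \<le> 10^9 * (s + exp (- \<eta>)) * main"
    using main_pos s_pos exp_gt_zero[of "-\<eta>"] by (intro mult_right_mono) (auto simp: distrib_left)
  finally show ?thesis .
qed

text \<open>In range (ii) the size of exp H - 1 need not tend to 0, so exp H is bounded by a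
  constant factor, without any splitting.\<close>

lemma upper_bound:
  "real (num_regular_partitions N t) \<le> ((1129/1000) + 10^9 * s) * main"
proof -
  define R where "R = sqrt (pi / X)"
  define c where "c = exp (- ln q / 2 + 2 * X) * s / (2 * pi)"
  have c: "c > 0" using s_pos by (simp add: c_def)
  have R: "R > 0" using X_pos by (simp add: R_def)
  have main: "main = c * R" by (simp add: main_def c_def R_def)
  define I where "I = saddle_int X (\<lambda>u. exp (H u))"
  have "norm I \<le> ((1129/1000) + 2 * ((1129/1000) * 1728 * (1 / X))) * R"
    unfolding I_def R_def
  proof (rule saddle_integral_bound[OF X_pos])
    show "continuous_on {-1..1} (\<lambda>u. exp (H u))" by (intro continuous_intros continuous_on_H)
    show "0 \<le> (1129/1000) * 1728 * (1 / X)" using X_pos by simp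
    fix u :: real assume u: "\<bar>u\<bar> \<le> 1"
    have "norm (exp (H u)) \<le> exp (norm (H u))" by (rule norm_exp)
    also have "\<dots> \<le> exp (23/200)" using norm_H_le'[OF u] by simp
    finally have "norm (exp (H u)) \<le> (1129/1000)" using exp_const by linarith
    hence "norm (exp (H u) * ker X u) \<le> (1129/1000) * (exp (- X * u\<^sup>2) + 1728 / X * exp (- (X / 4) * u\<^sup>2))"
      unfolding norm_mult by (intro mult_mono abs_ker_pointwise X_pos u) auto
    thus "norm (exp (H u) * ker X u) \<le> (1129/1000) * exp (- X * u\<^sup>2) + (1129/1000) * 1728 * (1 / X) * exp (- (X / 4) * u\<^sup>2)"
      by (simp add: distrib_left)
  qed simp
  also have "\<dots> \<le> ((1129/1000) + 10000 * s) * R"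
    using inverse_X_le R s_pos by (intro mult_right_mono) linarith+
  finally have "Re I \<le> ((1129/1000) + 10000 * s) * R" using complex_Re_le_cmod[of I] by linarith
  hence "c * Re I \<le> ((1129/1000) + 10000 * s) * main"
    using c mult_left_mono[of "Re I" "((1129/1000) + 10000 * s) * R" c] by (simp add: main mult_ac)
  moreover have "\<bar>real (num_regular_partitions N t) - c * Re I\<bar> \<le> 2 * 10^8 * s * main"
    using part_count_central by (simp add: c_def I_def)
  ultimately have "real (num_regular_partitions N t) \<le> ((1129/1000) + 10000 * s) * main + 2 * 10^8 * s * main"
    by linarith
  also have "\<dots> = ((1129/1000) + 10000 * s + 2 * 10^8 * s) * main" by (simp add: distrib_right)
  also have "\<dots> \<le> ((1129/1000) + 10^9 * s) * main"
    using main_pos s_pos by (intro mult_right_mono) auto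
  finally show ?thesis .
qed

end

section \<open>Regular partitions with large modulus\<close>

text \<open>This simplifies to the Hardy-Ramanujan term exp (pi sqrt (2 N / 3)) / (4 sqrt 3 N). The
  shift of N by 1/24 is left out of the saddle point and treated as an O(s) perturbation.\<close>

definition partition_main :: "nat \<Rightarrow> real" where
  "partition_main N = (let s = pi / sqrt (6 * real N); X = pi\<^sup>2 / (6 * s) in
     exp (ln (s / (2 * pi)) / 2 + 2 * X) * s / (2 * pi) * sqrt (pi / X))"

lemma norm_Ln_one_plus_iu: "norm (Ln (1 + \<i> * of_real u)) \<le> \<bar>u\<bar>"
proof -
  define S where "S = {z. Re z \<ge> 1}"
  have "norm (Ln (1 + \<i> * of_real u) - Ln 1) \<le> 1 * norm ((1 + \<i> * of_real u) - 1)"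
  proof (rule field_differentiable_bound[where S = S])
    show "convex S" unfolding S_def by (rule convex_halfspace_Re_ge)
    fix z assume z: "z \<in> S"
    hence nz: "z \<notin> \<real>\<^sub>\<le>\<^sub>0" by (auto simp: S_def complex_nonpos_Reals_iff)
    show "(Ln has_field_derivative inverse z) (at z within S)"
      by (rule has_field_derivative_at_within[OF has_field_derivative_Ln[OF nz]])
    have "1 \<le> norm z" using z complex_Re_le_cmod[of z] by (simp add: S_def)
    thus "norm (inverse z) \<le> 1" by (simp add: norm_inverse inverse_le_1_iff)
  qed (auto simp: S_def)
  thus ?thesis by (simp add: norm_mult)
qed

text \<open>The real part is ln (1 + u^2) / 2, of second order, while the logarithm itself is of
  first order: the pattern that \<open>saddle_integral\<close> asks for.\<close>

lemma Re_Ln_one_plus_iu: "\<bar>Re (Ln (1 + \<i> * of_real u))\<bar> \<le> u\<^sup>2 / 2"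
proof -
  have p: "1 + u\<^sup>2 > 0" by (intro add_pos_nonneg) auto
  have "Re (Ln (1 + \<i> * of_real u)) = ln (norm (1 + \<i> * of_real u))"
    using one_plus_i_nz by (rule Re_Ln)
  also have "norm (1 + \<i> * of_real u) = sqrt (1 + u\<^sup>2)" by (simp add: cmod_def)
  also have "ln (sqrt (1 + u\<^sup>2)) = ln (1 + u\<^sup>2) / 2" using p by (simp add: ln_sqrt)
  finally have "Re (Ln (1 + \<i> * of_real u)) = ln (1 + u\<^sup>2) / 2" .
  moreover have "ln (1 + u\<^sup>2) \<le> u\<^sup>2" using ln_add_one_self_le_self[of "u\<^sup>2"] by simp
  moreover have "0 \<le> ln (1 + u\<^sup>2)" by simp
  ultimately show ?thesis by linarith
qed

text \<open>The exponential preserves this pattern: beyond the linear term of exp G the error is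
  quadratic, and (\<bar>u\<bar> + \<delta>)^2 \<le> 2 (u^2 + \<delta>) because \<delta> \<le> 1. In
  70 = 50 + 20, the 50 is the quadratic error and the 20 covers the 17 of the linear term.\<close>

lemma exp_class:
  fixes G :: complex and u \<delta> :: real
  assumes u: "\<bar>u\<bar> \<le> 1" and \<delta>: "0 \<le> \<delta>" "\<delta> \<le> 1"
    and G: "norm G \<le> 5 * (\<bar>u\<bar> + \<delta>)" "\<bar>Re G\<bar> \<le> 17 * (u\<^sup>2 + \<delta>)"
  shows "\<bar>Re (exp G) - 1\<bar> \<le> 70 * exp 10 * (u\<^sup>2 + \<delta>)" "\<bar>Im (exp G)\<bar> \<le> 70 * exp 10 * (\<bar>u\<bar> + \<delta>)"
proof -
  have "5 * (\<bar>u\<bar> + \<delta>) \<le> 5 * (1 + 1)" using u \<delta> by (intro mult_left_mono add_mono) auto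
  hence G10: "norm G \<le> 10" using G(1) by simp
  hence e: "exp \<bar>Re G\<bar> \<le> exp 10" using abs_Re_le_cmod[of G] by simp
  have "norm (exp G - 1 - G) \<le> exp \<bar>Re G\<bar> * norm G ^ 2"
    using Taylor_exp[of G 1] by (simp add: diff_diff_eq power2_eq_square)
  also have "\<dots> \<le> exp 10 * (5 * (\<bar>u\<bar> + \<delta>)) ^ 2" using e G(1) by (intro mult_mono power_mono) auto
  also have "(5 * (\<bar>u\<bar> + \<delta>)) ^ 2 \<le> 50 * (u\<^sup>2 + \<delta>)"
  proof -
    have "(\<bar>u\<bar> + \<delta>)\<^sup>2 \<le> 2 * u\<^sup>2 + 2 * \<delta>\<^sup>2" using sum_squares_bound[of "\<bar>u\<bar>" \<delta>] by (simp add: power2_sum)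
    also have "\<delta>\<^sup>2 \<le> \<delta>" using \<delta> by (simp add: power2_eq_square mult_left_le)
    finally have "25 * (\<bar>u\<bar> + \<delta>)\<^sup>2 \<le> 25 * (2 * u\<^sup>2 + 2 * \<delta>)" by simp
    moreover have "(5 * (\<bar>u\<bar> + \<delta>)) ^ 2 = 25 * (\<bar>u\<bar> + \<delta>)\<^sup>2" by (simp only: power_mult_distrib) simp
    ultimately show ?thesis by simp
  qed
  finally have T: "norm (exp G - 1 - G) \<le> exp 10 * (50 * (u\<^sup>2 + \<delta>))" by simp
  have e1: "1 \<le> exp (10 :: real)" by simp
  have "\<bar>Re (exp G) - 1\<bar> \<le> \<bar>Re (exp G - 1 - G)\<bar> + \<bar>Re G\<bar>" by simp
  also have "\<dots> \<le> exp 10 * (50 * (u\<^sup>2 + \<delta>)) + 17 * (u\<^sup>2 + \<delta>)"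
    using T G(2) abs_Re_le_cmod[of "exp G - 1 - G"] by linarith
  also have "17 * (u\<^sup>2 + \<delta>) \<le> exp 10 * (20 * (u\<^sup>2 + \<delta>))"
    using mult_mono[of 1 "exp 10" "17 * (u\<^sup>2 + \<delta>)" "20 * (u\<^sup>2 + \<delta>)"] e1 \<delta> by simp
  finally show "\<bar>Re (exp G) - 1\<bar> \<le> 70 * exp 10 * (u\<^sup>2 + \<delta>)" by (simp add: algebra_simps)
  have "\<bar>Im (exp G)\<bar> \<le> norm (exp G - 1)" using abs_Im_le_cmod[of "exp G - 1"] by simp
  also have "\<dots> \<le> exp \<bar>Re G\<bar> * norm G" using Taylor_exp[of G 0] by simp
  also have "\<dots> \<le> exp 10 * (5 * (\<bar>u\<bar> + \<delta>))" using e G(1) by (intro mult_mono) auto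
  also have "\<dots> \<le> exp 10 * (70 * (\<bar>u\<bar> + \<delta>))" using \<delta> by (intro mult_left_mono mult_right_mono) auto
  also have "\<dots> = 70 * exp 10 * (\<bar>u\<bar> + \<delta>)" by simp
  finally show "\<bar>Im (exp G)\<bar> \<le> 70 * exp 10 * (\<bar>u\<bar> + \<delta>)" .
qed

text \<open>The error of \<open>saddle_integral\<close> with K = 70 exp 10 and 1 / X + s \<le> 2 s,
  plus the contribution of the outer arcs.\<close>

definition partition_const :: real where
  "partition_const = 3456 * (1 + 70 * exp 10) * 2 + exp 10 * 10^8"

text \<open>Treats p(N) (with \<open>lam\<close> = 0 and \<open>D\<close> = 0) and p(N,t) in range
  (iii) at the same saddle point. In the second case \<open>lam\<close> is the value of ln F(q z) at
  the saddle point and \<open>D\<close> its variation along the arc, which must again be of first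
  order with a real part of second order.\<close>

lemma partition_core:
  fixes A :: "nat set" and N :: nat and lam :: real and D :: "real \<Rightarrow> complex"
  defines "s \<equiv> pi / sqrt (6 * real N)"
  assumes A: "A = UNIV \<or> (\<exists>q\<ge>2. A = {n. \<not> q dvd n})" and N: "N \<ge> 2" and lam: "lam \<ge> 0"
    and contD: "continuous_on {-1..1} D"
    and lnG: "\<And>u. \<bar>u\<bar> \<le> 1 \<Longrightarrow> lnG A (Complex s (s * u)) = lnF (Complex s (s * u)) - of_real lam + D u"
    and D1: "\<And>u. \<bar>u\<bar> \<le> 1 \<Longrightarrow> norm (D u) \<le> 4 * \<bar>u\<bar>"
    and D2: "\<And>u. \<bar>u\<bar> \<le> 1 \<Longrightarrow> \<bar>Re (D u)\<bar> \<le> 16 * u\<^sup>2"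
  shows "\<bar>real (part_count A N) - exp (- lam) * partition_main N\<bar> \<le> partition_const * s * partition_main N"
proof -
  define X where "X = pi\<^sup>2 / (6 * s)"
  define c where "c = ln (s / (2 * pi)) / 2"
  define z where "z = (\<lambda>u. Complex s (s * u))"
  \<comment> \<open>Of the factor sqrt (z / (2 pi)), the constant sqrt (s / (2 pi)) is in
    \<open>c\<close> and sqrt (1 + i u) stays here; the other two terms are O(s) and make up the
    \<delta> of \<open>saddle_integral\<close>.\<close>
  define H1 where "H1 = (\<lambda>u. Ln (1 + \<i> * of_real u) / 2 - z u / 24 + lnF (of_real (4 * pi\<^sup>2) / z u))"
  define H where "H = (\<lambda>u. H1 u + D u - of_real lam)"
  define main where "main = exp (c + 2 * X) * s / (2 * pi) * sqrt (pi / X)"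
  have main: "partition_main N = main"
    by (simp add: partition_main_def main_def Let_def s_def X_def c_def)
  have s_pos: "s > 0" using N by (simp add: s_def)
  have p9: "9 \<le> pi\<^sup>2" using power_mono[of 3 pi 2] pi_gt3 by simp
  have p12: "pi\<^sup>2 \<le> 12" using power_mono[of pi "16/5" 2] pi_approx(2) by (simp add: power2_eq_square)
  have s2: "s\<^sup>2 = pi\<^sup>2 / (6 * real N)" by (simp add: s_def power_divide)
  have s_le: "s \<le> 1"
  proof -
    have "s\<^sup>2 \<le> 1" unfolding s2 using p12 N by (simp add: field_simps)
    thus ?thesis using power2_le_imp_le[of s 1] by simp
  qed
  have X_pos: "X > 0" using s_pos by (simp add: X_def)
  have X_le: "X \<le> 2 / s"
  proof -
    have "X = (pi\<^sup>2 / 6) / s" by (simp add: X_def)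
    also have "\<dots> \<le> 2 / s" using p12 s_pos by (intro divide_right_mono) auto
    finally show ?thesis .
  qed
  have inv_X: "1 / X \<le> s" unfolding X_def using p9 s_pos by (simp add: field_simps)
  have sN: "s * N = X"
  proof -
    have "s * (s * N) = pi\<^sup>2 / 6" using s2 N by (simp add: power2_eq_square field_simps)
    thus ?thesis using s_pos by (simp add: X_def field_simps)
  qed
  have nz: "1 + \<i> * complex_of_real u \<noteq> 0" for u by (rule one_plus_i_nz)
  have z: "z u = of_real s * (1 + \<i> * of_real u)" for u by (simp add: z_def Complex_scaled)
  have Rez: "Re (z u) > 0" for u using s_pos by (simp add: z_def)
  have Re_z': "Re (of_real (4 * pi\<^sup>2) / z u) = 4 * pi\<^sup>2 / (s * (1 + u\<^sup>2))" for u
    unfolding z_def by (rule Re_inverse_scaled[OF s_pos])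
  have H_eq: "lnG A (Complex s (s * u)) + of_nat N * Complex s (s * u) =
              of_real (c + 2 * X) - of_real (X * u\<^sup>2) / (1 + \<i> * of_real u) + H u" if u: "\<bar>u\<bar> \<le> 1" for u
  proof -
    define w where "w = 1 + \<i> * complex_of_real u"
    have w: "w \<noteq> 0" using nz by (simp add: w_def)
    have "Ln (z u / of_real (2 * pi)) = of_real (ln (s / (2 * pi))) + Ln w"
    proof -
      have "z u / of_real (2 * pi) = of_real (s / (2 * pi)) * w" by (simp add: z w_def)
      thus ?thesis using Ln_times_of_real[of "s / (2 * pi)" w] Ln_of_real[of "s / (2 * pi)"] s_pos w
        by (simp only:) simp
    qed
    hence L: "Ln (z u / of_real (2 * pi)) / 2 = of_real c + Ln w / 2" by (simp add: c_def add_divide_distrib)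
    have "of_real (pi\<^sup>2) / (6 * z u) + of_nat N * z u = of_real X * (1 / w + w)"
    proof -
      have "pi\<^sup>2 / 6 = X * s" using s_pos by (simp add: X_def)
      hence "of_real (pi\<^sup>2 / 6) / z u = of_real X * (1 / w)" using s_pos by (simp add: z w_def)
      moreover have "of_real (pi\<^sup>2) / (6 * z u) = of_real (pi\<^sup>2 / 6) / z u" by simp
      moreover have "of_nat N * z u = of_real X * w" by (simp add: z w_def sN [symmetric])
      ultimately show ?thesis by (simp only: distrib_left)
    qed
    also have "\<dots> = of_real (2 * X) - of_real (X * u\<^sup>2) / w"
      unfolding w_def one_plus_iu_reciprocal by (simp add: algebra_simps)
    finally have key: "of_real (pi\<^sup>2) / (6 * z u) + of_nat N * z u = of_real (2 * X) - of_real (X * u\<^sup>2) / w" .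
    have "lnF (z u) = lnF (of_real (4 * pi\<^sup>2) / z u) + of_real (pi\<^sup>2) / (6 * z u) - z u / 24 + (of_real c + Ln w / 2)"
      using lnF_transformation[OF Rez[of u]] unfolding L [symmetric] by simp
    hence "lnG A (z u) + of_nat N * z u = (of_real (pi\<^sup>2) / (6 * z u) + of_nat N * z u) + of_real c + H u"
    proof -
      have "lnG A (z u) = lnF (z u) - of_real lam + D u" using lnG[OF u] by (simp add: z_def)
      thus ?thesis using \<open>lnF (z u) = _\<close> by (simp add: H_def H1_def w_def)
    qed
    thus ?thesis unfolding key by (simp add: z_def w_def)
  qed
  have cont_z': "continuous_on {-1..1} (\<lambda>u. of_real (4 * pi\<^sup>2) / z u)"
    unfolding z using s_pos nz by (intro continuous_intros) auto
  have contH: "continuous_on {-1..1} H"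
  proof -
    have p: "1 + u\<^sup>2 > 0" for u :: real by (intro add_pos_nonneg) auto
    have "continuous_on {-1..1} (\<lambda>u. lnF (of_real (4 * pi\<^sup>2) / z u))"
      by (rule continuous_on_lnF_compose[OF cont_z']) (unfold Re_z', use s_pos p in simp)
    moreover have "continuous_on {-1..1} (\<lambda>u. Ln (1 + \<i> * complex_of_real u))"
      by (intro continuous_intros) (auto simp: complex_nonpos_Reals_iff)
    moreover have "continuous_on {-1..1} z" unfolding z_def Complex_scaled by (intro continuous_intros)
    ultimately show ?thesis unfolding H_def H1_def
      by (intro continuous_on_add continuous_on_diff continuous_on_divide continuous_on_const contD) auto
  qed
  have H1_bound: "norm (H1 u) \<le> \<bar>u\<bar> / 2 + 2 * s" "\<bar>Re (H1 u)\<bar> \<le> u\<^sup>2 / 4 + 2 * s" if u: "\<bar>u\<bar> \<le> 1" for u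
  proof -
    define r where "r = lnF (of_real (4 * pi\<^sup>2) / z u) - z u / 24"
    have u2: "u\<^sup>2 \<le> 1" using u by (simp add: abs_square_le_1)
    have p: "1 + u\<^sup>2 > 0" by (intro add_pos_nonneg) auto
    have "norm (1 + \<i> * complex_of_real u) \<le> 2"
      using norm_triangle_ineq[of 1 "\<i> * complex_of_real u"] u by (simp add: norm_mult)
    hence "norm (z u) \<le> s * 2" unfolding z norm_mult using s_pos by simp
    hence "norm (z u / 24) \<le> s" using s_pos by (simp add: norm_divide)
    moreover have "norm (lnF (of_real (4 * pi\<^sup>2) / z u)) \<le> s"
    proof -
      define y where "y = 4 * pi\<^sup>2 / (s * (1 + u\<^sup>2))"
      have "18 / s = 36 / (s * 2)" by simp
      also have "\<dots> \<le> y" unfolding y_def using p9 s_pos u2 p by (intro frac_le mult_left_mono) auto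
      finally have y: "18 / s \<le> y" .
      have "18 \<le> 18 / s" using s_pos s_le by (simp add: field_simps)
      hence "norm (lnF (of_real (4 * pi\<^sup>2) / z u)) \<le> (28/25) * exp (- y)"
        using norm_lnF_small[of "of_real (4 * pi\<^sup>2) / z u"] y unfolding Re_z' y_def by simp
      also have "exp (- y) \<le> exp (- (18 / s))" using y by simp
      also have "exp (- (18 / s)) \<le> s / 18"
      proof -
        have "18 / s \<le> exp (18 / s)" using exp_ge_add_one_self[of "18/s"] by linarith
        thus ?thesis using s_pos by (simp add: exp_minus field_simps)
      qed
      finally show ?thesis using s_pos by simp
    qed
    ultimately have r: "norm r \<le> 2 * s" unfolding r_def by (intro order.trans[OF norm_triangle_ineq4]) simp
    have H1: "H1 u = Ln (1 + \<i> * of_real u) / 2 + r" by (simp add: H1_def r_def)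
    have "norm (Ln (1 + \<i> * of_real u) / 2) \<le> \<bar>u\<bar> / 2" using norm_Ln_one_plus_iu[of u] by (simp add: norm_divide)
    thus "norm (H1 u) \<le> \<bar>u\<bar> / 2 + 2 * s" unfolding H1 using r by (intro order.trans[OF norm_triangle_ineq]) simp
    have "\<bar>Re (Ln (1 + \<i> * of_real u) / 2)\<bar> \<le> u\<^sup>2 / 4" using Re_Ln_one_plus_iu[of u] by simp
    moreover have "\<bar>Re r\<bar> \<le> 2 * s" using r abs_Re_le_cmod[of r] by linarith
    ultimately show "\<bar>Re (H1 u)\<bar> \<le> u\<^sup>2 / 4 + 2 * s" unfolding H1 by simp
  qed
  define K where "K = 70 * exp (10 :: real)"
  have K: "K \<ge> 0" by (simp add: K_def)
  \<comment> \<open>This factor plays the role of \<open>a\<close> in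
    \<open>saddle_integral\<close>. As it is at most 1, the resulting constant does not depend on
    \<open>lam\<close>.\<close>
  define \<alpha> where "\<alpha> = exp (- lam)"
  have \<alpha>: "0 < \<alpha>" "\<alpha> \<le> 1" using lam by (auto simp: \<alpha>_def)
  have expH: "exp (H u) = of_real \<alpha> * exp (H1 u + D u)" for u
    by (simp add: H_def \<alpha>_def exp_diff exp_minus field_simps exp_of_real flip: exp_of_real)
  have G: "norm (H1 u + D u) \<le> 5 * (\<bar>u\<bar> + s)" "\<bar>Re (H1 u + D u)\<bar> \<le> 17 * (u\<^sup>2 + s)" if u: "\<bar>u\<bar> \<le> 1" for u
  proof -
    show "norm (H1 u + D u) \<le> 5 * (\<bar>u\<bar> + s)"
      using H1_bound(1)[OF u] D1[OF u] s_pos by (intro order.trans[OF norm_triangle_ineq]) simp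
    have "\<bar>Re (H1 u + D u)\<bar> \<le> u\<^sup>2 / 4 + 2 * s + 16 * u\<^sup>2"
      using H1_bound(2)[OF u] D2[OF u] by simp
    also have "\<dots> \<le> 17 * (u\<^sup>2 + s)" using s_pos by (simp add: algebra_simps)
    finally show "\<bar>Re (H1 u + D u)\<bar> \<le> 17 * (u\<^sup>2 + s)" .
  qed
  define I where "I = saddle_int X (\<lambda>u. exp (H u))"
  define R where "R = sqrt (pi / X)"
  have R: "R > 0" using X_pos by (simp add: R_def)
  have "\<bar>Re I - \<alpha> * R\<bar> \<le> 3456 * (\<bar>\<alpha>\<bar> + K) * (1 / X + s) * R"
    unfolding I_def R_def
  proof (rule saddle_integral[OF X_pos])
    show "continuous_on {-1..1} (\<lambda>u. exp (H u))" by (intro continuous_intros contH)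
    fix u :: real assume u: "\<bar>u\<bar> \<le> 1"
    note E = exp_class[OF u _ s_le G[OF u]]
    have "\<bar>Re (exp (H u)) - \<alpha>\<bar> = \<alpha> * \<bar>Re (exp (H1 u + D u)) - 1\<bar>"
    proof -
      have "Re (exp (H u)) - \<alpha> = \<alpha> * (Re (exp (H1 u + D u)) - 1)"
        unfolding expH by (simp add: right_diff_distrib)
      thus ?thesis using \<alpha> by (simp only: abs_mult abs_of_pos)
    qed
    also have "\<dots> \<le> 1 * (K * (u\<^sup>2 + s))"
      unfolding K_def using \<alpha> E(1) s_pos by (intro mult_mono) auto
    finally show "\<bar>Re (exp (H u)) - \<alpha>\<bar> \<le> K * (u\<^sup>2 + s)" by simp
    have "\<bar>Im (exp (H u))\<bar> = \<alpha> * \<bar>Im (exp (H1 u + D u))\<bar>"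
      unfolding expH using \<alpha> by (simp add: abs_mult)
    also have "\<dots> \<le> 1 * (K * (\<bar>u\<bar> + s))"
      unfolding K_def using \<alpha> E(2) s_pos by (intro mult_mono) auto
    finally show "\<bar>Im (exp (H u))\<bar> \<le> K * (\<bar>u\<bar> + s)" by simp
  qed (use s_pos K in auto)
  also have "\<dots> \<le> 3456 * (1 + K) * (2 * s) * R"
    using \<alpha> K inv_X s_pos X_pos R by (intro mult_right_mono mult_mono) auto
  finally have I: "\<bar>Re I - \<alpha> * R\<bar> \<le> 3456 * (1 + K) * (2 * s) * R" .
  define C where "C = exp (c + 2 * X) * s / (2 * pi)"
  have C: "C > 0" using s_pos by (simp add: C_def)
  have mainC: "main = C * R" by (simp add: main_def C_def R_def)
  have *: "C * \<bar>Re I - \<alpha> * R\<bar> \<le> C * (3456 * (1 + K) * (2 * s) * R)" using I C by (intro mult_left_mono) auto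
  have "\<bar>C * Re I - \<alpha> * main\<bar> \<le> 3456 * (1 + K) * (2 * s) * main"
  proof -
    have "C * Re I - \<alpha> * main = C * (Re I - \<alpha> * R)" by (simp only: mainC right_diff_distrib mult.left_commute)
    hence "\<bar>C * Re I - \<alpha> * main\<bar> = C * \<bar>Re I - \<alpha> * R\<bar>" using C by (simp only: abs_mult abs_of_pos)
    moreover have "C * (3456 * (1 + K) * (2 * s) * R) = 3456 * (1 + K) * (2 * s) * main"
      by (simp only: mainC mult.left_commute)
    ultimately show ?thesis using * by (simp only:)
  qed
  moreover have "\<bar>real (part_count A N) - C * Re I\<bar> \<le> exp 10 * 10^8 * s * main"
  proof -
    have "\<bar>real (part_count A N) - C * Re I\<bar> \<le> exp (c + 2 * X + Re (H 0) - 1 / (68 * s))"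
      unfolding C_def I_def by (rule saddle_part_count[OF A s_pos s_le H_eq])
    also have "\<dots> = exp (c + 2 * X) * (exp (Re (H 0)) * exp (- (1 / (68 * s))))"
      by (simp flip: exp_add)
    also have "\<dots> \<le> exp (c + 2 * X) * (exp 10 * (10^8 * s * (s * sqrt (pi / X) / (2 * pi))))"
    proof (intro mult_left_mono mult_mono tail_relative s_pos s_le X_pos X_le)
      have "\<bar>Re (H1 0 + D 0)\<bar> \<le> 5" using abs_Re_le_cmod[of "H1 0 + D 0"] G(1)[of 0] s_le by simp
      hence "Re (H 0) \<le> 10" using lam by (simp add: H_def)
      thus "exp (Re (H 0)) \<le> exp 10" by simp
    qed auto
    also have "\<dots> = exp 10 * 10^8 * s * main" by (simp add: main_def)
    finally show ?thesis .
  qed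
  ultimately have "\<bar>real (part_count A N) - \<alpha> * main\<bar> \<le> 3456 * (1 + K) * (2 * s) * main + exp 10 * 10^8 * s * main"
    by linarith
  also have "\<dots> = partition_const * s * main" by (simp add: partition_const_def K_def algebra_simps)
  finally show ?thesis by (simp add: main \<alpha>_def)
qed

text \<open>Cauchy's estimates on unit discs bound the n-th derivative by n! * 4 exp (- v), while
  the displacement is v u. Since v exp (- v) \<le> 1 and v^2 exp (- v) \<le> 2, the first and second
  order bounds are uniform in v, hence in t.\<close>

lemma lnF_ray_bounds:
  fixes v u :: real
  assumes v: "v \<ge> 6" and u: "\<bar>u\<bar> \<le> 1"
  shows "norm (lnF (of_real v) - lnF (Complex v (v * u))) \<le> 4 * \<bar>u\<bar>"
    and "\<bar>Re (lnF (of_real v) - lnF (Complex v (v * u)))\<bar> \<le> 16 * u\<^sup>2"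
proof -
  define S where "S = {z. Re z \<ge> v}"
  have op: "open {z. Re z > 0}" by (rule open_halfspace_Re_gt)
  have bound: "norm ((deriv ^^ n) lnF x) \<le> fact n * (4 * exp (- v)) / 1 ^ n" if x: "x \<in> S" for n x
  proof (rule Cauchy_inequality)
    have sub: "cball x 1 \<subseteq> {z. Re z > 0}"
    proof
      fix y assume "y \<in> cball x 1"
      hence "\<bar>Re (x - y)\<bar> \<le> 1" using abs_Re_le_cmod[of "x - y"] by (simp add: dist_norm)
      thus "y \<in> {z. Re z > 0}" using x v by (auto simp: S_def)
    qed
    show "lnF holomorphic_on ball x 1"
      by (rule holomorphic_on_subset[OF holomorphic_lnF]) (use sub ball_subset_cball in blast)
    show "continuous_on (cball x 1) lnF"
      by (rule holomorphic_on_imp_continuous_on[OF holomorphic_on_subset[OF holomorphic_lnF sub]])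
    fix y assume "norm (x - y) = 1"
    hence "\<bar>Re (x - y)\<bar> \<le> 1" using abs_Re_le_cmod[of "x - y"] by simp
    hence y: "Re y \<ge> v - 1" using x by (auto simp: S_def)
    have "norm (lnF y) \<le> (28/25) * exp (- Re y)" using y v by (intro norm_lnF_small) auto
    also have "exp (- Re y) \<le> exp 1 * exp (- v)" using y by (simp flip: exp_add)
    also have "exp 1 * exp (- v) \<le> 3 * exp (- v)" using exp_le by (intro mult_right_mono) auto
    finally show "norm (lnF y) \<le> 4 * exp (- v)" using exp_gt_zero[of "- v"] by linarith
  qed simp
  have d: "((deriv ^^ i) lnF has_field_derivative (deriv ^^ Suc i) lnF x) (at x within S)" if x: "x \<in> S" for i x
  proof -
    have "(deriv ^^ i) lnF holomorphic_on {z. Re z > 0}"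
      by (rule holomorphic_higher_deriv[OF holomorphic_lnF op])
    moreover have "x \<in> {z. Re z > 0}" using x v by (auto simp: S_def)
    ultimately have "((deriv ^^ i) lnF has_field_derivative deriv ((deriv ^^ i) lnF) x) (at x)"
      using holomorphic_derivI[OF _ op] by blast
    thus ?thesis by (simp add: has_field_derivative_at_within)
  qed
  have conv: "convex S" unfolding S_def by (rule convex_halfspace_Re_ge)
  have vS: "of_real v \<in> S" by (simp add: S_def)
  have yS: "Complex v (v * x) \<in> S" for x by (simp add: S_def)
  have diff: "Complex v (v * x) - of_real v = \<i> * of_real (v * x)" for x by (simp add: complex_eq_iff)
  have ve: "v * exp (- v) \<le> 1" "v\<^sup>2 * exp (- v) \<le> 2"
  proof -
    have "1 + v + v\<^sup>2 / 2 \<le> exp v" using v by (intro exp_lower_Taylor_quadratic) auto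
    hence "v \<le> exp v" "v\<^sup>2 \<le> 2 * exp v" using v zero_le_power2[of v] by linarith+
    thus "v * exp (- v) \<le> 1" "v\<^sup>2 * exp (- v) \<le> 2" by (simp_all add: exp_minus field_simps)
  qed
  note taylor = complex_Taylor[OF conv, where f = "\<lambda>i. (deriv ^^ i) lnF", OF d]
  have b1: "norm ((deriv ^^ Suc 0) lnF x) \<le> 4 * exp (- v)" if "x \<in> S" for x
    using bound[OF that, of 1] by simp
  have b2: "norm ((deriv ^^ Suc 1) lnF x) \<le> 8 * exp (- v)" if "x \<in> S" for x
    using bound[OF that, of 2] by (simp add: numeral_2_eq_2)
  from taylor[OF _ b1 vS yS[of u]]
  have "norm (lnF (Complex v (v * u)) - lnF (of_real v)) \<le> 4 * (v * exp (- v)) * \<bar>u\<bar>"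
    unfolding diff using v by (simp add: norm_mult abs_mult mult_ac)
  also have "\<dots> \<le> 4 * 1 * \<bar>u\<bar>" using ve by (intro mult_right_mono mult_left_mono) auto
  finally show "norm (lnF (of_real v) - lnF (Complex v (v * u))) \<le> 4 * \<bar>u\<bar>" by (simp add: norm_minus_commute)
  define l where "l = deriv lnF (of_real v)"
  have second: "norm (lnF (Complex v (v * x)) - lnF (of_real v) - l * (\<i> * of_real (v * x))) \<le> 16 * u\<^sup>2" if "\<bar>x\<bar> = \<bar>u\<bar>" for x
  proof -
    have x2: "x\<^sup>2 = u\<^sup>2" using that by (metis power2_abs)
    from taylor[OF _ b2 vS yS[of x]]
    have "norm (lnF (Complex v (v * x)) - lnF (of_real v) - l * (\<i> * of_real (v * x))) \<le> 8 * exp (- v) * (\<bar>v\<bar> * \<bar>x\<bar>)\<^sup>2"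
      unfolding diff by (simp add: l_def norm_mult diff_diff_eq power2_eq_square)
    also have "\<dots> = 8 * (v\<^sup>2 * exp (- v)) * u\<^sup>2" by (simp add: power_mult_distrib x2)
    also have "\<dots> \<le> 8 * 2 * u\<^sup>2" using ve by (intro mult_right_mono mult_left_mono) auto
    finally show ?thesis by simp
  qed
  have cnj: "lnF (Complex v (v * (- u))) = cnj (lnF (Complex v (v * u)))"
  proof -
    have "Complex v (v * (- u)) = cnj (Complex v (v * u))" by (simp add: complex_eq_iff)
    thus ?thesis using lnF_cnj[of "Complex v (v * u)"] v by simp
  qed
  \<comment> \<open>The linear terms at \<open>u\<close> and \<open>-u\<close> cancel.\<close>
  define P where "P = lnF (Complex v (v * u)) - lnF (of_real v) - l * (\<i> * of_real (v * u))"
  define Q where "Q = lnF (Complex v (v * (- u))) - lnF (of_real v) - l * (\<i> * of_real (v * (- u)))"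
  have "norm P \<le> 16 * u\<^sup>2" "norm Q \<le> 16 * u\<^sup>2" unfolding P_def Q_def by (rule second; simp)+
  hence "\<bar>Re P\<bar> \<le> 16 * u\<^sup>2" "\<bar>Re Q\<bar> \<le> 16 * u\<^sup>2" using abs_Re_le_cmod[of P] abs_Re_le_cmod[of Q] by linarith+
  moreover have "Re P + Re Q = 2 * Re (lnF (Complex v (v * u)) - lnF (of_real v))"
  proof -
    have "P + Q = lnF (Complex v (v * u)) + cnj (lnF (Complex v (v * u))) - 2 * lnF (of_real v)"
      unfolding P_def Q_def cnj by (simp add: algebra_simps)
    hence "Re (P + Q) = Re (lnF (Complex v (v * u)) + cnj (lnF (Complex v (v * u))) - 2 * lnF (of_real v))" by (rule arg_cong)
    thus ?thesis by simp
  qed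
  ultimately show "\<bar>Re (lnF (of_real v) - lnF (Complex v (v * u)))\<bar> \<le> 16 * u\<^sup>2" by simp
qed

text \<open>These are the bounds on \<nu> = lambert v / exp (- v) in range (iii). Below, the first
  term 1 / (exp v - 1) already exceeds exp (- v); above, exp (- v) \<le> 1/350 gives the factor
  (350/349)^2 < 1.00873.\<close>

lemma lambert_bounds:
  assumes v: "v > 6"
  shows "exp (- v) < lambert v" "lambert v < 1.00873 * exp (- v)"
proof -
  define w where "w = exp (- v)"
  have w: "0 < w" "w \<le> 1 / 350"
  proof -
    have "exp (- v) \<le> exp (- 6)" using v by simp
    also have "\<dots> = exp (- 3) * exp (- 3)" by (simp flip: exp_add)
    also have "\<dots> \<le> (2 / 39) * (2 / 39 :: real)" using exp_minus_le_of_ge_3[of 3] by (intro mult_mono) auto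
    finally show "w \<le> 1 / 350" by (simp add: w_def)
  qed (simp add: w_def)
  have sm: "summable (\<lambda>i. 1 / (real (Suc i) * (exp (v * real (Suc i)) - 1)))" using v by (intro lambert_summable) simp
  have "w < 1 / (exp v - 1)"
  proof -
    have "exp v > 1" using v by simp
    thus ?thesis by (simp add: w_def exp_minus field_simps)
  qed
  also have "\<dots> = (\<Sum>i\<in>{0}. 1 / (real (Suc i) * (exp (v * real (Suc i)) - 1)))" by simp
  also have "\<dots> \<le> lambert v" unfolding lambert_def using v by (intro sum_le_suminf sm) auto
  finally show "exp (- v) < lambert v" by (simp add: w_def)
  have "lambert v \<le> norm (lnF (of_real v))" using lnF_of_real[of v] v by simp
  also have "\<dots> \<le> w / (1 - w)\<^sup>2" using norm_lnF_le[of "of_real v"] v by (simp add: w_def)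
  also have "(349 / 350)\<^sup>2 \<le> (1 - w)\<^sup>2" using w by (intro power_mono) auto
  hence "w / (1 - w)\<^sup>2 \<le> w / (349 / 350)\<^sup>2" using w by (intro divide_left_mono mult_pos_pos) auto
  also have "\<dots> < 1.00873 * w" using w by (simp add: power2_eq_square)
  finally show "lambert v < 1.00873 * exp (- v)" by (simp add: w_def)
qed

lemma continuous_on_ray: "continuous_on S (\<lambda>u. Complex v (v * u))"
  unfolding Complex_scaled by (intro continuous_intros)

lemma partition_asymptotic:
  assumes "N \<ge> 2"
  shows "\<bar>real (num_partitions N) - partition_main N\<bar> \<le> partition_const * (pi / sqrt (6 * real N)) * partition_main N"
  using partition_core[of UNIV N 0 "\<lambda>_. 0"] assms
  by (simp add: lnG_UNIV num_partitions_eq_part_count)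

lemma regular_partition_asymptotic:
  assumes N: "N \<ge> 2" and t: "t \<ge> 1"
  defines "v \<equiv> (real t + 1) * (pi / sqrt (6 * real N))"
  assumes v: "v \<ge> 6"
  shows "\<bar>real (num_regular_partitions N t) - exp (- lambert v) * partition_main N\<bar>
            \<le> partition_const * (pi / sqrt (6 * real N)) * partition_main N"
proof -
  define s where "s = pi / sqrt (6 * real N)"
  have s: "s > 0" using N by (simp add: s_def)
  have vs: "v = real (t + 1) * s" by (simp add: v_def s_def)
  have lam: "lnF (of_real v) = of_real (lambert v)" using v by (intro lnF_of_real) auto
  have "lambert v \<ge> 0"
    unfolding lambert_def using v by (intro suminf_nonneg lambert_summable) auto
  have scale: "of_nat (t + 1) * Complex s (s * u) = Complex v (v * u)" for u
    by (simp add: vs complex_eq_iff)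
  show ?thesis unfolding num_regular_partitions_eq_part_count
  proof (rule partition_core[where D = "\<lambda>u. lnF (of_real v) - lnF (Complex v (v * u))"])
    show "{n. \<not> (t + 1) dvd n} = UNIV \<or> (\<exists>q\<ge>2. {n. \<not> (t + 1) dvd n} = {n. \<not> q dvd n})"
      using t by (intro disjI2 exI[of _ "t + 1"]) auto
    show "continuous_on {-1..1} (\<lambda>u. lnF (of_real v) - lnF (Complex v (v * u)))"
      using v by (intro continuous_on_diff continuous_on_const continuous_on_lnF_compose continuous_on_ray) auto
    fix u :: real assume u: "\<bar>u\<bar> \<le> 1"
    show "lnG {n. \<not> (t + 1) dvd n} (Complex (pi / sqrt (6 * real N)) (pi / sqrt (6 * real N) * u)) =
       lnF (Complex (pi / sqrt (6 * real N)) (pi / sqrt (6 * real N) * u)) - of_real (lambert v) + (lnF (of_real v) - lnF (Complex v (v * u)))"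
      unfolding s_def [symmetric] using lnG_regular[of "Complex s (s * u)" "t + 1"] s unfolding scale lam by simp
    show "norm (lnF (of_real v) - lnF (Complex v (v * u))) \<le> 4 * \<bar>u\<bar>"
      "\<bar>Re (lnF (of_real v) - lnF (Complex v (v * u)))\<bar> \<le> 16 * u\<^sup>2"
      using lnF_ray_bounds[OF v u] by auto
  qed fact+
qed

section \<open>The three ranges\<close>

definition regular_main :: "nat \<Rightarrow> nat \<Rightarrow> real" where
  "regular_main N t = sqrt 12 * A_coeff t N *
     exp (2 * pi / sqrt 6 * sqrt (real t / (real t + 1) * (real N + real t / 24)))"

lemma regular_main_pos: "t \<ge> 1 \<Longrightarrow> regular_main N t > 0"
  unfolding regular_main_def A_coeff_def by (intro mult_pos_pos) auto

lemma regular_partitions_estimate: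
  fixes N t :: nat
  assumes t: "t \<ge> 1" and N: "t + 1 \<le> N"
    and \<eta>: "2 * pi \<le> 2 * pi * sqrt ((24 * real N + real t) / (real t * (real t + 1)))"
  defines "y \<equiv> exp (- 2 * pi * sqrt ((24 * real N + real t) / (real t * (real t + 1))))"
  shows "\<bar>real (num_regular_partitions N t) - regular_main N t\<bar> \<le> 10^9 * (2 * real N powr (-1/2) + y) * regular_main N t"
    and "real (num_regular_partitions N t) \<le> (1129/1000 + 10^9 * (2 * real N powr (-1/2))) * regular_main N t"
proof -
  define M where "M = real N + real t / 24"
  define q where "q = real t + 1"
  define a where "a = pi\<^sup>2 * real t / (6 * q)"
  define s where "s = sqrt (a / M)"
  define X where "X = s * M"
  define e where "e = 4 * pi\<^sup>2 / (q * s)"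
  have M: "M > 0" "M \<ge> real N" using N by (auto simp: M_def)
  have q: "q > 0" by (simp add: q_def)
  have t0: "real t > 0" using t by simp
  have a: "a > 0" using t0 q by (simp add: a_def)
  have s: "s > 0" using a M by (simp add: s_def)
  have s2: "s\<^sup>2 = a / M" using a M by (simp add: s_def)
  have M24: "24 * real N + real t = 24 * M" by (simp add: M_def)
  have e_eq: "e = 2 * pi * sqrt ((24 * real N + real t) / (real t * (real t + 1)))"
  proof (rule power2_eq_imp_eq)
    have "e\<^sup>2 = 16 * pi^4 / (q\<^sup>2 * (a / M))"
      unfolding e_def by (simp add: power_divide power_mult_distrib s2 flip: power_mult)
    also have "\<dots> = 4 * pi\<^sup>2 * (24 * M / (real t * q))"
      using M q t0 by (simp add: a_def field_simps power2_eq_square power4_eq_xxxx)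
    also have "\<dots> = (2 * pi * sqrt (24 * M / (real t * q)))\<^sup>2"
      using M q t0 by (simp add: power_mult_distrib)
    finally show "e\<^sup>2 = (2 * pi * sqrt ((24 * real N + real t) / (real t * (real t + 1))))\<^sup>2"
      unfolding M24 q_def .
  qed (use s q in \<open>auto simp: e_def\<close>)
  interpret regular_saddle N t M q a s X e
  proof (intro regular_saddle.intro t N M_def q_def a_def s_def X_def e_def)
    show "2 * pi \<le> e" unfolding e_eq by (rule \<eta>)
  qed
  have main_eq: "main = regular_main N t"
  proof -
    have X: "X = pi / sqrt 6 * sqrt (real t / (real t + 1) * (real N + real t / 24))"
    proof (rule power2_eq_imp_eq)
      have "X\<^sup>2 = s\<^sup>2 * M\<^sup>2" by (simp add: X_def power_mult_distrib)
      also have "\<dots> = a * M" unfolding s2 using M by (simp add: power2_eq_square)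
      also have "\<dots> = pi\<^sup>2 / 6 * (real t / q * M)" by (simp add: a_def)
      also have "\<dots> = (pi / sqrt 6 * sqrt (real t / q * M))\<^sup>2"
        using M q t0 by (simp add: power_mult_distrib power_divide)
      finally show "X\<^sup>2 = (pi / sqrt 6 * sqrt (real t / (real t + 1) * (real N + real t / 24)))\<^sup>2"
        unfolding q_def M_def .
    qed (use X_pos M in auto)
    \<comment> \<open>Both prefactors are positive, and fourth powers clear all roots: each becomes
      t / (96 q^3 M^3).\<close>
    have pre: "exp (- ln q / 2) * s / (2 * pi) * sqrt (pi / X) = sqrt 12 * A_coeff t N"
    proof (rule power_eq_imp_eq_base[where n = 4])
      have "exp (- ln q / 2) ^ 4 = 1 / q\<^sup>2"
      proof -
        have "exp (- ln q / 2) ^ 4 = exp (- (2 * ln q))" by (simp flip: exp_of_nat_mult)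
        also have "\<dots> = 1 / (exp (ln q))\<^sup>2" by (simp add: exp_minus field_simps flip: exp_of_nat_mult)
        finally show ?thesis using q by simp
      qed
      moreover have "sqrt (pi / X) ^ 4 = (pi / X)\<^sup>2"
      proof -
        have "sqrt (pi / X) ^ 4 = ((sqrt (pi / X))\<^sup>2)\<^sup>2" by simp
        thus ?thesis using X_pos by simp
      qed
      ultimately have "(exp (- ln q / 2) * s / (2 * pi) * sqrt (pi / X)) ^ 4 = 1 / q\<^sup>2 * s ^ 4 / (2 * pi) ^ 4 * (pi / X)\<^sup>2"
        by (simp only: power_mult_distrib power_divide)
      also have "\<dots> = s\<^sup>2 / (16 * pi\<^sup>2 * q\<^sup>2 * M\<^sup>2)"
        using s M q unfolding X_def by (simp add: field_simps power2_eq_square power4_eq_xxxx)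
      also have "\<dots> = real t / (96 * q ^ 3 * M ^ 3)"
        unfolding s2 a_def using M q by (simp add: field_simps power2_eq_square power3_eq_cube)
      finally have L: "(exp (- ln q / 2) * s / (2 * pi) * sqrt (pi / X)) ^ 4 = real t / (96 * q ^ 3 * M ^ 3)" .
      have qM: "q * (24 * M) > 0" using q M by simp
      have "(real t powr (1/4)) ^ 4 = real t" using t0 by (simp add: powr_power)
      moreover have "((q * (24 * M)) powr (-3/4)) ^ 4 = 1 / (q * (24 * M)) ^ 3"
      proof -
        have "((q * (24 * M)) powr (-3/4)) ^ 4 = (q * (24 * M)) powr (-3)"
          by (subst powr_power) (use qM in auto)
        also have "\<dots> = 1 / (q * (24 * M)) ^ 3"
          using qM powr_realpow[of "q * (24 * M)" 3] by (simp only: powr_minus_divide) simp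
        finally show ?thesis .
      qed
      moreover have "sqrt 12 ^ 4 = (144 :: real)"
        by (simp add: power4_eq_xxxx)
      ultimately have "(sqrt 12 * A_coeff t N) ^ 4 = 144 * (real t * (1 / (q * (24 * M)) ^ 3))"
        unfolding A_coeff_def M24 q_def [symmetric] by (simp only: power_mult_distrib)
      also have "\<dots> = real t / (96 * q ^ 3 * M ^ 3)"
        using q M by (simp add: field_simps power3_eq_cube)
      finally show "(exp (- ln q / 2) * s / (2 * pi) * sqrt (pi / X)) ^ 4 = (sqrt 12 * A_coeff t N) ^ 4"
        using L by simp
    qed (use s X_pos in \<open>auto simp: A_coeff_def\<close>)
    have "main = (exp (- ln q / 2) * s / (2 * pi) * sqrt (pi / X)) * exp (2 * X)"
      unfolding main_def exp_add by (simp only: mult_ac times_divide_eq_left times_divide_eq_right)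
    also have "2 * X = 2 * pi / sqrt 6 * sqrt (real t / (real t + 1) * (real N + real t / 24))"
      unfolding X by simp
    finally show ?thesis unfolding pre regular_main_def .
  qed
  have s_le: "s \<le> 2 * real N powr (-1/2)"
  proof -
    have N0: "real N > 0" using N by simp
    have "s\<^sup>2 \<le> 2 / real N" unfolding s2 using a_bounds M N0 by (intro frac_le) auto
    also have "\<dots> \<le> (2 / sqrt (real N))\<^sup>2" using N0 by (simp add: power_divide divide_right_mono)
    finally have "s \<le> 2 / sqrt (real N)" by (rule power2_le_imp_le) simp
    moreover have "real N powr (-1/2) = 1 / sqrt (real N)"
      using powr_minus_divide[of "real N" "1/2"] by (simp add: powr_half_sqrt)
    ultimately show ?thesis by simp
  qed
  have y: "exp (- e) = y" unfolding y_def e_eq by simp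
  have m: "regular_main N t > 0" by (rule regular_main_pos[OF t])
  have "\<bar>real (num_regular_partitions N t) - regular_main N t\<bar> \<le> 10^9 * (s + y) * regular_main N t"
    using asymptotic unfolding main_eq y .
  also have "\<dots> \<le> 10^9 * (2 * real N powr (-1/2) + y) * regular_main N t"
    using s_le m by (intro mult_right_mono mult_left_mono) auto
  finally show "\<bar>real (num_regular_partitions N t) - regular_main N t\<bar> \<le> 10^9 * (2 * real N powr (-1/2) + y) * regular_main N t" .
  have "real (num_regular_partitions N t) \<le> (1129/1000 + 10^9 * s) * regular_main N t"
    using upper_bound unfolding main_eq .
  also have "\<dots> \<le> (1129/1000 + 10^9 * (2 * real N powr (-1/2))) * regular_main N t"
    using s_le m by (intro mult_right_mono add_left_mono mult_left_mono) auto
  finally show "real (num_regular_partitions N t) \<le> (1129/1000 + 10^9 * (2 * real N powr (-1/2))) * regular_main N t" .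
qed

section \<open>Range (i)\<close>

lemma exp_minus_1_le: "exp x - 1 \<le> x * exp x" for x :: real
proof -
  have "1 - x \<le> exp (- x)" using exp_ge_add_one_self[of "-x"] by simp
  hence "(1 - x) * exp x \<le> exp (- x) * exp x" by (rule mult_right_mono) simp
  thus ?thesis by (simp add: algebra_simps flip: exp_add)
qed

text \<open>Dividing the threshold condition by q turns it into (1/2 + \<epsilon>) ln M \<le>
  \<eta>. Hence exp (- \<eta>) \<le> N^(-1/2), and N \<ge> exp 16 gives \<eta> \<ge> 8 > 2
  pi.\<close>

lemma threshold_imp_decay:
  fixes N t :: nat and \<epsilon> :: real
  assumes \<epsilon>: "\<epsilon> > 0" and t: "t \<ge> 1" and N: "real N \<ge> exp 16" and th: "real t + 1 \<le> threshold \<epsilon> N t"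
  defines "\<eta> \<equiv> 2 * pi * sqrt ((24 * real N + real t) / (real t * (real t + 1)))"
  shows "2 * pi \<le> \<eta>" "exp (- \<eta>) \<le> real N powr (-1/2)"
proof -
  define M where "M = real N + real t / 24"
  define q where "q = real t + 1"
  have N0: "real N > 0" using N exp_gt_zero[of "16::real"] by linarith
  have M: "M \<ge> real N" "M > 0" using N0 by (auto simp: M_def)
  have q: "q > 0" and t0: "real t > 0" using t by (auto simp: q_def)
  define L where "L = ln M"
  have "16 \<le> ln (real N)" using N N0 by (subst ln_ge_iff) auto
  also have "ln (real N) \<le> L" unfolding L_def using M N0 by simp
  finally have L: "16 \<le> L" .
  have sq: "sqrt (24 * q * M / real t) = q * sqrt (24 * M / (real t * q))"
  proof -
    have "24 * q * M / real t = q\<^sup>2 * (24 * M / (real t * q))" using q t0 by (simp add: power2_eq_square)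
    thus ?thesis using q by (simp only: real_sqrt_mult real_sqrt_abs abs_of_pos)
  qed
  have eta: "\<eta> = 2 * pi * sqrt (24 * M / (real t * q))"
    by (simp add: \<eta>_def M_def q_def algebra_simps)
  have pos: "(1/2 + \<epsilon>) * L > 0" using \<epsilon> L by simp
  have "q \<le> 2 * pi / ((1/2 + \<epsilon>) * L) * (q * sqrt (24 * M / (real t * q)))"
    using th unfolding threshold_def M_def [symmetric] q_def [symmetric] L_def [symmetric] sq .
  also have "\<dots> = q * (\<eta> / ((1/2 + \<epsilon>) * L))" by (simp add: eta)
  finally have "q * 1 \<le> q * (\<eta> / ((1/2 + \<epsilon>) * L))" by simp
  hence "1 \<le> \<eta> / ((1/2 + \<epsilon>) * L)" using q by (simp only: mult_le_cancel_left_pos)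
  hence "(1/2 + \<epsilon>) * L \<le> \<eta>" using pos by (simp add: le_divide_eq)
  moreover have "1/2 * L \<le> (1/2 + \<epsilon>) * L" using \<epsilon> L by (intro mult_right_mono) auto
  ultimately have \<eta>: "L / 2 \<le> \<eta>" by simp
  thus "2 * pi \<le> \<eta>" using L pi_less_4 by linarith
  have "exp (- \<eta>) \<le> exp (- (ln (real N) / 2))" using \<eta> \<open>ln (real N) \<le> L\<close> by simp
  also have "\<dots> = real N powr (-1/2)" using N0 by (simp add: powr_def)
  finally show "exp (- \<eta>) \<le> real N powr (-1/2)" .
qed

theorem regular_partitions_small_modulus:
  fixes \<epsilon> :: real
  assumes \<epsilon>: "\<epsilon> > 0"
  shows "\<exists>E1 E2. error_term E1 \<and> error_term E2 \<and>
        (\<forall>N t :: nat. N \<ge> 1 \<longrightarrow> t \<ge> 1 \<longrightarrow> t + 1 \<le> N \<longrightarrow>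
           real t + 1 \<le> threshold \<epsilon> N t \<longrightarrow>
           (\<exists>\<rho>::real. 1 < \<rho> \<and> \<rho> < 1.00873 \<and>
              real (num_regular_partitions N t) =
                sqrt 12 * A_coeff t N *
                exp (2 * pi / sqrt 6 *
                     sqrt (real t / (real t + 1) * (real N + real t / 24))) /
                exp (\<rho> * exp (- 2 * pi * sqrt ((24 * real N + real t) /
                                                 (real t * (real t + 1))) + E1 N t)) *
                (1 + E2 N t)))"
    (is "\<exists>E1 E2. _ \<and> _ \<and> (\<forall>N t. _ \<longrightarrow> _ \<longrightarrow> _ \<longrightarrow> _ \<longrightarrow> (\<exists>\<rho>. _ \<and> _ \<and> ?R E1 E2 N t \<rho>))")
proof -
  define \<eta> where "\<eta> = (\<lambda>N t :: nat. 2 * pi * sqrt ((24 * real N + real t) / (real t * (real t + 1))))"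
  define y where "y = (\<lambda>N t. exp (- \<eta> N t))"
  define \<rho> :: real where "\<rho> = 1.005"
  \<comment> \<open>Solved from the asserted equation, and 0 outside the range to make the bound
    uniform in t. With p / m = 1 + O(d), y \<le> d and d = N^(-1/2), the factor exp (\<rho> y) is
    also 1 + O(d).\<close>
  define E2 where "E2 = (\<lambda>N t. if t \<ge> 1 \<and> t + 1 \<le> N \<and> real t + 1 \<le> threshold \<epsilon> N t
     then real (num_regular_partitions N t) * exp (\<rho> * y N t) / regular_main N t - 1 else 0)"
  define K :: real where "K = 10^9 * 3 * exp 2 + 2 * exp 2"
  have "error_term E2" unfolding error_term_iff
  proof (intro exI[of _ K] exI[of _ "nat \<lceil>exp 16 :: real\<rceil>"] allI impI)
    fix N t :: nat assume "N \<ge> nat \<lceil>exp 16 :: real\<rceil>"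
    hence N: "real N \<ge> exp 16" by linarith
    show "\<bar>E2 N t\<bar> \<le> K * real N powr (-1/2)"
    proof (cases "t \<ge> 1 \<and> t + 1 \<le> N \<and> real t + 1 \<le> threshold \<epsilon> N t")
      case False
      thus ?thesis by (auto simp: E2_def K_def)
    next
      case True
      define p m d Y where "p = real (num_regular_partitions N t)" and "m = regular_main N t"
        and "d = real N powr (-1/2)" and "Y = y N t"
      have m: "m > 0" using True regular_main_pos by (simp add: m_def)
      have dec: "2 * pi \<le> \<eta> N t" "Y \<le> d"
        using threshold_imp_decay[OF \<epsilon> _ N] True by (auto simp: Y_def y_def \<eta>_def d_def)
      have Y: "0 < Y" "Y \<le> 1"
      proof -
        have "\<eta> N t \<ge> 0" using dec(1) pi_gt_zero by linarith
        thus "0 < Y" "Y \<le> 1" by (auto simp: Y_def y_def)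
      qed
      have "\<bar>p - m\<bar> \<le> 10^9 * (2 * d + Y) * m"
        using regular_partitions_estimate(1)[of t N] True dec(1) by (simp add: p_def m_def d_def Y_def y_def \<eta>_def)
      also have "\<dots> \<le> 10^9 * (3 * d) * m" using dec(2) m by (intro mult_right_mono mult_left_mono) auto
      finally have "\<bar>p - m\<bar> / m \<le> 10^9 * 3 * d" using m by (simp add: divide_le_eq)
      moreover have "p / m - 1 = (p - m) / m" using m by (simp add: diff_divide_distrib)
      ultimately have 1: "\<bar>p / m - 1\<bar> \<le> 10^9 * 3 * d" using m by simp
      have \<rho>Y: "\<rho> * Y \<le> 2" "0 \<le> \<rho> * Y" using Y by (auto simp: \<rho>_def)
      have ex: "exp (\<rho> * Y) \<le> exp 2" using \<rho>Y by simp
      have "exp (\<rho> * Y) - 1 \<le> (\<rho> * Y) * exp (\<rho> * Y)" by (rule exp_minus_1_le)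
      also have "\<dots> \<le> (2 * d) * exp 2"
        using ex \<rho>Y Y dec(2) by (intro mult_mono) (auto simp: \<rho>_def)
      finally have 2: "\<bar>exp (\<rho> * Y) - 1\<bar> \<le> 2 * d * exp 2" using \<rho>Y by simp
      have "E2 N t = (p / m - 1) * exp (\<rho> * Y) + (exp (\<rho> * Y) - 1)"
        using True by (simp add: E2_def p_def m_def Y_def algebra_simps)
      also have "\<bar>\<dots>\<bar> \<le> \<bar>p / m - 1\<bar> * exp (\<rho> * Y) + \<bar>exp (\<rho> * Y) - 1\<bar>"
        by (intro order.trans[OF abs_triangle_ineq]) (simp add: abs_mult)
      also have "\<dots> \<le> 10^9 * 3 * d * exp 2 + 2 * d * exp 2"
        using 1 2 ex by (intro add_mono mult_mono) (auto simp: d_def)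
      also have "\<dots> = K * d" by (simp add: K_def algebra_simps)
      finally show ?thesis by (simp add: d_def)
    qed
  qed
  moreover have "error_term (\<lambda>_ _. 0)" unfolding error_term_iff by (intro exI[of _ 0]) simp
  moreover have "?R (\<lambda>_ _. 0) E2 N t \<rho>" if "t \<ge> 1" "t + 1 \<le> N" "real t + 1 \<le> threshold \<epsilon> N t" for N t
  proof -
    have m: "regular_main N t > 0" by (rule regular_main_pos[OF that(1)])
    have "exp (- 2 * pi * sqrt ((24 * real N + real t) / (real t * (real t + 1))) + 0) = y N t"
      by (simp add: y_def \<eta>_def)
    moreover have "1 + E2 N t = real (num_regular_partitions N t) * exp (\<rho> * y N t) / regular_main N t"
      using that by (simp add: E2_def)
    ultimately show ?thesis using m unfolding regular_main_def [symmetric] by simp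
  qed
  moreover have "1 < \<rho>" "\<rho> < 1.00873" by (auto simp: \<rho>_def)
  ultimately show ?thesis by blast
qed

section \<open>Range (ii)\<close>

lemma upper_prefactor:
  fixes t M :: real
  assumes t: "t \<ge> 2" and M: "M > 0"
  shows "t powr (1/4) * ((t + 1) * M) powr (-3/4) \<le> (2 * t + 1) powr (3/4) / (sqrt (t - 1) * (M * (2 * t + 2)) powr (3/4))"
proof -
  define B where "B = (t + 1) * M"
  have B: "B > 0" using t M by (simp add: B_def)
  have "M * (2 * t + 2) = 2 * B" by (simp add: B_def algebra_simps)
  hence d: "(M * (2 * t + 2)) powr (3/4) = 2 powr (3/4) * B powr (3/4)" using B by (simp add: powr_mult)
  have n: "2 powr (3/4) * t powr (3/4) \<le> (2 * t + 1) powr (3/4)"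
  proof -
    have "(2 * t) powr (3/4) \<le> (2 * t + 1) powr (3/4)" using t by (intro powr_mono2) auto
    thus ?thesis using t by (simp add: powr_mult)
  qed
  \<comment> \<open>After this rewriting the two sides differ only in 2t against 2t + 1 and sqrt t
    against sqrt (t - 1); the latter is positive because t \<ge> 2.\<close>
  have "t powr (3/4) = t powr (1/4) * sqrt t"
    using t by (simp add: powr_half_sqrt [symmetric] flip: powr_add)
  hence "t powr (1/4) * B powr (-3/4) = (2 powr (3/4) * t powr (3/4)) / (sqrt t * (2 powr (3/4) * B powr (3/4)))"
    using t B powr_minus_divide[of B "3/4"] by (simp add: field_simps)
  also have "\<dots> \<le> (2 * t + 1) powr (3/4) / (sqrt (t - 1) * (2 powr (3/4) * B powr (3/4)))"
    using t B n by (intro frac_le mult_right_mono mult_pos_pos) auto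
  finally show ?thesis unfolding d B_def .
qed

text \<open>The squares of the two roots differ by M / (2 q), their sum is at most 2 sqrt M, and q
  \<le> sqrt (24 M). So the roots differ by at least 1 / (4 sqrt 24), and 2 pi / sqrt 6 times this
  is pi / 24.\<close>

lemma upper_exponent:
  fixes t M :: real
  assumes t: "t \<ge> 1" and M: "M > 0" and tM: "(t + 1)\<^sup>2 \<le> 24 * M"
  shows "2 * pi / sqrt 6 * sqrt (t / (t + 1) * M) + pi / 24 \<le> 2 * pi / sqrt 6 * sqrt ((2 * t + 1) / (2 * t + 2) * M)"
proof -
  define q where "q = t + 1"
  define S0 S1 where "S0 = sqrt (t / q * M)" and "S1 = sqrt ((2 * t + 1) / (2 * t + 2) * M)"
  have q: "q > 0" using t by (simp add: q_def)
  have r1: "(2 * t + 1) / (2 * t + 2) > 0" "(2 * t + 1) / (2 * t + 2) \<le> 1" "t / q \<ge> 0" "t / q \<le> 1"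
    using t by (auto simp: q_def)
  have S: "S0 \<ge> 0" "S1 > 0"
    unfolding S0_def S1_def real_sqrt_gt_0_iff real_sqrt_ge_0_iff using r1 M by (intro mult_nonneg_nonneg mult_pos_pos; simp)+
  have "S0 \<le> sqrt M" "S1 \<le> sqrt M"
    unfolding S0_def S1_def real_sqrt_le_iff
    using mult_right_mono[OF r1(4), of M] mult_right_mono[OF r1(2), of M] M by simp_all
  note S = S this
  have sM: "sqrt M > 0" using M by simp
  have "S1\<^sup>2 - S0\<^sup>2 = (2 * t + 1) / (2 * t + 2) * M - t / q * M"
    using t M q by (simp add: S0_def S1_def)
  also have "(2 * t + 1) / (2 * t + 2) * M - t / q * M = M / (2 * q)"
    using t q by (simp add: q_def divide_simps) (simp add: algebra_simps)
  finally have diff: "(S1 - S0) * (S1 + S0) = M / (2 * q)" by (simp add: power2_eq_square algebra_simps)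
  have q_le: "q \<le> sqrt 24 * sqrt M"
    using tM real_le_rsqrt[of q "24 * M"] by (simp add: q_def real_sqrt_mult)
  have "1 / (4 * sqrt 24) = sqrt M / (4 * (sqrt 24 * sqrt M))" using sM by simp
  also have "\<dots> \<le> sqrt M / (4 * q)" using q_le q sM by (intro divide_left_mono) auto
  also have "\<dots> = (M / (2 * q)) / (2 * sqrt M)" using sM q M by (simp add: field_simps)
  also have "\<dots> \<le> (M / (2 * q)) / (S1 + S0)" using S q M by (intro divide_left_mono mult_pos_pos) auto
  also have "\<dots> = S1 - S0" unfolding diff [symmetric] using S by simp
  finally have "1 / (4 * sqrt 24) \<le> S1 - S0" .
  moreover define k where "k = 2 * pi / sqrt 6"
  ultimately have "k * (1 / (4 * sqrt 24)) \<le> k * (S1 - S0)" by (intro mult_left_mono) auto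
  moreover have "k * (1 / (4 * sqrt 24)) = pi / 24"
  proof -
    have "sqrt 6 * sqrt 24 = (12 :: real)" by (simp flip: real_sqrt_mult)
    thus ?thesis by (simp add: k_def field_simps)
  qed
  ultimately have "k * S0 + pi / 24 \<le> k * S1" by (simp add: right_diff_distrib)
  thus ?thesis unfolding k_def S0_def S1_def q_def .
qed

text \<open>The gain pi / 24 in the exponent beats the factor exp y in the denominator and the
  constant 1.13, which is 1.129 from \<open>upper_bound\<close> plus 1/1000 for its error term at
  large N.\<close>

lemma upper_slack:
  fixes y :: real
  assumes "0 < y" "y \<le> exp (- 6)"
  shows "1.13 \<le> exp (pi / 24) / exp y"
proof -
  have "exp (- 6) = exp (- 3) * exp (- 3 :: real)" by (simp flip: exp_add)
  also have "\<dots> \<le> (2 / 39) * (2 / 39 :: real)" using exp_minus_le_of_ge_3[of 3] by (intro mult_mono) auto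
  finally have y: "y \<le> 1 / 350" using assms by simp
  have "exp y \<le> 1 + y + y\<^sup>2" using assms y by (intro exp_bound) auto
  also have "y\<^sup>2 \<le> 1 / 350 * y" using y assms by (simp add: power2_eq_square mult_right_mono)
  finally have ey: "exp y \<le> 1003 / 1000" using y by simp
  have p: "pi / 24 \<ge> 13 / 100" using pi_approx(1) by simp
  have "1 + 13/100 + (13/100)\<^sup>2 / 2 \<le> exp (13/100 :: real)" by (intro exp_lower_Taylor_quadratic) auto
  also have "\<dots> \<le> exp (pi / 24)" using p by simp
  finally have "1.138 \<le> exp (pi / 24)" by (simp add: power2_eq_square)
  moreover have "1.13 * exp y \<le> 1.13 * (1003 / 1000)" using ey by simp
  ultimately have "1.13 * exp y \<le> exp (pi / 24)" by simp
  thus ?thesis by (simp add: field_simps)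
qed

theorem regular_partitions_middle_range:
  fixes \<epsilon> :: real
  assumes \<epsilon>: "\<epsilon> > 0"
  shows "\<exists>E. error_term E \<and>
        (\<forall>\<^sub>F N :: nat in sequentially. \<forall>t :: nat. N \<ge> 1 \<longrightarrow> t \<ge> 1 \<longrightarrow> t + 1 \<le> N \<longrightarrow>
           threshold \<epsilon> N t < real t + 1 \<longrightarrow> real t + 1 \<le> sqrt (24 * real N) \<longrightarrow>
           real (num_regular_partitions N t) \<le>
             sqrt 12 * (2 * real t + 1) powr (3/4) *
             exp (2 * pi / sqrt 6 *
                  sqrt ((2 * real t + 1) / (2 * real t + 2) * (real N + real t / 24))) /
             (sqrt (real t - 1) * ((24 * real N + real t) * (2 * real t + 2)) powr (3/4) *
              exp (exp (- 2 * pi * sqrt ((24 * real N + real t) /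
                                           (real t * (real t + 1)))))) *
             (1 + E N t))"
    (is "\<exists>E. _ \<and> (\<forall>\<^sub>F N in _. ?P E N)" is "\<exists>E. _ \<and> (\<forall>\<^sub>F N in _. \<forall>t. _ \<longrightarrow> _ \<longrightarrow> _ \<longrightarrow> _ \<longrightarrow> _ \<longrightarrow> ?R E N t)")
proof (intro exI[of _ "\<lambda>_ _. 0"] conjI)
  show "error_term (\<lambda>_ _. 0)" unfolding error_term_iff by (intro exI[of _ 0]) simp
  \<comment> \<open>For t = 1 the root sqrt (t - 1) vanishes and division by 0 would make the
    asserted bound 0. But the threshold at t = 1 tends to infinity, so that for large N this case
    belongs to range (i).\<close>
  have "filterlim (\<lambda>N. 2 * pi / ((1/2 + \<epsilon>) * ln (real N + 1 / 24)) * sqrt (24 * (1 + 1) * (real N + 1 / 24) / 1)) at_top sequentially"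
    using \<epsilon> by real_asymp
  hence "\<forall>\<^sub>F N in sequentially. threshold \<epsilon> N 1 > 2"
    by (simp add: threshold_def filterlim_at_top_dense)
  moreover have "(\<lambda>N. 10^9 * (2 * real N powr (-1/2))) \<longlonglongrightarrow> 0" by real_asymp
  hence "\<forall>\<^sub>F N in sequentially. 10^9 * (2 * real N powr (-1/2)) < 1 / 1000"
    by (rule order_tendstoD) simp
  ultimately show "\<forall>\<^sub>F N in sequentially. ?P (\<lambda>_ _. 0) N"
  proof eventually_elim
    case (elim N)
    show ?case
    proof (intro allI impI)
      fix t :: nat
      assume N1: "N \<ge> 1" and t1: "t \<ge> 1" and tN: "t + 1 \<le> N" and th: "threshold \<epsilon> N t < real t + 1"
        and le: "real t + 1 \<le> sqrt (24 * real N)"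
      have "t \<noteq> 1" using th elim(1) by auto
      hence t: "real t \<ge> 2" using t1 by simp
      define M where "M = real N + real t / 24"
      have M: "M > 0" "real N \<le> M" using N1 by (auto simp: M_def)
      have M24: "24 * real N + real t = 24 * M" by (simp add: M_def)
      have "(real t + 1)\<^sup>2 \<le> (sqrt (24 * real N))\<^sup>2" using le by (intro power_mono) auto
      hence tN24: "(real t + 1)\<^sup>2 \<le> 24 * real N" by simp
      hence tM: "(real t + 1)\<^sup>2 \<le> 24 * M" using M by simp
      define r where "r = sqrt ((24 * real N + real t) / (real t * (real t + 1)))"
      \<comment> \<open>From t (t + 1) \<le> (t + 1)^2 \<le> 24 N. This is the place where the upper
        end of the range provides \<eta> = 2 pi r \<ge> 2 pi.\<close>
      have "1 \<le> (24 * real N + real t) / (real t * (real t + 1))"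
      proof -
        have "real t * (real t + 1) \<le> 24 * real N + real t" using tN24 by (simp add: power2_eq_square algebra_simps)
        moreover have "0 < real t * (real t + 1)" using t by (intro mult_pos_pos) auto
        ultimately show ?thesis by (simp only: le_divide_eq_1_pos)
      qed
      hence r: "1 \<le> r" by (simp add: r_def)
      define y where "y = exp (- 2 * pi * r)"
      have pr: "2 * pi * 1 \<le> 2 * pi * r" using r by (intro mult_left_mono) auto
      have y: "0 < y" "y \<le> exp (- 6)"
      proof -
        have "6 \<le> 2 * pi * r" using pr pi_gt3 by linarith
        thus "y \<le> exp (- 6)" by (simp add: y_def)
      qed (simp add: y_def)
      have mp: "regular_main N t > 0" by (rule regular_main_pos[OF t1])
      define e0 e1 where "e0 = 2 * pi / sqrt 6 * sqrt (real t / (real t + 1) * M)"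
        and "e1 = 2 * pi / sqrt 6 * sqrt ((2 * real t + 1) / (2 * real t + 2) * M)"
      define pre where "pre = (2 * real t + 1) powr (3/4) / (sqrt (real t - 1) * ((24 * M) * (2 * real t + 2)) powr (3/4))"
      have "real (num_regular_partitions N t) \<le> (1129/1000 + 10^9 * (2 * real N powr (-1/2))) * regular_main N t"
        using regular_partitions_estimate(2)[OF t1 tN] pr by (simp add: r_def)
      also have "\<dots> \<le> 1.13 * regular_main N t" using elim(2) mp by (intro mult_right_mono) auto
      also have "\<dots> = 1.13 * (sqrt 12 * A_coeff t N * exp e0)" by (simp add: regular_main_def e0_def M_def)
      also have "\<dots> \<le> (exp (pi / 24) / exp y) * (sqrt 12 * pre * exp e0)"
      proof (intro mult_mono mult_right_mono mult_left_mono upper_slack y)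
        show "A_coeff t N \<le> pre"
          unfolding A_coeff_def pre_def M24 using upper_prefactor[OF t, of "24 * M"] M by simp
      qed (use t in \<open>auto simp: A_coeff_def pre_def\<close>)
      also have "\<dots> = sqrt 12 * pre * exp (e0 + pi / 24) / exp y" by (simp add: exp_add)
      also have "\<dots> \<le> sqrt 12 * pre * exp e1 / exp y"
        using upper_exponent[of "real t" M] t M tM
        by (intro divide_right_mono mult_left_mono) (auto simp: e0_def e1_def pre_def)
      also have "\<dots> = sqrt 12 * (2 * real t + 1) powr (3/4) * exp e1 /
             (sqrt (real t - 1) * ((24 * M) * (2 * real t + 2)) powr (3/4) * exp y) * (1 + 0)"
        by (simp add: pre_def)
      finally show "?R (\<lambda>_ _. 0) N t"
        unfolding M24 [symmetric] unfolding e1_def y_def r_def M_def .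
    qed
  qed
qed

section \<open>Range (iii)\<close>

lemma num_partitions_pos: "num_partitions N > 0"
proof -
  have "replicate_mset N 1 \<in> partitions N"
    by (auto simp: partitions_def sum_mset_replicate_mset)
  thus ?thesis unfolding num_partitions_def using finite_partitions card_gt_0_iff by blast
qed

theorem regular_partitions_large_modulus:
  "\<exists>E1 E2. error_term E1 \<and> error_term E2 \<and>
      (\<forall>N t :: nat. N \<ge> 1 \<longrightarrow> t \<ge> 1 \<longrightarrow> t + 1 \<le> N \<longrightarrow>
         real t + 1 > sqrt (24 * real N) \<longrightarrow>
         (\<exists>\<nu>::real. 1 < \<nu> \<and> \<nu> < 1.00873 \<and>
            real (num_regular_partitions N t) =
              real (num_partitions N) *
              exp (- \<nu> * exp (- (pi * (real t + 1) / sqrt (6 * real N)) * (1 + E1 N t))) *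
              (1 + E2 N t)))"
    (is "\<exists>E1 E2. _ \<and> _ \<and> (\<forall>N t. _ \<longrightarrow> _ \<longrightarrow> _ \<longrightarrow> _ \<longrightarrow> (\<exists>\<nu>. ?Q E1 E2 N t \<nu>))"
     is "\<exists>E1 E2. _ \<and> _ \<and> (\<forall>N t. _ \<longrightarrow> _ \<longrightarrow> _ \<longrightarrow> _ \<longrightarrow> (\<exists>\<nu>. _ \<and> _ \<and> ?R E1 E2 N t \<nu>))")
proof -
  define v where "v = (\<lambda>N t :: nat. (real t + 1) * (pi / sqrt (6 * real N)))"
  define E2 where "E2 = (\<lambda>N t. if t \<ge> 1 \<and> t + 1 \<le> N \<and> real t + 1 > sqrt (24 * real N)
     then real (num_regular_partitions N t) / (real (num_partitions N) * exp (- lambert (v N t))) - 1 else 0)"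
  \<comment> \<open>Here v = q s, and sqrt (24 N) * pi / sqrt (6 N) = 2 pi > 6.\<close>
  have v6: "v N t > 6" if "t + 1 \<le> N" "real t + 1 > sqrt (24 * real N)" for N t
  proof -
    have N: "real N > 0" using that by simp
    have "sqrt (24 * real N) = 2 * sqrt (6 * real N)"
    proof -
      have "24 * real N = 4 * (6 * real N)" by simp
      thus ?thesis by (simp only: real_sqrt_mult real_sqrt_four)
    qed
    hence "2 * sqrt (6 * real N) * (pi / sqrt (6 * real N)) < v N t"
      unfolding v_def using that N by (intro mult_strict_right_mono) auto
    moreover have "2 * sqrt (6 * real N) * (pi / sqrt (6 * real N)) = 2 * pi" using N by simp
    ultimately show ?thesis using pi_gt3 by linarith
  qed
  define C where "C = partition_const * (pi / sqrt 6)"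
  have C_pos: "C > 0" by (simp add: C_def partition_const_def add_pos_pos)
  have lim: "(\<lambda>N. C * real N powr (-1/2)) \<longlonglongrightarrow> 0" using C_pos by real_asymp
  hence "\<forall>\<^sub>F N in sequentially. C * real N powr (-1/2) < 1 / 2"
    by (rule order_tendstoD) simp
  then obtain N0 where N0: "\<And>N. N \<ge> N0 \<Longrightarrow> C * real N powr (-1/2) < 1 / 2"
    by (auto simp: eventually_at_top_linorder)
  have "error_term E2" unfolding error_term_iff
  proof (intro exI[of _ "8 * C"] exI[of _ N0] allI impI)
    fix N t :: nat assume NN: "N \<ge> N0"
    show "\<bar>E2 N t\<bar> \<le> 8 * C * real N powr (-1/2)"
    proof (cases "t \<ge> 1 \<and> t + 1 \<le> N \<and> real t + 1 > sqrt (24 * real N)")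
      case False
      thus ?thesis using C_pos by (auto simp: E2_def)
    next
      case True
      define a b m \<alpha> d where "a = real (num_partitions N)" and "b = real (num_regular_partitions N t)"
        and "m = partition_main N" and "\<alpha> = exp (- lambert (v N t))" and "d = C * real N powr (-1/2)"
      have N2: "N \<ge> 2" using True by simp
      have v: "v N t > 6" using v6 True by blast
      have d: "partition_const * (pi / sqrt (6 * real N)) = d"
        using powr_minus_divide[of "real N" "1/2"]
        by (simp add: d_def C_def real_sqrt_mult powr_half_sqrt)
      have d2: "0 \<le> d" "d \<le> 1 / 2" using N0[OF NN] C_pos by (auto simp: d_def)
      have m: "m > 0" unfolding m_def partition_main_def Let_def using N2 by simp
      have A: "\<bar>a - m\<bar> \<le> d * m"
        using partition_asymptotic[OF N2] unfolding d a_def m_def .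
      have B: "\<bar>b - \<alpha> * m\<bar> \<le> d * m"
        using regular_partition_asymptotic[OF N2, of t] True v unfolding d b_def m_def \<alpha>_def v_def by simp
      have \<alpha>: "1 / 2 \<le> \<alpha>" "\<alpha> \<le> 1"
      proof -
        have "exp (- v N t) \<le> 2 / 39" using v exp_minus_le_of_ge_3[of "v N t"] by simp
        hence "lambert (v N t) \<le> 1 / 2" using lambert_bounds(2)[OF v] by simp
        moreover have "1 + - lambert (v N t) \<le> \<alpha>" unfolding \<alpha>_def by (rule exp_ge_add_one_self)
        ultimately show "1 / 2 \<le> \<alpha>" by linarith
        have "0 < lambert (v N t)" using lambert_bounds(1)[OF v] exp_gt_zero[of "- v N t"] by linarith
        thus "\<alpha> \<le> 1" by (simp add: \<alpha>_def)
      qed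
      \<comment> \<open>Both counts are known up to d m. For the quotient, p(N) \<ge> m / 2 and
        \<alpha> \<ge> 1/2 give a denominator of at least m / 4, and the numerator is at most 2 d m,
        which explains the 8.\<close>
      have "d * m \<le> 1 / 2 * m" using d2 m by (intro mult_right_mono) auto
      hence a: "m / 2 \<le> a" using A by linarith
      have "(m / 2) * (1 / 2) \<le> a * \<alpha>" using a \<alpha> m by (intro mult_mono) auto
      hence a\<alpha>: "m / 4 \<le> a * \<alpha>" "0 < a * \<alpha>" using m by auto
      have "b - a * \<alpha> = (b - \<alpha> * m) - \<alpha> * (a - m)" by (simp add: algebra_simps)
      also have "\<bar>\<dots>\<bar> \<le> \<bar>b - \<alpha> * m\<bar> + \<bar>\<alpha> * (a - m)\<bar>" by (rule abs_triangle_ineq4)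
      also have "\<bar>\<alpha> * (a - m)\<bar> \<le> 1 * (d * m)" unfolding abs_mult using A \<alpha> by (intro mult_mono) auto
      finally have "\<bar>b - a * \<alpha>\<bar> \<le> 2 * (d * m)" using B by linarith
      also have "\<dots> = 8 * d * (m / 4)" by simp
      also have "\<dots> \<le> 8 * d * (a * \<alpha>)" using a\<alpha> d2 by (intro mult_left_mono) auto
      finally have "\<bar>b - a * \<alpha>\<bar> / (a * \<alpha>) \<le> 8 * d" using a\<alpha> by (simp only: pos_divide_le_eq)
      moreover have "E2 N t = (b - a * \<alpha>) / (a * \<alpha>)"
        using True num_partitions_pos[of N] by (simp add: E2_def a_def b_def \<alpha>_def diff_divide_distrib)
      ultimately have "\<bar>E2 N t\<bar> \<le> 8 * d" using a\<alpha>(2) by (simp only: abs_divide abs_of_pos)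
      thus ?thesis by (simp add: d_def)
    qed
  qed
  moreover have "error_term (\<lambda>_ _. 0)" unfolding error_term_iff by (intro exI[of _ 0]) simp
  \<comment> \<open>With \<nu> = lambert v / exp (- v) the exponent is - lambert v. As v equals pi
    (t + 1) / sqrt (6 N) exactly, the inner error term is 0.\<close>
  moreover have "\<exists>\<nu>. ?Q (\<lambda>_ _. 0) E2 N t \<nu>" if "t \<ge> 1" "t + 1 \<le> N" "real t + 1 > sqrt (24 * real N)" for N t
  proof (intro exI[of _ "lambert (v N t) / exp (- v N t)"] conjI)
    note b = lambert_bounds[OF v6[OF that(2,3)]]
    show "1 < lambert (v N t) / exp (- v N t)" using b(1) by (simp add: less_divide_eq)
    show "lambert (v N t) / exp (- v N t) < 1.00873" using b(2) by (simp add: divide_less_eq)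
    have "- (pi * (real t + 1) / sqrt (6 * real N)) * (1 + 0) = - v N t" by (simp add: v_def)
    hence "exp (- (lambert (v N t) / exp (- v N t)) * exp (- (pi * (real t + 1) / sqrt (6 * real N)) * (1 + 0))) = exp (- lambert (v N t))"
      by (simp only:) simp
    moreover have "1 + E2 N t = real (num_regular_partitions N t) / (real (num_partitions N) * exp (- lambert (v N t)))"
      using that by (simp add: E2_def)
    ultimately show "?R (\<lambda>_ _. 0) E2 N t (lambert (v N t) / exp (- v N t))"
      using num_partitions_pos[of N] by (simp only:) simp
  qed
  ultimately show ?thesis by blast
qed

theorem theorem1p2:
  shows
   "(\<forall>\<epsilon>::real. \<epsilon> > 0 \<longrightarrow>
      (\<exists>E1 E2. error_term E1 \<and> error_term E2 \<and>
        (\<forall>N t :: nat. N \<ge> 1 \<longrightarrow> t \<ge> 1 \<longrightarrow> t + 1 \<le> N \<longrightarrow>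
           real t + 1 \<le> threshold \<epsilon> N t \<longrightarrow>
           (\<exists>\<rho>::real. 1 < \<rho> \<and> \<rho> < 1.00873 \<and>
              real (num_regular_partitions N t) =
                sqrt 12 * A_coeff t N *
                exp (2 * pi / sqrt 6 *
                     sqrt (real t / (real t + 1) * (real N + real t / 24))) /
                exp (\<rho> * exp (- 2 * pi * sqrt ((24 * real N + real t) /
                                                 (real t * (real t + 1))) + E1 N t)) *
                (1 + E2 N t)))))
    \<and>
    (\<forall>\<epsilon>::real. \<epsilon> > 0 \<longrightarrow>
      (\<exists>E. error_term E \<and>
        (\<forall>\<^sub>F N :: nat in sequentially. \<forall>t :: nat. N \<ge> 1 \<longrightarrow> t \<ge> 1 \<longrightarrow> t + 1 \<le> N \<longrightarrow>
           threshold \<epsilon> N t < real t + 1 \<longrightarrow> real t + 1 \<le> sqrt (24 * real N) \<longrightarrow>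
           real (num_regular_partitions N t) \<le>
             sqrt 12 * (2 * real t + 1) powr (3/4) *
             exp (2 * pi / sqrt 6 *
                  sqrt ((2 * real t + 1) / (2 * real t + 2) * (real N + real t / 24))) /
             (sqrt (real t - 1) * ((24 * real N + real t) * (2 * real t + 2)) powr (3/4) *
              exp (exp (- 2 * pi * sqrt ((24 * real N + real t) /
                                           (real t * (real t + 1)))))) *
             (1 + E N t))))
    \<and>
    (\<exists>E1 E2. error_term E1 \<and> error_term E2 \<and>
      (\<forall>N t :: nat. N \<ge> 1 \<longrightarrow> t \<ge> 1 \<longrightarrow> t + 1 \<le> N \<longrightarrow>
         real t + 1 > sqrt (24 * real N) \<longrightarrow>
         (\<exists>\<nu>::real. 1 < \<nu> \<and> \<nu> < 1.00873 \<and>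
            real (num_regular_partitions N t) =
              real (num_partitions N) *
              exp (- \<nu> * exp (- (pi * (real t + 1) / sqrt (6 * real N)) * (1 + E1 N t))) *
              (1 + E2 N t))))"
  by (intro conjI allI impI regular_partitions_small_modulus regular_partitions_middle_range
      regular_partitions_large_modulus)

end
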